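(* Let $\{E_k\}_k$ be an at most countable family of closed subsets of the unit circle $\mathbb T$ such that $\alpha(E_k)<\infty$ for every $k$. Let $U$ be a unitary operator, let $\mu$ be its scalar spectral measure, and suppose $\mu(\mathbb T)=\mu\bigl(\bigcup_k E_k\bigr)$. Let $T$ be a power bounded operator such that $T\sim U$. Then $T\approx U$ and $$\sup_{n\le 0}\|T^n\|\le\Bigl(\sup_{n\ge 0}\|T^n\|\Bigr)^8.$$
   Context: All Hilbert spaces are complex and separable; operators are linear and bounded. $T$ is power bounded if $\sup_{n\ge 0}\|T^n\|<\infty$. For operators $T$ on $\mathcal H$ and $R$ on $\mathcal K$: $T\approx R$ (similar) means there is a bounded invertible $X:\mathcal H\to\mathcal K$ with bounded inverse and $XT=RX$; $T\prec R$ means there is a bounded linear $X:\mathcal H\to\mathcal K$ with $\ker X=\{0\}$, dense range, and $XT=RX$; $T\sim R$ (quasisimilar) means $T\prec R$ and $R\prec T$. A bound on $\sup_{n\le 0}\|T^n\|$ includes the assertion that $T$ is invertible with bounded inverse. The scalar spectral measure of a unitary operator $U$ is a finite positive Borel measure $\mu$ on $\mathbb T$ that is mutually absolutely continuous with the (projection-valued) spectral measure of $U$. For a closed set $E\subset\mathbb T$ and $\varepsilon>0$, let $N_\varepsilon$ be the smallest number of closed arcs of length $\varepsilon$ whose union contains $E$, and set $\alpha(E)=\liminf_{\varepsilon\to 0}\dfrac{N_\varepsilon}{\log\frac1\varepsilon}$. *)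

theory Defs
  imports "HOL-Analysis.Analysis"
begin

text \<open>
  A complex inner product space is presented as a real one (with inner product the real part of
  the complex one, so that norm and topology are the library's) carrying a complex scalar
  multiplication.  The complex inner product is linear in its first argument.
\<close>

class complex_inner = real_inner +
  fixes scaleC :: "complex \<Rightarrow> 'a \<Rightarrow> 'a"  (infixr "*\<^sub>C" 75)
    and cinner :: "'a \<Rightarrow> 'a \<Rightarrow> complex"
  assumes scaleC_add_right: "c *\<^sub>C (x + y) = c *\<^sub>C x + c *\<^sub>C y"
    and scaleC_add_left: "(c + d) *\<^sub>C x = c *\<^sub>C x + d *\<^sub>C x"
    and scaleC_scaleC: "c *\<^sub>C d *\<^sub>C x = (c * d) *\<^sub>C x"
    and scaleC_of_real: "complex_of_real r *\<^sub>C x = r *\<^sub>R x"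
    and cinner_commute: "cinner x y = cnj (cinner y x)"
    and cinner_add_left: "cinner (x + y) z = cinner x z + cinner y z"
    and cinner_scaleC_left: "cinner (c *\<^sub>C x) y = c * cinner x y"
    and inner_eq_Re_cinner: "inner x y = Re (cinner x y)"

text \<open>For metric spaces, separability is second countability.\<close>

class separable_complex_hilbert = complex_inner + polish_space

definition bounded_clinear :: "('a::complex_inner \<Rightarrow> 'b::complex_inner) \<Rightarrow> bool" where
  "bounded_clinear A \<longleftrightarrow> bounded_linear A \<and> (\<forall>c x. A (c *\<^sub>C x) = c *\<^sub>C A x)"

text \<open>Two-sided invertibility with bounded inverse.\<close>

definition boundedly_invertible :: "('a::complex_inner \<Rightarrow> 'b::complex_inner) \<Rightarrow> bool" where
  "boundedly_invertible X \<longleftrightarrow> bounded_clinear X \<and> bij X \<and> bounded_clinear (inv X)"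

definition similar_op ::
    "('a::complex_inner \<Rightarrow> 'a) \<Rightarrow> ('b::complex_inner \<Rightarrow> 'b) \<Rightarrow> bool"  (infix "\<approx>\<^sub>o" 50) where
  "T \<approx>\<^sub>o R \<longleftrightarrow> (\<exists>X. boundedly_invertible X \<and> X \<circ> T = R \<circ> X)"

definition quasiaffine_op ::
    "('a::complex_inner \<Rightarrow> 'a) \<Rightarrow> ('b::complex_inner \<Rightarrow> 'b) \<Rightarrow> bool"  (infix "\<prec>\<^sub>o" 50) where
  "T \<prec>\<^sub>o R \<longleftrightarrow> (\<exists>X. bounded_clinear X \<and> {x. X x = 0} = {0} \<and> closure (range X) = UNIV \<and>
     X \<circ> T = R \<circ> X)"

definition quasisimilar_op ::
    "('a::complex_inner \<Rightarrow> 'a) \<Rightarrow> ('b::complex_inner \<Rightarrow> 'b) \<Rightarrow> bool"  (infix "\<sim>\<^sub>o" 50) where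
  "T \<sim>\<^sub>o R \<longleftrightarrow> T \<prec>\<^sub>o R \<and> R \<prec>\<^sub>o T"

definition power_bounded :: "('a::complex_inner \<Rightarrow> 'a) \<Rightarrow> bool" where
  "power_bounded T \<longleftrightarrow> bdd_above (range (\<lambda>n. onorm (T ^^ n)))"

text \<open>Integer powers; for negative exponents meaningful only if \<open>T\<close> is bijective.\<close>

definition op_powi :: "('a \<Rightarrow> 'a) \<Rightarrow> int \<Rightarrow> 'a \<Rightarrow> 'a" where
  "op_powi T n = (if n \<ge> 0 then T ^^ nat n else inv T ^^ nat (- n))"

definition unitary_op :: "('a::complex_inner \<Rightarrow> 'a) \<Rightarrow> bool" where
  "unitary_op U \<longleftrightarrow>
     bounded_clinear U \<and> surj U \<and> (\<forall>x y. cinner (U x) (U y) = cinner x y)"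

definition orthogonal_projection :: "('a::complex_inner \<Rightarrow> 'a) \<Rightarrow> bool" where
  "orthogonal_projection P \<longleftrightarrow>
     bounded_clinear P \<and> P \<circ> P = P \<and> (\<forall>x y. cinner (P x) y = cinner x (P y))"

abbreviation unit_circle :: "complex set" where
  "unit_circle \<equiv> sphere 0 1"

abbreviation circle_borel :: "complex measure" where
  "circle_borel \<equiv> restrict_space borel unit_circle"

definition projection_valued_measure :: "(complex set \<Rightarrow> 'a::complex_inner \<Rightarrow> 'a) \<Rightarrow> bool" where
  "projection_valued_measure P \<longleftrightarrow>
     (\<forall>B \<in> sets circle_borel. orthogonal_projection (P B)) \<and>
     P unit_circle = id \<and>
     (\<forall>A. range A \<subseteq> sets circle_borel \<longrightarrow> disjoint_family A \<longrightarrow>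
        (\<forall>x. (\<lambda>n::nat. P (A n) x) sums P (\<Union>n. A n) x))"

text \<open>The positive measure \<open>B \<mapsto> \<langle>P(B)x, x\<rangle>\<close> on the circle.\<close>

definition pvm_measure :: "(complex set \<Rightarrow> 'a::complex_inner \<Rightarrow> 'a) \<Rightarrow> 'a \<Rightarrow> complex measure" where
  "pvm_measure P x =
     measure_of unit_circle (sets circle_borel) (\<lambda>B. ennreal (Re (cinner (P B x) x)))"

lemma projection_form:
  assumes "orthogonal_projection P"
  shows "Re (cinner (P x) x) = (norm (P x))\<^sup>2"
proof -
  have "P (P x) = P x"
    using assms unfolding orthogonal_projection_def by (metis comp_apply)
  then have "cinner (P x) x = cinner (P x) (P x)"
    using assms unfolding orthogonal_projection_def by metis
  then show ?thesis
    by (metis inner_eq_Re_cinner power2_norm_eq_inner)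
qed

text \<open>The set function above is countably additive, so \<open>pvm_measure\<close> is not degenerate.\<close>

lemma emeasure_pvm_measure:
  assumes P: "projection_valued_measure P" and B: "B \<in> sets circle_borel"
  shows "emeasure (pvm_measure P x) B = ennreal (Re (cinner (P B x) x))"
proof (rule emeasure_measure_of[OF pvm_measure_def])
  let ?f = "\<lambda>B. Re (cinner (P B x) x)"
  have nn: "?f A \<ge> 0" if "A \<in> sets circle_borel" for A
    using P that projection_form[of "P A" x] unfolding projection_valued_measure_def by simp
  have sums: "(\<lambda>n. ?f (A n)) sums ?f (\<Union>n. A n)"
    if "range A \<subseteq> sets circle_borel" "disjoint_family A" for A :: "nat \<Rightarrow> complex set"
  proof -
    have "(\<lambda>n. P (A n) x) sums P (\<Union>n. A n) x"
      using P that unfolding projection_valued_measure_def by blast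
    then have "(\<lambda>n. inner (P (A n) x) x) sums inner (P (\<Union>n. A n) x) x"
      by (rule bounded_linear.sums[OF bounded_linear_inner_left])
    then show ?thesis by (simp add: inner_eq_Re_cinner)
  qed
  show "sets circle_borel \<subseteq> Pow unit_circle"
    using sets.sets_into_space[of _ circle_borel] by (auto simp: space_restrict_space)
  show "B \<in> sets (pvm_measure P x)"
    using B \<open>sets circle_borel \<subseteq> Pow unit_circle\<close>
    by (simp add: pvm_measure_def sets_measure_of sigma_sets.Basic)
  have sets_eq: "sets (pvm_measure P x) = sets circle_borel"
    using \<open>sets circle_borel \<subseteq> Pow unit_circle\<close> sets.sigma_sets_eq[of circle_borel]
    by (simp add: pvm_measure_def sets_measure_of space_restrict_space)
  have "(\<lambda>n::nat. ?f {}) sums ?f (\<Union>n::nat. {})"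
    by (rule sums) (auto simp: disjoint_family_on_def)
  then have "?f {} = 0"
    using summable_LIMSEQ_zero[OF sums_summable] LIMSEQ_unique tendsto_const by metis
  then show "positive (sets (pvm_measure P x)) (\<lambda>B. ennreal (?f B))"
    by (simp add: positive_def)
  show "countably_additive (sets (pvm_measure P x)) (\<lambda>B. ennreal (?f B))"
    unfolding countably_additive_def sets_eq
  proof (intro allI impI)
    fix A :: "nat \<Rightarrow> complex set"
    assume A: "range A \<subseteq> sets circle_borel" "disjoint_family A"
    then have "0 \<le> ?f (A n)" for n using nn by blast
    then show "(\<Sum>n. ennreal (?f (A n))) = ennreal (?f (\<Union>n. A n))"
      using sums[OF A] by (rule suminf_ennreal_eq)
  qed
qed

text \<open>
  \<open>P\<close> is the spectral measure of \<open>U\<close>: \<open>U = \<integral> z dP(z)\<close>, the integral being understood weakly,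
  through the quadratic form \<open>\<langle>Ux, x\<rangle>\<close> (which determines \<open>U\<close> by polarization).
\<close>

definition spectral_measure_of ::
    "('a::complex_inner \<Rightarrow> 'a) \<Rightarrow> (complex set \<Rightarrow> 'a \<Rightarrow> 'a) \<Rightarrow> bool" where
  "spectral_measure_of U P \<longleftrightarrow> projection_valued_measure P \<and>
     (\<forall>x. cinner (U x) x = (LINT z|pvm_measure P x. z))"

text \<open>
  The spectral measure of a unitary operator exists and is unique, so the existential quantifier
  over \<open>P\<close> just names it.
\<close>

definition scalar_spectral_measure ::
    "('a::complex_inner \<Rightarrow> 'a) \<Rightarrow> complex measure \<Rightarrow> bool" where
  "scalar_spectral_measure U \<mu> \<longleftrightarrow>
     sets \<mu> = sets circle_borel \<and> finite_measure \<mu> \<and>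
     (\<exists>P. spectral_measure_of U P \<and>
        (\<forall>B \<in> sets circle_borel. emeasure \<mu> B = 0 \<longleftrightarrow> P B = (\<lambda>x. 0)))"

definition closed_arc :: "real \<Rightarrow> real \<Rightarrow> complex set" where
  "closed_arc a l = cis ` {a..a + l}"

definition arc_covering_number :: "complex set \<Rightarrow> real \<Rightarrow> nat" where
  "arc_covering_number S \<epsilon> =
     (LEAST n. \<exists>a::nat \<Rightarrow> real. S \<subseteq> (\<Union>i<n. closed_arc (a i) \<epsilon>))"

definition arc_alpha :: "complex set \<Rightarrow> ereal" where
  "arc_alpha S =
     Liminf (at_right 0) (\<lambda>\<epsilon>. ereal (real (arc_covering_number S \<epsilon>) / ln (1 / \<epsilon>)))"

end

theory Submission
  imports Defs
begin

text \<open>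
  Let \<open>M\<close> bound the powers \<open>T\<^sup>n\<close>, \<open>n \<ge> 0\<close>, and let \<open>Y\<close> be injective with dense range and \<open>Y U = T Y\<close>. All
  arguments take place on the space of \<open>U\<close>, where \<open>n \<mapsto> \<parallel>Y U\<^sup>n h\<parallel>\<close>, defined for all integers \<open>n\<close>, is almost
  decreasing: a later value is at most \<open>M\<close> times an earlier one. Means of the forms
  \<open>\<langle>Y U\<^sup>n g, Y U\<^sup>n h\<rangle>\<close> over \<open>n \<rightarrow> \<infinity>\<close> and over \<open>n \<rightarrow> -\<infinity>\<close> have cluster points, which are given by positive
  operators \<open>D\<close> and \<open>D'\<close> commuting with \<open>U\<close> (\<open>invariant_limit_operator\<close>). Almost monotonicity gives
  \<open>\<langle>D h, h\<rangle> \<le> M\<^sup>2 \<parallel>Y h\<parallel>\<^sup>2\<close> and \<open>\<parallel>Y h\<parallel>\<^sup>2 \<le> M\<^sup>2 \<langle>D' h, h\<rangle>\<close>.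

  The crucial point is \<open>D' \<le> M\<^sup>4 D\<close>. For a bilateral shift \<open>U\<close> it can fail even if \<open>M = 1\<close>, so the
  thinness of the spectrum has to enter here. Operators commuting with \<open>U\<close> commute with its spectral
  measure (\<open>commutant_commutes_P\<close>), so it suffices to treat eigenvectors, where both forms are
  \<open>\<parallel>Y h\<parallel>\<^sup>2\<close>, and atomless vectors \<open>h\<close> supported on a single closed set \<open>E\<close> with \<open>arc_alpha E < \<infinity>\<close>.

  For such \<open>E\<close> there is a sequence of \<open>\<epsilon>\<close> for which \<open>E\<close> is covered by \<open>O(log (1/\<epsilon>))\<close> arcs of length \<open>\<epsilon>\<close>. The
  number of dyadic scales above \<open>\<epsilon>\<close> is of the same order, so on average a scale reveals a bounded number of new
  points of \<open>E\<close>. Hence for every \<open>W\<close> there are arbitrarily small \<open>\<delta>\<close> such that, outside boundedly many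
  small balls, \<open>E\<close> consists of clusters of diameter about \<open>\<delta>\<close> with gaps at least \<open>W \<delta>\<close>
  (\<open>few_crowded_points\<close>, \<open>cluster_decomposition\<close>). The exceptional balls carry little mass, as \<open>h\<close> has
  no atoms. Take \<open>N\<close> between \<open>1 / (W \<delta>)\<close> and \<open>1 / \<delta>\<close>. For \<open>\<bar>n\<bar> \<le> N\<close>, the operator \<open>U\<^sup>n\<close> is almost a scalar on
  each cluster, so \<open>Y U\<^sup>n h\<close> is an exponential sum with well separated frequencies, and the mean of
  \<open>\<parallel>Y U\<^sup>n h\<parallel>\<^sup>2\<close> over about \<open>N\<close> exponents is close to the sum of \<open>\<parallel>Y h\<^sub>s\<parallel>\<^sup>2\<close> over the cluster components
  \<open>h\<^sub>s\<close> of \<open>h\<close> (\<open>fejer_average\<close>). This value is the same for positive and for negative exponents. With almost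
  monotonicity it follows that \<open>\<parallel>Y U\<^sup>-\<^sup>i h\<parallel> \<le> M\<^sup>2 \<parallel>Y U\<^sup>j h\<parallel>\<close> for all \<open>i, j \<ge> 0\<close>
  (\<open>thin_support_two_sided_bound\<close>), and so \<open>D' \<le> M\<^sup>4 D\<close>.

  Altogether \<open>\<parallel>Y h\<parallel>\<^sup>2 \<le> M\<^sup>6 \<langle>D h, h\<rangle> \<le> M\<^sup>8 \<parallel>Y h\<parallel>\<^sup>2\<close>. As the middle term is invariant under \<open>U\<close>, this
  gives \<open>\<parallel>T\<^sup>-\<^sup>n\<parallel> \<le> M\<^sup>4\<close>, which is at most \<open>M\<^sup>8\<close>. The square root \<open>Z\<close> of \<open>D\<close> commutes with \<open>U\<close>, and
  \<open>\<parallel>Z h\<parallel>\<close> is comparable with \<open>\<parallel>Y h\<parallel>\<close>; so \<open>Y h \<mapsto> Z h\<close> extends to a similarity of \<open>T\<close> with \<open>U\<close>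
  (\<open>similar_to_unitary\<close>).
\<close>

section \<open>Hilbert space preliminaries\<close>

text \<open>
  The point of \<open>C\<close> nearest to \<open>x\<close> exists by completeness: by the parallelogram law a minimizing
  sequence is Cauchy. Minimality along every line through it gives orthogonality.
\<close>

lemma orthogonal_decomposition_closed_subspace:
  fixes C :: "'a::{real_inner, complete_space} set"
  assumes "closed C" and "subspace C"
  obtains c where "c \<in> C" and "\<And>u. u \<in> C \<Longrightarrow> inner (x - c) u = 0"
proof -
  have C0: "0 \<in> C" and Cadd: "\<And>u v. u \<in> C \<Longrightarrow> v \<in> C \<Longrightarrow> u + v \<in> C"
    and Cscale: "\<And>r u. u \<in> C \<Longrightarrow> r *\<^sub>R u \<in> C"
    using assms(2) by (auto simp: subspace_def)
  define d where "d = (INF u\<in>C. (norm (x - u))\<^sup>2)"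
  have bdd: "bdd_below ((\<lambda>u. (norm (x - u))\<^sup>2) ` C)"
    by (rule bdd_belowI[of _ 0]) auto
  have d_le: "d \<le> (norm (x - u))\<^sup>2" if "u \<in> C" for u
    unfolding d_def by (rule cINF_lower[OF bdd that])
  have "\<exists>u\<in>C. (norm (x - u))\<^sup>2 < d + inverse (real (Suc n))" for n
    using cINF_less_iff[OF _ bdd, of "d + inverse (real (Suc n))"] C0
    by (auto simp: d_def)
  then obtain u where u: "\<And>n. u n \<in> C" "\<And>n. (norm (x - u n))\<^sup>2 < d + inverse (real (Suc n))"
    by metis
  have par: "(norm (u m - u n))\<^sup>2 \<le> 2 * inverse (real (Suc m)) + 2 * inverse (real (Suc n))" for m n
  proof -
    have "(1/2) *\<^sub>R (u m + u n) \<in> C" using u Cadd Cscale by blast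
    from d_le[OF this] have "4 * d \<le> 4 * (norm (x - (1/2) *\<^sub>R (u m + u n)))\<^sup>2" by simp
    also have "\<dots> = (norm ((x - u m) + (x - u n)))\<^sup>2"
    proof -
      have "(x - u m) + (x - u n) = 2 *\<^sub>R (x - (1/2) *\<^sub>R (u m + u n))"
        by (simp add: algebra_simps scaleR_2)
      then show ?thesis by (simp add: power_mult_distrib)
    qed
    finally have "4 * d \<le> (norm ((x - u m) + (x - u n)))\<^sup>2" .
    moreover have "(norm ((x - u m) + (x - u n)))\<^sup>2 + (norm ((x - u m) - (x - u n)))\<^sup>2
        = 2 * (norm (x - u m))\<^sup>2 + 2 * (norm (x - u n))\<^sup>2"
      by (simp only: power2_norm_eq_inner) (simp add: inner_simps inner_commute algebra_simps)
    moreover have "norm ((x - u m) - (x - u n)) = norm (u m - u n)"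
      by (simp add: norm_minus_commute)
    ultimately show ?thesis using u(2)[of m] u(2)[of n] by simp
  qed
  have "Cauchy u"
  proof (rule metric_CauchyI)
    fix e :: real assume e: "e > 0"
    then obtain N where N: "inverse (real (Suc N)) < e\<^sup>2 / 4"
      using reals_Archimedean[of "e\<^sup>2/4"] by auto
    have "dist (u m) (u n) < e" if "m \<ge> N" "n \<ge> N" for m n
    proof -
      have "inverse (real (Suc m)) \<le> inverse (real (Suc N))"
        "inverse (real (Suc n)) \<le> inverse (real (Suc N))"
        using that by (auto intro!: le_imp_inverse_le)
      then have "(norm (u m - u n))\<^sup>2 < e\<^sup>2" using par[of m n] N by linarith
      then show ?thesis using e power2_less_imp_less[of "norm (u m - u n)" e] by (simp add: dist_norm)
    qed
    then show "\<exists>N. \<forall>m\<ge>N. \<forall>n\<ge>N. dist (u m) (u n) < e" by blast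
  qed
  then obtain c where c: "u \<longlonglongrightarrow> c" using Cauchy_convergent convergent_def by blast
  have cC: "c \<in> C" using closed_sequentially[OF assms(1)] u(1) c by blast
  have "(\<lambda>n. (norm (x - u n))\<^sup>2) \<longlonglongrightarrow> (norm (x - c))\<^sup>2" by (intro tendsto_intros c)
  moreover have "(\<lambda>n. d + inverse (real (Suc n))) \<longlonglongrightarrow> d + 0"
    by (intro tendsto_intros LIMSEQ_inverse_real_of_nat)
  ultimately have cd: "(norm (x - c))\<^sup>2 \<le> d"
    using LIMSEQ_le[of "\<lambda>n. (norm (x - u n))\<^sup>2" "(norm (x - c))\<^sup>2" "\<lambda>n. d + inverse (real (Suc n))" "d + 0"]
      less_imp_le[OF u(2)] by simp
  have "inner (x - c) v = 0" if v: "v \<in> C" for v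
  proof -
    have *: "2 * t * inner (x - c) v \<le> t\<^sup>2 * (norm v)\<^sup>2" for t
    proof -
      have "c + t *\<^sub>R v \<in> C" using cC v Cadd Cscale by blast
      then have "(norm (x - c))\<^sup>2 \<le> (norm (x - (c + t *\<^sub>R v)))\<^sup>2"
        using cd d_le order_trans by blast
      also have "\<dots> = (norm (x - c))\<^sup>2 - 2 * t * inner (x - c) v + t\<^sup>2 * (norm v)\<^sup>2"
        by (simp only: power2_norm_eq_inner)
           (simp add: inner_simps inner_commute algebra_simps power2_eq_square)
      finally show ?thesis by simp
    qed
    have "v = 0 \<or> (inner (x - c) v)\<^sup>2 \<le> 0"
    proof (cases "v = 0")
      case False
      then have nz: "(norm v)\<^sup>2 > 0" by simp
      define a where "a = inner (x - c) v"
      have "(a / (norm v)\<^sup>2)\<^sup>2 * (norm v)\<^sup>2 = a\<^sup>2 / (norm v)\<^sup>2"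
        using nz by (simp add: power2_eq_square)
      then have "2 * (a\<^sup>2 / (norm v)\<^sup>2) \<le> a\<^sup>2 / (norm v)\<^sup>2"
        using *[of "a / (norm v)\<^sup>2"] by (simp add: a_def[symmetric] power2_eq_square)
      then have "a\<^sup>2 / (norm v)\<^sup>2 \<le> 0" by simp
      then show ?thesis using nz by (simp add: a_def divide_le_0_iff)
    qed simp
    then show ?thesis by auto
  qed
  then show thesis using that cC by blast
qed

lemma riesz_representation:
  fixes f :: "'a::{real_inner, complete_space} \<Rightarrow> real"
  assumes "bounded_linear f"
  obtains y where "\<And>x. f x = inner y x"
proof (cases "\<forall>x. f x = 0")
  case True then show thesis using that[of 0] by simp
next
  case False
  interpret f: bounded_linear f by fact
  obtain z where z: "f z \<noteq> 0" using False by blast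
  have "closed {x. f x = 0}"
    by (intro closed_Collect_eq continuous_on_const linear_continuous_on assms)
  moreover have "subspace {x. f x = 0}"
    by (auto simp: subspace_def f.add f.scaleR f.zero)
  ultimately obtain c where "c \<in> {x. f x = 0}" "\<And>u. u \<in> {x. f x = 0} \<Longrightarrow> inner (z - c) u = 0"
    using orthogonal_decomposition_closed_subspace by metis
  then have c: "f c = 0" "\<And>u. f u = 0 \<Longrightarrow> inner (z - c) u = 0" by auto
  define w where "w = z - c"
  have fw: "f w = f z" by (simp add: w_def f.diff c)
  then have "w \<noteq> 0" using z f.zero by metis
  have "f x = inner ((f w / (norm w)\<^sup>2) *\<^sub>R w) x" for x
  proof -
    have "f (x - (f x / f w) *\<^sub>R w) = 0" using fw z by (simp add: f.diff f.scaleR)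
    from c(2)[OF this] have "inner w x = f x / f w * inner w w"
      by (simp add: w_def[symmetric] inner_simps)
    then show ?thesis using fw z \<open>w \<noteq> 0\<close> by (simp add: power2_norm_eq_inner)
  qed
  then show thesis using that by blast
qed

text \<open>
  The component of a vector orthogonal to the range of a self-adjoint operator lies in its kernel.
\<close>

lemma injective_selfadjoint_dense_range:
  fixes Z :: "'a::{real_inner, complete_space} \<Rightarrow> 'a"
  assumes "bounded_linear Z" and sa: "\<And>x y. inner (Z x) y = inner x (Z y)"
    and inj: "\<And>x. Z x = 0 \<Longrightarrow> x = 0"
  shows "closure (range Z) = UNIV"
proof -
  interpret bounded_linear Z by fact
  have "subspace (closure (range Z))"
    unfolding subspace_def closure_sequential
  proof (intro conjI ballI allI)
    show "\<exists>u. (\<forall>n. u n \<in> range Z) \<and> u \<longlonglongrightarrow> 0"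
      by (auto intro!: exI[of _ "\<lambda>_. 0"] range_eqI[of _ _ 0] simp: zero)
  next
    fix x y assume "x \<in> closure (range Z)" "y \<in> closure (range Z)"
    then obtain u v where uv: "\<And>n. u n \<in> range Z" "u \<longlonglongrightarrow> x" "\<And>n. v n \<in> range Z" "v \<longlonglongrightarrow> y"
      unfolding closure_sequential by blast
    have "u n + v n \<in> range Z" for n
    proof -
      obtain a b where "u n = Z a" "v n = Z b" using uv(1)[of n] uv(3)[of n] by blast
      then show ?thesis using add[of a b] rangeI[of Z "a + b"] by simp
    qed
    then show "\<exists>w. (\<forall>n. w n \<in> range Z) \<and> w \<longlonglongrightarrow> x + y"
      using tendsto_add[OF uv(2,4)] by (intro exI[of _ "\<lambda>n. u n + v n"] conjI allI)
  next
    fix c x assume "x \<in> closure (range Z)"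
    then obtain u where u: "\<And>n. u n \<in> range Z" "u \<longlonglongrightarrow> x"
      unfolding closure_sequential by blast
    have "c *\<^sub>R u n \<in> range Z" for n
    proof -
      obtain a where "u n = Z a" using u(1)[of n] by blast
      then show ?thesis using scaleR[of c a] rangeI[of Z "c *\<^sub>R a"] by simp
    qed
    then show "\<exists>w. (\<forall>n. w n \<in> range Z) \<and> w \<longlonglongrightarrow> c *\<^sub>R x"
      using tendsto_scaleR[OF tendsto_const u(2)] by (intro exI[of _ "\<lambda>n. c *\<^sub>R u n"] conjI allI)
  qed
  have "x \<in> closure (range Z)" for x
  proof -
    obtain c where c: "c \<in> closure (range Z)"
        "\<And>u. u \<in> closure (range Z) \<Longrightarrow> inner (x - c) u = 0"
      by (rule orthogonal_decomposition_closed_subspace[OF closed_closure \<open>subspace (closure (range Z))\<close>, of x])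
         (erule that, blast)
    have "inner (Z (x - c)) (Z (x - c)) = inner (x - c) (Z (Z (x - c)))" by (rule sa)
    also have "\<dots> = 0" by (intro c(2) subsetD[OF closure_subset]) blast
    finally have "x - c = 0" by (rule inj[OF iffD1[OF inner_eq_zero_iff]])
    then show ?thesis using c by simp
  qed
  then show ?thesis by auto
qed

section \<open>Square roots of positive operators\<close>

text \<open>
  A fixed point \<open>S\<close> of \<open>S \<mapsto> (A + S\<^sup>2) / 2\<close> satisfies \<open>(1 - S)\<^sup>2 = 1 - A\<close>. The iterates are polynomials
  in \<open>A\<close> with nonnegative coefficients, so their convergence for \<open>\<parallel>A\<parallel> \<le> 1\<close> follows from the
  scalar case \<open>A = 1\<close>.
\<close>

fun sqrt_iteration :: "('a::real_vector \<Rightarrow> 'a) \<Rightarrow> nat \<Rightarrow> 'a \<Rightarrow> 'a" where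
  "sqrt_iteration A 0 x = 0"
| "sqrt_iteration A (Suc n) x = (1/2) *\<^sub>R (A x + sqrt_iteration A n (sqrt_iteration A n x))"

text \<open>
  Scaling reduces to \<open>0 \<le> D \<le> 1\<close>; then \<open>A = 1 - D\<close> is a contraction and the iteration above
  converges. Being a limit of polynomials in \<open>A\<close>, the root commutes with all operators that
  commute with \<open>D\<close>; this is what later makes it intertwine a unitary operator with itself.
\<close>

lemma positive_operator_sqrt:
  fixes D :: "'a::{real_inner, complete_space} \<Rightarrow> 'a"
  assumes D: "bounded_linear D" and sa: "\<And>x y. inner (D x) y = inner x (D y)"
    and pos: "\<And>x. inner (D x) x \<ge> 0"
  obtains Z where "bounded_linear Z" "\<And>x y. inner (Z x) y = inner x (Z y)"
    "\<And>x. Z (Z x) = D x"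
    "\<And>C x. bounded_linear C \<Longrightarrow> (\<And>x. C (D x) = D (C x)) \<Longrightarrow> C (Z x) = Z (C x)"
proof -
  interpret D: bounded_linear D by fact
  obtain K where K: "K > 0" "\<And>x. norm (D x) \<le> norm x * K" using D.pos_bounded by blast
  \<comment> \<open>Dividing by the norm bound \<open>K\<close> gives \<open>0 \<le> A \<le> 1\<close>.\<close>
  define A where "A x = x - (1/K) *\<^sub>R D x" for x
  have A: "bounded_linear A" unfolding A_def
    by (intro bounded_linear_sub bounded_linear_ident bounded_linear_const_scaleR D)
  interpret A: bounded_linear A by fact
  have Asa: "inner (A x) y = inner x (A y)" for x y by (simp add: A_def inner_simps sa)
  have A0: "inner (A x) x \<ge> 0" for x
  proof -
    have "inner (D x) x \<le> norm (D x) * norm x" by (rule norm_cauchy_schwarz)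
    also have "\<dots> \<le> (norm x * K) * norm x" using K by (intro mult_right_mono) auto
    finally have "inner (D x) x \<le> K * inner x x"
      by (simp add: power2_norm_eq_inner[symmetric] power2_eq_square mult_ac)
    then show ?thesis using K by (simp add: A_def inner_simps field_simps)
  qed
  have A1: "inner (A x) x \<le> (norm x)\<^sup>2" for x
    using pos[of x] K by (simp add: A_def inner_simps power2_norm_eq_inner)
  have Anorm: "norm (A x) \<le> norm x" for x
  proof (cases "A x = 0")
    case False
    then have x0: "x \<noteq> 0" using A.zero by metis
    \<comment> \<open>Polarization in the direction of \<open>A x\<close>, rescaled to the length of \<open>x\<close>.\<close>
    define y where "y = (norm x / norm (A x)) *\<^sub>R A x"
    have ny: "norm y = norm x" using False by (simp add: y_def)
    have "4 * inner (A x) y = inner (A (x + y)) (x + y) - inner (A (x - y)) (x - y)"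
      using Asa[of x y] by (simp add: A.add A.diff inner_simps inner_commute)
    also have "\<dots> \<le> (norm (x + y))\<^sup>2" using A0[of "x - y"] A1[of "x + y"] by linarith
    also have "\<dots> \<le> (norm x + norm y)\<^sup>2" by (intro power_mono norm_triangle_ineq) auto
    also have "\<dots> = 4 * (norm x)\<^sup>2" by (simp add: ny power2_eq_square)
    finally have "inner (A x) y \<le> (norm x)\<^sup>2" by simp
    moreover have "inner (A x) y = norm x * norm (A x)"
      using False by (simp add: y_def power2_norm_eq_inner[symmetric] power2_eq_square)
    ultimately show ?thesis using x0 by (simp add: power2_eq_square)
  qed simp
  define R where "R = sqrt_iteration A"
  \<comment> \<open>The scalar majorant: the iterates for \<open>A = 1\<close>, increasing and bounded by 1.\<close>
  define r where "r = rec_nat (0::real) (\<lambda>_ s. (1 + s\<^sup>2) / 2)"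
  have R0: "R 0 x = 0" and RS: "R (Suc n) x = (1/2) *\<^sub>R (A x + R n (R n x))" for n x
    by (simp_all add: R_def)
  have r0: "r 0 = 0" and rS: "r (Suc n) = (1 + (r n)\<^sup>2) / 2" for n
    by (simp_all add: r_def)
  have R_lin: "bounded_linear (R n)" for n
  proof (induction n)
    case 0 then show ?case by (simp add: R0[abs_def] bounded_linear_zero)
  next
    case (Suc n)
    have "bounded_linear (\<lambda>x. (1/2) *\<^sub>R (A x + R n (R n x)))"
      by (intro bounded_linear_const_scaleR bounded_linear_add A bounded_linear_compose[OF Suc Suc])
    then show ?case by (simp add: RS[abs_def])
  qed
  have R_comm: "C (R n x) = R n (C x)" if C: "bounded_linear C" "\<And>x. C (A x) = A (C x)" for C n x
  proof (induction n arbitrary: x)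
    case 0 then show ?case by (simp add: R0 C(1) linear_simps(3))
  next
    case (Suc n)
    then show ?case by (simp add: RS linear_simps[OF C(1)] C(2))
  qed
  have RA: "A (R n x) = R n (A x)" for n x by (rule R_comm[OF A]) simp
  have RR: "R m (R n x) = R n (R m x)" for m n x
    by (rule R_comm[OF R_lin]) (simp add: RA)
  have R_sa: "inner (R n x) y = inner x (R n y)" for n x y
    by (induction n arbitrary: x y) (simp_all add: R0 RS inner_simps Asa)
  have rr: "0 \<le> r n \<and> r n \<le> r (Suc n) \<and> r n \<le> 1" for n
  proof (induction n)
    case 0 then show ?case by (simp add: r0 rS)
  next
    case (Suc n)
    then have "(r n)\<^sup>2 \<le> (r (Suc n))\<^sup>2" "(r n)\<^sup>2 \<le> 1"
      by (auto intro!: power_mono power_le_one)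
    then show ?case using Suc by (auto simp: rS[of "Suc n"] rS[of n])
  qed
  have Rn: "norm (R n x) \<le> r n * norm x" for n x
  proof (induction n arbitrary: x)
    case 0 then show ?case by (simp add: R0 r0)
  next
    case (Suc n)
    have "norm (R n (R n x)) \<le> r n * norm (R n x)" by (rule Suc)
    also have "\<dots> \<le> r n * (r n * norm x)" using rr by (intro mult_left_mono Suc) auto
    finally have "norm (A x) + norm (R n (R n x)) \<le> norm x + r n * (r n * norm x)"
      using Anorm[of x] by linarith
    then have "norm (A x + R n (R n x)) \<le> norm x + r n * (r n * norm x)"
      using norm_triangle_ineq order_trans by blast
    moreover have "norm (R (Suc n) x) = norm (A x + R n (R n x)) / 2"
      by (simp only: RS norm_scaleR)
    ultimately show ?case by (simp add: rS power2_eq_square algebra_simps)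
  qed
  have Rdiff: "norm (R (Suc n) x - R n x) \<le> (r (Suc n) - r n) * norm x" for n x
  proof (induction n arbitrary: x)
    case 0 then show ?case using Rn[of 1 x] by (simp add: R0 r0)
  next
    case (Suc n)
    let ?y = "R (Suc n) x + R n x"
    have "R (Suc (Suc n)) x - R (Suc n) x
        = (1/2) *\<^sub>R (R (Suc n) (R (Suc n) x) - R n (R n x))"
      by (simp only: RS[of "Suc n"] RS[of n x]) (simp add: algebra_simps)
    also have "R (Suc n) (R (Suc n) x) - R n (R n x) = R (Suc n) ?y - R n ?y"
      by (simp add: linear_simps[OF R_lin] RR[of n "Suc n"])
    finally have e: "norm (R (Suc (Suc n)) x - R (Suc n) x) = norm (R (Suc n) ?y - R n ?y) / 2"
      by simp
    have "norm ?y \<le> (r (Suc n) + r n) * norm x"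
      using Rn[of "Suc n" x] Rn[of n x] norm_triangle_ineq[of "R (Suc n) x" "R n x"]
      by (simp add: algebra_simps)
    then have "(r (Suc n) - r n) * norm ?y \<le> (r (Suc n) - r n) * ((r (Suc n) + r n) * norm x)"
      using rr by (intro mult_left_mono) auto
    then have "norm (R (Suc (Suc n)) x - R (Suc n) x)
        \<le> (r (Suc n) - r n) * ((r (Suc n) + r n) * norm x) / 2"
      using e Suc[of ?y] by simp
    also have "\<dots> = (r (Suc (Suc n)) - r (Suc n)) * norm x"
      by (simp add: rS[of "Suc n"] rS[of n] power2_eq_square field_simps)
    finally show ?case .
  qed
  have Rdiff': "norm (R m x - R n x) \<le> (r m - r n) * norm x" if "n \<le> m" for m n x
    using that
  proof (induction m rule: dec_induct)
    case (step m)
    then show ?case using Rdiff[of m x] norm_triangle_ineq[of "R (Suc m) x - R m x" "R m x - R n x"]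
      by (simp add: algebra_simps)
  qed simp
  have "convergent r"
    by (rule Bseq_monoseq_convergent) (use rr in \<open>auto intro!: BseqI'[of _ 1] simp: monoseq_Suc\<close>)
  then have Cr: "Cauchy r" by (rule convergent_Cauchy)
  have "Cauchy (\<lambda>n. R n x)" for x
  proof (rule metric_CauchyI)
    fix e :: real assume "e > 0"
    then have "e / (norm x + 1) > 0" by (simp add: add_nonneg_pos)
    then obtain N where N: "\<And>m n. m \<ge> N \<Longrightarrow> n \<ge> N \<Longrightarrow> dist (r m) (r n) < e / (norm x + 1)"
      using metric_CauchyD[OF Cr] by blast
    have one: "dist (R m x) (R n x) < e" if "m \<ge> N" "n \<ge> N" "n \<le> m" for m n
    proof -
      have "dist (R m x) (R n x) \<le> (r m - r n) * norm x"
        using Rdiff'[OF that(3)] by (simp add: dist_norm)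
      also have "\<dots> \<le> dist (r m) (r n) * (norm x + 1)"
        by (intro mult_mono) (auto simp: dist_real_def)
      also have "\<dots> < e" using N[OF that(1,2)] by (simp add: pos_less_divide_eq add_nonneg_pos)
      finally show ?thesis .
    qed
    then show "\<exists>M. \<forall>m\<ge>M. \<forall>n\<ge>M. dist (R m x) (R n x) < e"
      by (metis dist_commute nle_le)
  qed
  then have "\<exists>y. (\<lambda>n. R n x) \<longlonglongrightarrow> y" for x using Cauchy_convergent convergent_def by blast
  then obtain S where S: "\<And>x. (\<lambda>n. R n x) \<longlonglongrightarrow> S x" by metis
  have Sn: "norm (S x) \<le> norm x * 1" for x
  proof (rule LIMSEQ_le_const2[OF tendsto_norm[OF S]], intro exI allI impI)
    fix n show "norm (R n x) \<le> norm x * 1"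
      using order_trans[OF Rn[of n x]] mult_right_mono[of "r n" 1 "norm x"] rr[of n] by simp
  qed
  have S_lin: "bounded_linear S"
  proof (rule bounded_linear_intro[OF _ _ Sn])
    show "S (x + y) = S x + S y" for x y
      by (rule LIMSEQ_unique[OF S]) (use tendsto_add[OF S S] in \<open>simp add: linear_simps[OF R_lin]\<close>)
    show "S (c *\<^sub>R x) = c *\<^sub>R S x" for c x
      by (rule LIMSEQ_unique[OF S])
         (use tendsto_scaleR[OF tendsto_const S] in \<open>simp add: linear_simps[OF R_lin]\<close>)
  qed
  interpret S: bounded_linear S by fact
  have S_sa: "inner (S x) y = inner x (S y)" for x y
    by (rule LIMSEQ_unique[OF tendsto_inner[OF S tendsto_const]])
       (use tendsto_inner[OF tendsto_const S] in \<open>simp add: R_sa\<close>)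
  have SS: "(\<lambda>n. R n (R n x)) \<longlonglongrightarrow> S (S x)" for x
  proof -
    have "(\<lambda>n. R n (R n x - S x) + R n (S x)) \<longlonglongrightarrow> 0 + S (S x)"
    proof (intro tendsto_add S)
      have le: "norm (R n (R n x - S x)) \<le> norm (R n x - S x)" for n
        using order_trans[OF Rn[of n]] mult_right_mono[of "r n" 1] rr[of n] by simp
      have lim: "(\<lambda>n. norm (R n x - S x)) \<longlonglongrightarrow> 0"
        by (intro tendsto_norm_zero LIM_zero S)
      show "(\<lambda>n. R n (R n x - S x)) \<longlonglongrightarrow> 0"
        by (rule Lim_null_comparison[OF always_eventually[OF allI] lim], rule le)
    qed
    then show ?thesis by (simp add: linear_simps[OF R_lin])
  qed
  have SA: "2 *\<^sub>R S x = A x + S (S x)" for x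
  proof -
    have "(\<lambda>n. R (Suc n) x) \<longlonglongrightarrow> S x" by (rule LIMSEQ_Suc[OF S])
    moreover have "(\<lambda>n. R (Suc n) x) \<longlonglongrightarrow> (1/2) *\<^sub>R (A x + S (S x))"
      unfolding RS by (intro tendsto_intros SS)
    ultimately have "S x = (1/2) *\<^sub>R (A x + S (S x))" by (rule LIMSEQ_unique)
    then have "2 *\<^sub>R S x = 2 *\<^sub>R ((1/2) *\<^sub>R (A x + S (S x)))" by (rule arg_cong)
    then show ?thesis by (simp only: scaleR_scaleR) simp
  qed
  define Z where "Z x = sqrt K *\<^sub>R (x - S x)" for x
  show thesis
  proof
    show "bounded_linear Z" unfolding Z_def
      by (intro bounded_linear_const_scaleR bounded_linear_sub bounded_linear_ident S_lin)
    show "inner (Z x) y = inner x (Z y)" for x y by (simp add: Z_def inner_simps S_sa)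
    show "Z (Z x) = D x" for x
    proof -
      have "Z (Z x) = K *\<^sub>R (x - 2 *\<^sub>R S x + S (S x))"
      proof -
        have "Z (Z x) = (sqrt K * sqrt K) *\<^sub>R ((x - S x) - S (x - S x))"
          by (simp only: Z_def S.scaleR scaleR_right_diff_distrib[symmetric] scaleR_scaleR)
        then show ?thesis using K by (simp add: S.diff scaleR_2 algebra_simps)
      qed
      also have "\<dots> = K *\<^sub>R (x - A x)" by (simp add: SA)
      also have "\<dots> = D x" using K by (simp add: A_def)
      finally show ?thesis .
    qed
    fix C x assume C: "bounded_linear C" "\<And>x. C (D x) = D (C x)"
    have CA: "C (A x) = A (C x)" for x by (simp add: A_def linear_simps[OF C(1)] C(2))
    have "(\<lambda>n. C (R n x)) \<longlonglongrightarrow> C (S x)" by (rule bounded_linear.tendsto[OF C(1) S])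
    then have "C (S x) = S (C x)"
      using R_comm[OF C(1) CA] LIMSEQ_unique[OF _ S[of "C x"]] by simp
    then show "C (Z x) = Z (C x)" by (simp add: Z_def linear_simps[OF C(1)])
  qed
qed

section \<open>Complex scalars and unitary operators\<close>

lemma cinner_scaleC_right: "cinner x (c *\<^sub>C y) = cnj c * cinner x (y::'a::complex_inner)"
  by (metis cinner_scaleC_left cinner_commute complex_cnj_mult)

lemma inner_scaleC_left: "inner (c *\<^sub>C x) y = inner x (cnj c *\<^sub>C (y::'a::complex_inner))"
  by (simp add: inner_eq_Re_cinner cinner_scaleC_left cinner_scaleC_right)

lemma norm_scaleC: "norm (c *\<^sub>C (x::'a::complex_inner)) = cmod c * norm x"
proof -
  have "(norm (c *\<^sub>C x))\<^sup>2 = Re (cinner (c *\<^sub>C x) (c *\<^sub>C x))"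
    by (simp add: power2_norm_eq_inner inner_eq_Re_cinner)
  also have "cinner (c *\<^sub>C x) (c *\<^sub>C x) = (c * cnj c) * cinner x x"
    by (simp add: cinner_scaleC_left cinner_scaleC_right mult_ac)
  also have "c * cnj c = complex_of_real ((cmod c)\<^sup>2)" by (rule complex_norm_square[symmetric])
  also have "Re (complex_of_real ((cmod c)\<^sup>2) * cinner x x) = (cmod c)\<^sup>2 * Re (cinner x x)"
    by (simp only: times_complex.simps Re_complex_of_real Im_complex_of_real)
  also have "\<dots> = (cmod c * norm x)\<^sup>2"
    by (simp add: power_mult_distrib power2_norm_eq_inner inner_eq_Re_cinner)
  finally show ?thesis by (simp add: power2_eq_iff_nonneg)
qed

lemma scaleC_one: "1 *\<^sub>C x = (x::'a::complex_inner)"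
  using scaleC_of_real[of 1 x] by simp

lemma bounded_linear_scaleC: "bounded_linear (\<lambda>x::'a::complex_inner. c *\<^sub>C x)"
proof (rule bounded_linear_intro[of _ "cmod c"])
  show "c *\<^sub>C r *\<^sub>R x = r *\<^sub>R c *\<^sub>C x" for r and x :: 'a
    by (simp add: scaleC_of_real[symmetric] scaleC_scaleC mult.commute)
qed (simp_all add: scaleC_add_right norm_scaleC)

lemma scaleC_diff_right: "c *\<^sub>C (x - y) = c *\<^sub>C x - c *\<^sub>C (y::'a::complex_inner)"
  by (rule linear_simps(2)[OF bounded_linear_scaleC])

lemma bounded_clinearD:
  assumes "bounded_clinear A"
  shows "bounded_linear A" "A (c *\<^sub>C x) = c *\<^sub>C A x"
  using assms by (auto simp: bounded_clinear_def)

lemma bounded_linear_sum_arg: "bounded_linear A \<Longrightarrow> A (\<Sum>i\<in>I. f i) = (\<Sum>i\<in>I. A (f i))"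
  by (rule Real_Vector_Spaces.linear_sum[OF bounded_linear.linear])

lemma bounded_clinear_funpow:
  fixes A :: "'a::complex_inner \<Rightarrow> 'a"
  assumes "bounded_clinear A" shows "bounded_clinear (A ^^ n)"
proof (induction n)
  case 0 then show ?case by (simp add: bounded_clinear_def bounded_linear_ident id_def)
next
  case (Suc n)
  then show ?case using assms bounded_linear_compose[of A "A ^^ n"]
    by (auto simp: bounded_clinear_def comp_def)
qed

lemma unitary_opD:
  assumes "unitary_op U"
  shows "bounded_clinear U" "inner (U x) (U y) = inner x y" "norm (U x) = norm x" "bij U"
    "U (inv U x) = x" "inv U (U x) = x"
proof -
  show 1: "bounded_clinear U" and 2: "inner (U x) (U y) = inner x y" for x y
    using assms by (auto simp: unitary_op_def inner_eq_Re_cinner)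
  have 3: "norm (U x) = norm x" for x by (simp add: norm_eq_sqrt_inner 2)
  then show "norm (U x) = norm x" .
  have "inj U"
  proof (rule injI)
    fix x y assume "U x = U y"
    then have "norm (U (x - y)) = 0" by (simp add: linear_simps[OF bounded_clinearD(1)[OF 1]])
    then show "x = y" by (simp add: 3)
  qed
  moreover have "surj U" using assms by (simp add: unitary_op_def)
  ultimately show "bij U" "U (inv U x) = x" "inv U (U x) = x"
    by (simp_all add: bij_def surj_f_inv_f)
qed

lemma unitary_op_inv:
  assumes "unitary_op U" shows "unitary_op (inv U)"
proof -
  note u = unitary_opD[OF assms]
  have inv_eq: "inv U x = y \<longleftrightarrow> x = U y" for x y using u(5,6) by metis
  have nrm: "norm (inv U x) \<le> norm x * 1" for x using u(3)[of "inv U x"] by (simp add: u(5))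
  have "bounded_linear (inv U)"
    by (rule bounded_linear_intro[OF _ _ nrm])
       (simp_all add: inv_eq linear_simps[OF bounded_clinearD(1)[OF u(1)]] u(5))
  moreover have "inv U (c *\<^sub>C x) = c *\<^sub>C inv U x" for c x
    by (simp add: inv_eq bounded_clinearD(2)[OF u(1)] u(5))
  moreover have "surj (inv U)" using u(4) by (simp add: bij_imp_bij_inv bij_is_surj)
  moreover have "cinner (inv U x) (inv U y) = cinner x y" for x y
  proof -
    have "cinner (U (inv U x)) (U (inv U y)) = cinner (inv U x) (inv U y)"
      using assms unfolding unitary_op_def by blast
    then show ?thesis by (simp add: u(5))
  qed
  ultimately show ?thesis by (auto simp: unitary_op_def bounded_clinear_def)
qed

lemma unitary_funpow_norm:
  assumes "unitary_op U" shows "norm ((U ^^ n) x) = norm x"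
  by (induction n) (simp_all add: unitary_opD(3)[OF assms])

section \<open>Invariant limits of quadratic forms\<close>

text \<open>
  This instance of Tychonoff's theorem plays the role of a Banach limit below: a bounded sequence of
  functions has a cluster point for pointwise convergence.
\<close>

lemma compact_product_intervals:
  fixes b :: "'i \<Rightarrow> real"
  shows "compact {f. \<forall>p. f p \<in> {- b p .. b p}}"
proof -
  have "{f. \<forall>p. f p \<in> {- b p .. b p}} = (\<Pi>\<^sub>E p\<in>UNIV. {- b p .. b p})" by (auto simp: PiE_def)
  moreover have "compactin (product_topology (\<lambda>p. euclidean) UNIV) (\<Pi>\<^sub>E p\<in>UNIV. {- b p .. b p})"
    by (simp add: compactin_PiE)
  ultimately show ?thesis by (simp add: euclidean_product_topology)
qed

text \<open>
  The Cesaro means of the forms \<open>(g, h) \<mapsto> \<langle>Y W\<^sup>n g, Y W\<^sup>n h\<rangle>\<close> are uniformly bounded, so they have a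
  pointwise cluster point. It is again a bounded form, it is \<open>W\<close>-invariant because consecutive
  means of shifted sequences differ by two boundary terms over \<open>N\<close>, and by Riesz it is given by a
  self-adjoint operator; invariance under the unitary \<open>W\<close> means that this operator commutes with
  \<open>W\<close>. Cluster points inherit bounds that hold for all terms, which is the only way in which the
  value of the limit is controlled.
\<close>

lemma invariant_limit_operator:
  fixes W :: "'b::{complex_inner, complete_space} \<Rightarrow> 'b" and Y :: "'b \<Rightarrow> 'a::complex_inner"
  assumes W: "unitary_op W" and Y: "bounded_clinear Y"
  obtains D where "bounded_clinear D" and "\<And>x y. inner (D x) y = inner x (D y)"
    and "\<And>x. D (W x) = W (D x)"
    and "\<And>x c. (\<And>n. c \<le> (norm (Y ((W ^^ n) x)))\<^sup>2) \<Longrightarrow> c \<le> inner (D x) x"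
    and "\<And>x c. (\<And>n. (norm (Y ((W ^^ n) x)))\<^sup>2 \<le> c) \<Longrightarrow> inner (D x) x \<le> c"
proof -
  note w = unitary_opD[OF W]
  note Yl = linear_simps[OF bounded_clinearD(1)[OF Y]]
  have Wn: "bounded_clinear (W ^^ n)" for n by (rule bounded_clinear_funpow[OF w(1)])
  note Wl = linear_simps[OF bounded_clinearD(1)[OF Wn]]
  obtain K where K: "K > 0" "\<And>x. norm (Y x) \<le> norm x * K"
    using bounded_linear.pos_bounded[OF bounded_clinearD(1)[OF Y]] by blast
  define a where "a n g h = inner (Y ((W ^^ n) g)) (Y ((W ^^ n) h))" for n g h
  define b where "b = (\<lambda>p::'b \<times> 'b. K\<^sup>2 * norm (fst p) * norm (snd p))"
  have a_bd: "\<bar>a n g h\<bar> \<le> b (g, h)" for n g h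
  proof -
    have "\<bar>a n g h\<bar> \<le> norm (Y ((W ^^ n) g)) * norm (Y ((W ^^ n) h))"
      unfolding a_def by (rule Cauchy_Schwarz_ineq2)
    also have "\<dots> \<le> (norm ((W ^^ n) g) * K) * (norm ((W ^^ n) h) * K)"
      using K by (intro mult_mono) auto
    finally show ?thesis
      by (simp add: unitary_funpow_norm[OF W] b_def power2_eq_square mult_ac)
  qed
  define c where "c N p = (\<Sum>n\<le>N. a n (fst p) (snd p)) / real (Suc N)" for N p
  have c_bd: "\<bar>c N p\<bar> \<le> b p" for N p
  proof -
    have "\<bar>\<Sum>n\<le>N. a n (fst p) (snd p)\<bar> \<le> (\<Sum>n\<le>N. b p)"
      by (rule order_trans[OF sum_abs sum_mono]) (use a_bd[of _ "fst p" "snd p"] in simp)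
    then show ?thesis by (simp add: c_def field_simps)
  qed
  let ?S = "{f. \<forall>p. f p \<in> {- b p .. b p}}"
  have S: "compact ?S" by (rule compact_product_intervals)
  have c1: "filtermap c sequentially \<noteq> bot" by (simp add: filtermap_bot_iff)
  have c2: "eventually (\<lambda>f. f \<in> ?S) (filtermap c sequentially)"
    using c_bd by (auto simp: eventually_filtermap abs_le_iff minus_le_iff intro!: always_eventually)
  from iffD1[OF compact_filter S, THEN spec, THEN mp, THEN mp, OF c1 c2]
  obtain \<beta> where \<beta>: "\<beta> \<in> ?S" "inf (nhds \<beta>) (filtermap c sequentially) \<noteq> bot" ..
  \<comment> \<open>Along \<open>G\<close> the means converge pointwise to \<open>\<beta>\<close>, and sequential limits persist.\<close>
  define G where "G = inf (nhds \<beta>) (filtermap c sequentially)"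
  have G: "G \<noteq> bot" using \<beta>(2) by (simp add: G_def)
  have lim: "((\<lambda>f. f p) \<longlongrightarrow> \<beta> p) G" for p
  proof -
    have "((\<lambda>f. f p) \<longlongrightarrow> \<beta> p) (nhds \<beta>)"
    proof (rule topological_tendstoI)
      fix S :: "real set" assume S: "open S" "\<beta> p \<in> S"
      have "open ((\<lambda>f. f p) -` S)"
        by (rule open_vimage[OF S(1) continuous_on_product_coordinates])
      then show "eventually (\<lambda>f. f p \<in> S) (nhds \<beta>)"
        using S(2) eventually_nhds_in_open[of "(\<lambda>f. f p) -` S" \<beta>] by simp
    qed
    then show ?thesis by (rule tendsto_mono[rotated]) (simp add: G_def)
  qed
  have null: "L = 0" if "(\<phi> \<longlongrightarrow> L) G" "(\<lambda>N. \<phi> (c N)) \<longlonglongrightarrow> 0" for \<phi> and L :: real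
  proof -
    have "(\<phi> \<longlongrightarrow> 0) (filtermap c sequentially)" using that(2) by (simp add: filterlim_filtermap)
    then have "(\<phi> \<longlongrightarrow> 0) G" by (rule tendsto_mono[rotated]) (simp add: G_def)
    then show ?thesis using tendsto_unique[OF G that(1)] by simp
  qed
  have ev: "eventually Q G" if "\<And>N. Q (c N)" for Q
  proof -
    have "eventually Q (filtermap c sequentially)" using that by (simp add: eventually_filtermap)
    then show ?thesis unfolding G_def by (rule filter_leD[rotated]) simp
  qed
  have \<beta>_add1: "\<beta> (x + y, h) = \<beta> (x, h) + \<beta> (y, h)" for x y h
  proof -
    have "((\<lambda>f. f (x + y, h) - (f (x, h) + f (y, h))) \<longlongrightarrow> \<beta> (x + y, h) - (\<beta> (x, h) + \<beta> (y, h))) G"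
      by (intro tendsto_intros lim)
    then have "\<beta> (x + y, h) - (\<beta> (x, h) + \<beta> (y, h)) = 0"
      by (rule null) (simp add: c_def a_def Wl Yl inner_simps sum.distrib add_divide_distrib)
    then show ?thesis by simp
  qed
  have \<beta>_sym: "\<beta> (x, y) = \<beta> (y, x)" for x y
  proof -
    have "((\<lambda>f. f (x, y) - f (y, x)) \<longlongrightarrow> \<beta> (x, y) - \<beta> (y, x)) G"
      by (intro tendsto_intros lim)
    then have "\<beta> (x, y) - \<beta> (y, x) = 0" by (rule null) (simp add: c_def a_def inner_commute)
    then show ?thesis by simp
  qed
  have \<beta>_scale: "\<beta> (r *\<^sub>C x, y) = \<beta> (x, cnj r *\<^sub>C y)" for r x y
  proof -
    have "((\<lambda>f. f (r *\<^sub>C x, y) - f (x, cnj r *\<^sub>C y)) \<longlongrightarrow> \<beta> (r *\<^sub>C x, y) - \<beta> (x, cnj r *\<^sub>C y)) G"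
      by (intro tendsto_intros lim)
    then have "\<beta> (r *\<^sub>C x, y) - \<beta> (x, cnj r *\<^sub>C y) = 0"
      by (rule null) (simp add: c_def a_def bounded_clinearD(2)[OF Wn] bounded_clinearD(2)[OF Y]
          inner_scaleC_left)
    then show ?thesis by simp
  qed
  have \<beta>_scaleR: "\<beta> (r *\<^sub>R x, y) = r * \<beta> (x, y)" for r x y
  proof -
    have "((\<lambda>f. f (r *\<^sub>R x, y) - r * f (x, y)) \<longlongrightarrow> \<beta> (r *\<^sub>R x, y) - r * \<beta> (x, y)) G"
      by (intro tendsto_intros lim)
    then have "\<beta> (r *\<^sub>R x, y) - r * \<beta> (x, y) = 0"
      by (rule null) (simp add: c_def a_def Wl Yl flip: sum_distrib_left)
    then show ?thesis by simp
  qed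
  have \<beta>_inv: "\<beta> (W x, W y) = \<beta> (x, y)" for x y
  proof -
    have "((\<lambda>f. f (W x, W y) - f (x, y)) \<longlongrightarrow> \<beta> (W x, W y) - \<beta> (x, y)) G"
      by (intro tendsto_intros lim)
    moreover have "(\<lambda>N. c N (W x, W y) - c N (x, y)) \<longlonglongrightarrow> 0"
    proof (rule Lim_null_comparison[OF always_eventually[OF allI]])
      fix N
      have "(\<Sum>n\<le>N. a n (W x) (W y)) - (\<Sum>n\<le>N. a n x y) = (\<Sum>n\<le>N. a (Suc n) x y - a n x y)"
        by (simp add: a_def sum_subtractf funpow_swap1)
      also have "\<dots> = a (Suc N) x y - a 0 x y" by (induction N) simp_all
      finally have "c N (W x, W y) - c N (x, y) = (a (Suc N) x y - a 0 x y) / real (Suc N)"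
        by (simp add: c_def diff_divide_distrib[symmetric])
      moreover have "\<bar>a (Suc N) x y - a 0 x y\<bar> \<le> 2 * b (x, y)"
        using a_bd[of "Suc N" x y] a_bd[of 0 x y] by linarith
      ultimately show "norm (c N (W x, W y) - c N (x, y)) \<le> 2 * b (x, y) * inverse (real (Suc N))"
        by (simp add: divide_inverse abs_mult mult_right_mono)
    next
      have "(\<lambda>N. 2 * b (x, y) * inverse (real (Suc N))) \<longlonglongrightarrow> 2 * b (x, y) * 0"
        by (intro tendsto_intros LIMSEQ_inverse_real_of_nat)
      then show "(\<lambda>N. 2 * b (x, y) * inverse (real (Suc N))) \<longlonglongrightarrow> 0" by simp
    qed
    ultimately have "\<beta> (W x, W y) - \<beta> (x, y) = 0" by (rule null)
    then show ?thesis by simp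
  qed
  have \<beta>_bd: "\<bar>\<beta> (x, y)\<bar> \<le> K\<^sup>2 * norm x * norm y" for x y
  proof -
    have "\<beta> (x, y) \<in> {- b (x, y) .. b (x, y)}" using \<beta>(1) by blast
    then show ?thesis by (simp add: b_def abs_le_iff)
  qed
  have "\<exists>z. \<forall>y. \<beta> (x, y) = inner z y" for x
  proof -
    have "bounded_linear (\<lambda>y. \<beta> (x, y))"
      by (rule bounded_linear_intro[of _ "K\<^sup>2 * norm x"])
         (use \<beta>_bd in \<open>simp_all add: \<beta>_sym[of x] \<beta>_add1 \<beta>_scaleR mult_ac\<close>)
    then obtain z where "\<And>y. \<beta> (x, y) = inner z y" by (rule riesz_representation) blast
    then show ?thesis by blast
  qed
  then obtain D where D: "\<And>x y. \<beta> (x, y) = inner (D x) y" by metis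
  have eqI: "u = v" if "\<And>h. inner u h = inner v h" for u v :: 'b
    using that vector_eq_rdot by blast
  show thesis
  proof
    have "norm (D x) \<le> norm x * K\<^sup>2" for x
    proof (cases "D x = 0")
      case False
      have "norm (D x) * norm (D x) = \<beta> (x, D x)"
        by (simp add: D power2_norm_eq_inner[symmetric] power2_eq_square)
      also have "\<dots> \<le> (norm x * K\<^sup>2) * norm (D x)" using \<beta>_bd[of x "D x"] by (simp add: mult_ac)
      finally show ?thesis using False by simp
    qed simp
    then have "bounded_linear D"
      by (intro bounded_linear_intro[of D "K\<^sup>2"] eqI)
         (simp_all add: D[symmetric] inner_simps \<beta>_add1 \<beta>_scaleR)
    moreover have "D (r *\<^sub>C x) = r *\<^sub>C D x" for r x
      by (rule eqI) (simp add: D[symmetric] inner_scaleC_left \<beta>_scale)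
    ultimately show "bounded_clinear D" by (simp add: bounded_clinear_def)
    show "inner (D x) y = inner x (D y)" for x y
      using \<beta>_sym[of x y] by (simp add: D inner_commute)
    show "D (W x) = W (D x)" for x
    proof (rule eqI)
      fix h
      have "inner (D (W x)) (W (inv W h)) = inner (W (D x)) (W (inv W h))"
        using \<beta>_inv[of x "inv W h"] by (simp only: D w(2))
      then show "inner (D (W x)) h = inner (W (D x)) h" by (simp add: w(5))
    qed
    fix x r
    show "r \<le> inner (D x) x" if r: "\<And>n. r \<le> (norm (Y ((W ^^ n) x)))\<^sup>2"
    proof -
      have "r \<le> c N (x, x)" for N
      proof -
        have "real (Suc N) * r = (\<Sum>n\<le>N. r)" by simp
        also have "\<dots> \<le> (\<Sum>n\<le>N. a n x x)"
          by (intro sum_mono) (use r in \<open>simp add: a_def power2_norm_eq_inner\<close>)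
        finally show ?thesis by (simp add: c_def field_simps)
      qed
      then have "r \<le> \<beta> (x, x)" by (intro tendsto_lowerbound[OF lim _ G] ev) simp
      then show ?thesis by (simp add: D)
    qed
    show "inner (D x) x \<le> r" if r: "\<And>n. (norm (Y ((W ^^ n) x)))\<^sup>2 \<le> r"
    proof -
      have "c N (x, x) \<le> r" for N
      proof -
        have "(\<Sum>n\<le>N. a n x x) \<le> (\<Sum>n\<le>N. r)"
          by (intro sum_mono) (use r in \<open>simp add: a_def power2_norm_eq_inner\<close>)
        then show ?thesis by (simp add: c_def field_simps)
      qed
      then have "\<beta> (x, x) \<le> r" by (intro tendsto_upperbound[OF lim _ G] ev) simp
      then show ?thesis by (simp add: D)
    qed
  qed
qed

section \<open>Maps defined on a dense range\<close>

text \<open>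
  The map \<open>A h \<mapsto> B h\<close> is well defined and bounded on the range of \<open>A\<close>, so it extends by completeness.
  The estimate does the work of a polar decomposition: applied in both directions, it turns two-sided
  norm comparisons into bounded invertible maps.
\<close>

lemma bounded_extension_from_dense_range:
  fixes A :: "'b::complex_inner \<Rightarrow> 'a::complex_inner"
    and B :: "'b \<Rightarrow> 'c::{complex_inner, complete_space}"
  assumes A: "bounded_clinear A" and B: "bounded_clinear B"
    and dense: "closure (range A) = UNIV" and le: "\<And>h. norm (B h) \<le> C * norm (A h)"
  obtains X where "bounded_clinear X" "\<And>h. X (A h) = B h"
proof -
  note Al = linear_simps[OF bounded_clinearD(1)[OF A]]
  note Bl = linear_simps[OF bounded_clinearD(1)[OF B]]
  have "\<exists>s. (\<lambda>n. A (s n)) \<longlonglongrightarrow> x" for x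
  proof -
    have "x \<in> closure (range A)" using dense by simp
    then obtain t where t: "\<And>n. t n \<in> range A" "t \<longlonglongrightarrow> x" unfolding closure_sequential by blast
    then have "t = (\<lambda>n. A (inv A (t n)))" by (simp add: f_inv_into_f)
    then show ?thesis using t(2) by metis
  qed
  then obtain s where s: "\<And>x. (\<lambda>n. A (s x n)) \<longlonglongrightarrow> x" by metis
  have C: "norm (B h) \<le> \<bar>C\<bar> * norm (A h)" for h
    by (rule order_trans[OF le]) (simp add: mult_right_mono)
  have "Cauchy (\<lambda>n. B (s x n))" for x
  proof (rule metric_CauchyI)
    fix e :: real assume "e > 0"
    then have "e / (\<bar>C\<bar> + 1) > 0" by (simp add: add_nonneg_pos)
    moreover have "Cauchy (\<lambda>n. A (s x n))" by (rule LIMSEQ_imp_Cauchy[OF s])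
    ultimately obtain N where N: "\<And>m n. m \<ge> N \<Longrightarrow> n \<ge> N \<Longrightarrow>
        dist (A (s x m)) (A (s x n)) < e / (\<bar>C\<bar> + 1)"
      using metric_CauchyD by blast
    have "dist (B (s x m)) (B (s x n)) < e" if mn: "m \<ge> N" "n \<ge> N" for m n
    proof -
      have "dist (B (s x m)) (B (s x n)) \<le> \<bar>C\<bar> * dist (A (s x m)) (A (s x n))"
        using C[of "s x m - s x n"] by (simp add: dist_norm Al Bl)
      also have "\<dots> \<le> (\<bar>C\<bar> + 1) * dist (A (s x m)) (A (s x n))"
        by (intro mult_right_mono) auto
      also have "\<dots> < e" using N[OF mn] by (simp add: pos_less_divide_eq add_nonneg_pos mult.commute)
      finally show ?thesis .
    qed
    then show "\<exists>N. \<forall>m\<ge>N. \<forall>n\<ge>N. dist (B (s x m)) (B (s x n)) < e" by blast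
  qed
  then have "\<exists>y. (\<lambda>n. B (s x n)) \<longlonglongrightarrow> y" for x using Cauchy_convergent convergent_def by blast
  then obtain X where X: "\<And>x. (\<lambda>n. B (s x n)) \<longlonglongrightarrow> X x" by metis
  have Xlim: "(\<lambda>n. B (u n)) \<longlonglongrightarrow> X x" if u: "(\<lambda>n. A (u n)) \<longlonglongrightarrow> x" for u x
  proof -
    have "(\<lambda>n. B (u n) - B (s x n)) \<longlonglongrightarrow> 0"
    proof (rule Lim_null_comparison[OF always_eventually[OF allI]])
      show "norm (B (u n) - B (s x n)) \<le> \<bar>C\<bar> * norm (A (u n) - A (s x n))" for n
        using C[of "u n - s x n"] by (simp add: Al Bl)
      have "(\<lambda>n. \<bar>C\<bar> * norm (A (u n) - A (s x n))) \<longlonglongrightarrow> \<bar>C\<bar> * norm (x - x)"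
        by (intro tendsto_intros u s)
      then show "(\<lambda>n. \<bar>C\<bar> * norm (A (u n) - A (s x n))) \<longlonglongrightarrow> 0" by simp
    qed
    from tendsto_add[OF this X[of x]] show ?thesis by simp
  qed
  show thesis
  proof
    show "X (A h) = B h" for h
      using Xlim[of "\<lambda>_. h" "A h"] by (simp add: LIMSEQ_const_iff)
    have add: "X (x + y) = X x + X y" for x y
    proof (rule LIMSEQ_unique)
      have "(\<lambda>n. A (s x n + s y n)) \<longlonglongrightarrow> x + y" unfolding Al by (intro tendsto_add s)
      then show "(\<lambda>n. B (s x n + s y n)) \<longlonglongrightarrow> X (x + y)" by (rule Xlim)
      show "(\<lambda>n. B (s x n + s y n)) \<longlonglongrightarrow> X x + X y" unfolding Bl by (intro tendsto_add X)
    qed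
    have scaleC: "X (r *\<^sub>C x) = r *\<^sub>C X x" for r x
    proof (rule LIMSEQ_unique)
      note t = bounded_linear.tendsto[OF bounded_linear_scaleC]
      have "(\<lambda>n. A (r *\<^sub>C s x n)) \<longlonglongrightarrow> r *\<^sub>C x"
        unfolding bounded_clinearD(2)[OF A] by (intro t s)
      then show "(\<lambda>n. B (r *\<^sub>C s x n)) \<longlonglongrightarrow> X (r *\<^sub>C x)" by (rule Xlim)
      show "(\<lambda>n. B (r *\<^sub>C s x n)) \<longlonglongrightarrow> r *\<^sub>C X x"
        unfolding bounded_clinearD(2)[OF B] by (intro t X)
    qed
    have "norm (X x) \<le> norm x * \<bar>C\<bar>" for x
    proof (rule LIMSEQ_le)
      show "(\<lambda>n. norm (B (s x n))) \<longlonglongrightarrow> norm (X x)" by (intro tendsto_norm X)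
      show "(\<lambda>n. norm (A (s x n)) * \<bar>C\<bar>) \<longlonglongrightarrow> norm x * \<bar>C\<bar>" by (intro tendsto_intros s)
      show "\<exists>N. \<forall>n\<ge>N. norm (B (s x n)) \<le> norm (A (s x n)) * \<bar>C\<bar>"
        using C by (simp add: mult.commute)
    qed
    then have "bounded_linear X"
      by (intro bounded_linear_intro[of X "\<bar>C\<bar>"]) (simp_all add: add scaleC scaleC_of_real[symmetric])
    then show "bounded_clinear X" by (simp add: bounded_clinear_def scaleC)
  qed
qed

section \<open>Small arcs of the circle\<close>

lemma norm_cis_diff: "cmod (cis a - cis b) = 2 * \<bar>sin ((a - b) / 2)\<bar>"
proof -
  have "cis a - cis b = cis b * (cis (a - b) - 1)" by (simp add: right_diff_distrib cis_mult)
  then show ?thesis using dist_exp_i_1[of "a - b"] by (simp add: norm_mult cis_conv_exp)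
qed

lemma norm_cis_diff_le: "cmod (cis a - cis b) \<le> \<bar>a - b\<bar>"
  using abs_sin_x_le_abs_x[of "(a - b) / 2"] by (simp add: norm_cis_diff)

lemma circle_sets_space: "B \<in> sets circle_borel \<Longrightarrow> B \<subseteq> unit_circle"
  using sets.sets_into_space[of B circle_borel] by (simp add: space_restrict_space)

lemma circle_setsI: "B \<in> sets borel \<Longrightarrow> B \<subseteq> unit_circle \<Longrightarrow> B \<in> sets circle_borel"
  by (auto simp: sets_restrict_space_iff)

lemma circle_sets_top: "unit_circle \<in> sets circle_borel"
  by (rule circle_setsI) auto

text \<open>
  It matters that \<open>n\<close> arcs suffice for diameter of order \<open>1/n\<close>: in the arguments below the pieces of
  a vector are summed with the Cauchy-Schwarz loss \<open>sqrt n\<close>, and the error \<open>1/n\<close> of each piece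
  compensates for it.
\<close>

lemma small_arc_partition:
  assumes "n > (0::nat)"
  obtains a z where "\<And>k. a k \<in> sets circle_borel" "disjoint_family_on a {..<n}"
    "(\<Union>k<n. a k) = unit_circle" "\<And>k. cmod (z k) = 1"
    "\<And>k w. w \<in> a k \<Longrightarrow> cmod (w - z k) \<le> 2 * pi / n"
proof -
  define A where "A k = cis ` {2 * pi * real k / n .. 2 * pi * real (Suc k) / n}" for k
  have A: "A k \<in> sets circle_borel" for k
  proof (rule circle_setsI)
    have "compact (A k)" unfolding A_def
      by (intro compact_continuous_image continuous_intros compact_Icc)
    then show "A k \<in> sets borel" by (rule borel_compact)
  qed (auto simp: A_def)
  have top: "(\<Union>k<n. A k) = unit_circle"
  proof
    show "(\<Union>k<n. A k) \<subseteq> unit_circle" by (auto simp: A_def)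
    show "unit_circle \<subseteq> (\<Union>k<n. A k)"
    proof
      fix w :: complex assume w: "w \<in> unit_circle"
      define t where "t = Arg2pi w"
      have t: "0 \<le> t" "t < 2 * pi" "w = cis t"
        using w Arg2pi[of w] by (auto simp: t_def cis_conv_exp is_Arg_def)
      define k where "k = nat \<lfloor>t * n / (2 * pi)\<rfloor>"
      have "real k = of_int \<lfloor>t * n / (2 * pi)\<rfloor>" using t(1) by (simp add: k_def)
      then have k: "real k \<le> t * n / (2 * pi)" "t * n / (2 * pi) < real k + 1" by linarith+
      have "t * n / (2 * pi) < n" using t assms by (simp add: field_simps)
      then have "k < n" using k by linarith
      moreover have "t \<in> {2 * pi * real k / n .. 2 * pi * real (Suc k) / n}"
        using k assms by (simp add: field_simps)
      ultimately show "w \<in> (\<Union>k<n. A k)" unfolding t(3) A_def by blast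
    qed
  qed
  show thesis
  proof (rule that[of "disjointed A" "\<lambda>k. cis (2 * pi * real k / n)"])
    show "disjointed A k \<in> sets circle_borel" for k
      using sets.range_disjointed_sets[of A circle_borel] A by auto
    show "disjoint_family_on (disjointed A) {..<n}"
      using disjoint_family_disjointed[of A] by (auto simp: disjoint_family_on_def)
    show "(\<Union>k<n. disjointed A k) = unit_circle"
      using finite_UN_disjointed_eq[of A n] top by (simp add: atLeast0LessThan)
    show "cmod (w - cis (2 * pi * real k / n)) \<le> 2 * pi / n" if w: "w \<in> disjointed A k" for w k
    proof -
      obtain t where t: "w = cis t" "2 * pi * real k / n \<le> t" "t \<le> 2 * pi * real (Suc k) / n"
        using w disjointed_subset[of A k] by (auto simp: A_def)
      have "cmod (w - cis (2 * pi * real k / n)) \<le> \<bar>t - 2 * pi * real k / n\<bar>"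
        unfolding t(1) by (rule norm_cis_diff_le)
      also have "\<dots> \<le> 2 * pi / n" using t(2,3) by (simp add: add_divide_distrib algebra_simps)
      finally show ?thesis .
    qed
  qed simp
qed

lemma sum_norm_le_sqrt_card:
  fixes x :: "'i \<Rightarrow> 'a::real_normed_vector"
  assumes "(\<Sum>i\<in>I. (norm (x i))\<^sup>2) \<le> c\<^sup>2" "c \<ge> 0"
  shows "(\<Sum>i\<in>I. norm (x i)) \<le> sqrt (card I) * c"
proof (rule power2_le_imp_le)
  have "(\<Sum>i\<in>I. norm (x i))\<^sup>2 \<le> (\<Sum>i\<in>I. (norm (x i))\<^sup>2) * card I"
    by (rule sum_squared_le_sum_of_squares)
  also have "\<dots> \<le> c\<^sup>2 * card I" by (intro mult_right_mono assms) simp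
  finally show "(\<Sum>i\<in>I. norm (x i))\<^sup>2 \<le> (sqrt (card I) * c)\<^sup>2" by (simp add: power_mult_distrib mult.commute)
qed (use assms in simp)

lemma divide_mult_sqrt:
  fixes n c x :: real
  assumes "n > 0" shows "c / n * (sqrt n * x) = c * x / sqrt n"
proof -
  have "c / (sqrt n * sqrt n) * (sqrt n * x) = c * x / sqrt n"
    using assms by (simp add: divide_simps del: real_sqrt_mult_self)
  then show ?thesis using assms by simp
qed

lemma zero_if_le_inverse_sqrt:
  fixes a c :: real and N :: nat
  assumes "a \<ge> 0" and le: "\<And>n::nat. n > N \<Longrightarrow> a \<le> c / sqrt n"
  shows "a = 0"
proof -
  have "filterlim (\<lambda>n::nat. sqrt n) at_top sequentially"
    by (rule filterlim_compose[OF sqrt_at_top filterlim_real_sequentially])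
  then have "(\<lambda>n::nat. c / sqrt n) \<longlonglongrightarrow> 0" by (rule tendsto_divide_0[OF tendsto_const filterlim_at_top_imp_at_infinity])
  then have "a \<le> 0"
    by (rule tendsto_lowerbound) (use le in \<open>auto intro: eventually_sequentiallyI[of "Suc N"]\<close>)
  with assms show ?thesis by simp
qed

section \<open>The spectral measure of a unitary operator\<close>

locale unitary_with_spectral_measure =
  fixes U :: "'b::{complex_inner, complete_space} \<Rightarrow> 'b" and P :: "complex set \<Rightarrow> 'b \<Rightarrow> 'b"
  assumes unitary: "unitary_op U" and spectral: "spectral_measure_of U P"
begin

lemma pvm: "projection_valued_measure P"
  using spectral by (simp add: spectral_measure_of_def)

lemma P_clinear: "B \<in> sets circle_borel \<Longrightarrow> bounded_clinear (P B)"
  using pvm by (auto simp: projection_valued_measure_def orthogonal_projection_def)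

lemma P_linear: "B \<in> sets circle_borel \<Longrightarrow> bounded_linear (P B)"
  using P_clinear bounded_clinearD by blast

lemma P_idem: "B \<in> sets circle_borel \<Longrightarrow> P B (P B x) = P B x"
  using pvm unfolding projection_valued_measure_def orthogonal_projection_def by (metis comp_apply)

lemma P_selfadjoint: "B \<in> sets circle_borel \<Longrightarrow> inner (P B x) y = inner x (P B y)"
  using pvm by (auto simp: projection_valued_measure_def orthogonal_projection_def inner_eq_Re_cinner)

lemma P_top: "P unit_circle x = x"
  using pvm by (auto simp: projection_valued_measure_def)

lemma P_sums:
  "range A \<subseteq> sets circle_borel \<Longrightarrow> disjoint_family A \<Longrightarrow> (\<lambda>n. P (A n) x) sums P (\<Union>n. A n) x"
  using pvm by (auto simp: projection_valued_measure_def)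

lemma P_empty: "P {} x = 0"
proof -
  have "(\<lambda>n::nat. P {} x) sums P (\<Union>n::nat. {}) x"
    by (rule P_sums) (auto simp: disjoint_family_on_def)
  then have "(\<lambda>n::nat. P {} x) \<longlonglongrightarrow> 0" by (intro summable_LIMSEQ_zero sums_summable)
  then show ?thesis by (simp add: LIMSEQ_const_iff)
qed

lemma P_Un:
  assumes "B \<in> sets circle_borel" "C \<in> sets circle_borel" "B \<inter> C = {}"
  shows "P (B \<union> C) x = P B x + P C x"
proof -
  have "(\<lambda>n. P (binaryset B C n) x) sums P (\<Union>n. binaryset B C n) x"
    by (rule P_sums) (use assms in \<open>auto simp: disjoint_family_on_def binaryset_def\<close>)
  moreover have "(\<lambda>n. P (binaryset B C n) x) sums (P B x + P C x)"
    by (rule binaryset_sums) (rule P_empty)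
  ultimately show ?thesis using sums_unique2 by (auto simp: UN_binaryset_eq)
qed

lemma norm_P: "B \<in> sets circle_borel \<Longrightarrow> (norm (P B x))\<^sup>2 = inner (P B x) x"
  using P_selfadjoint[of B "P B x" x] P_idem[of B x]
  by (simp add: power2_norm_eq_inner P_selfadjoint)

lemma norm_P_le: "B \<in> sets circle_borel \<Longrightarrow> norm (P B x) \<le> norm x"
proof -
  assume B: "B \<in> sets circle_borel"
  have "norm (P B x) * norm (P B x) \<le> norm (P B x) * norm x"
    using norm_cauchy_schwarz[of "P B x" x] norm_P[OF B, of x] by (simp add: power2_eq_square)
  then show ?thesis by (cases "norm (P B x) = 0") simp_all
qed

lemma P_disjoint:
  assumes B: "B \<in> sets circle_borel" and C: "C \<in> sets circle_borel" and "B \<inter> C = {}"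
  shows "P C (P B x) = 0"
proof -
  let ?y = "P B x"
  have BC: "B \<union> C \<in> sets circle_borel" using B C by (rule sets.Un)
  have "(norm (P (B \<union> C) ?y))\<^sup>2 = (norm (P B ?y))\<^sup>2 + (norm (P C ?y))\<^sup>2"
    using norm_P[OF BC] norm_P[OF B] norm_P[OF C] P_Un[OF assms] by (simp add: inner_simps)
  moreover have "(norm (P (B \<union> C) ?y))\<^sup>2 \<le> (norm ?y)\<^sup>2"
    by (intro power_mono norm_P_le BC) simp
  ultimately show ?thesis by (simp add: P_idem[OF B])
qed

lemma P_Int:
  assumes B: "B \<in> sets circle_borel" and C: "C \<in> sets circle_borel"
  shows "P B (P C x) = P (B \<inter> C) x"
proof -
  have s: "B \<inter> C \<in> sets circle_borel" "C - B \<in> sets circle_borel" "B - C \<in> sets circle_borel"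
    using B C by (auto intro: sets.Int sets.Diff)
  have d: "(B \<inter> C) \<inter> (C - B) = {}" "(B \<inter> C) \<inter> (B - C) = {}" "(C - B) \<inter> B = {}"
    "(B \<inter> C) \<union> (C - B) = C" "(B \<inter> C) \<union> (B - C) = B" by auto
  have "P C x = P (B \<inter> C) x + P (C - B) x"
    using P_Un[OF s(1,2) d(1), of x] by (simp only: d(4))
  then have "P B (P C x) = P B (P (B \<inter> C) x)"
    using P_disjoint[OF s(2) B d(3), of x] by (simp add: linear_simps[OF P_linear[OF B]])
  also have "\<dots> = P (B \<inter> C) x"
    using P_Un[OF s(1,3) d(2), of "P (B \<inter> C) x"] P_disjoint[OF s(1,3) d(2), of x] P_idem[OF s(1), of x]
    by (simp only: d(5)) simp
  finally show ?thesis .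
qed

lemma P_Compl:
  assumes B: "B \<in> sets circle_borel"
  shows "P (unit_circle - B) x = x - P B x"
proof -
  have "unit_circle - B \<in> sets circle_borel" using B circle_sets_top by (rule sets.Diff[rotated])
  from P_Un[OF B this, of x] have "P unit_circle x = P B x + P (unit_circle - B) x"
    using circle_sets_space[OF B] by (simp add: Un_absorb1)
  then show ?thesis unfolding P_top by (metis add_diff_cancel_left')
qed

lemma P_UN:
  assumes "finite I" "\<And>i. i \<in> I \<Longrightarrow> A i \<in> sets circle_borel" "disjoint_family_on A I"
  shows "P (\<Union>i\<in>I. A i) x = (\<Sum>i\<in>I. P (A i) x)"
  using assms
proof (induction I)
  case (insert i I)
  have "A i \<inter> (\<Union>i\<in>I. A i) = {}" using insert by (auto simp: disjoint_family_on_def)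
  moreover have "(\<Union>i\<in>I. A i) \<in> sets circle_borel" using insert by (intro sets.finite_UN) auto
  ultimately have "P (\<Union>i\<in>insert i I. A i) x = P (A i) x + P (\<Union>i\<in>I. A i) x"
    using P_Un[of "A i" "\<Union>i\<in>I. A i" x] insert by simp
  moreover have "P (\<Union>i\<in>I. A i) x = (\<Sum>i\<in>I. P (A i) x)"
    using insert by (auto simp: disjoint_family_on_def)
  ultimately show ?case using insert by simp
qed (simp add: P_empty)

lemma norm_sum_P:
  assumes I: "finite I" and A: "\<And>i. i \<in> I \<Longrightarrow> A i \<in> sets circle_borel" "disjoint_family_on A I"
    and y: "\<And>i. i \<in> I \<Longrightarrow> P (A i) (y i) = y i"
  shows "(norm (\<Sum>i\<in>I. y i))\<^sup>2 = (\<Sum>i\<in>I. (norm (y i))\<^sup>2)"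
proof (rule norm_sum_Pythagorean[OF I], rule pairwiseI)
  fix i j assume ij: "i \<in> I" "j \<in> I" "i \<noteq> j"
  have "inner (y i) (y j) = inner (P (A i) (y i)) (P (A j) (y j))" using y ij by simp
  also have "\<dots> = inner (y i) (P (A i) (P (A j) (y j)))" using A ij by (simp add: P_selfadjoint)
  also have "P (A i) (P (A j) (y j)) = 0"
    using P_disjoint[of "A j" "A i"] A ij by (force simp: disjoint_family_on_def)
  finally show "orthogonal (y i) (y j)" by (simp add: orthogonal_def)
qed

lemma sum_norm_P_le:
  assumes I: "finite I" and A: "\<And>i. i \<in> I \<Longrightarrow> A i \<in> sets circle_borel" "disjoint_family_on A I"
  shows "(\<Sum>i\<in>I. (norm (P (A i) x))\<^sup>2) \<le> (norm x)\<^sup>2"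
proof -
  have "(\<Sum>i\<in>I. (norm (P (A i) x))\<^sup>2) = (norm (\<Sum>i\<in>I. P (A i) x))\<^sup>2"
    by (rule norm_sum_P[symmetric, OF I A]) (use A P_idem in auto)
  also have "\<dots> = (norm (P (\<Union>i\<in>I. A i) x))\<^sup>2" by (simp add: P_UN[OF I A])
  also have "\<dots> \<le> (norm x)\<^sup>2"
    by (intro power_mono norm_P_le sets.finite_UN) (use I A in auto)
  finally show ?thesis .
qed

abbreviation "vector_measure \<equiv> pvm_measure P"

lemma sets_vector_measure [measurable_cong]: "sets (vector_measure x) = sets circle_borel"
proof -
  have "sets circle_borel \<subseteq> Pow unit_circle" using circle_sets_space by blast
  then show ?thesis
    using sets.sigma_sets_eq[of circle_borel]
    by (simp add: pvm_measure_def sets_measure_of space_restrict_space)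
qed

lemma space_vector_measure: "space (vector_measure x) = unit_circle"
  using sets_eq_imp_space_eq[OF sets_vector_measure] by (simp add: space_restrict_space)

lemma emeasure_vector_measure: "B \<in> sets circle_borel \<Longrightarrow> emeasure (vector_measure x) B = ennreal ((norm (P B x))\<^sup>2)"
  using emeasure_pvm_measure[OF pvm] norm_P by (simp add: inner_eq_Re_cinner)

lemma measure_vector_measure: "B \<in> sets circle_borel \<Longrightarrow> measure (vector_measure x) B = (norm (P B x))\<^sup>2"
  by (simp add: measure_def emeasure_vector_measure)

lemma finite_vector_measure: "finite_measure (vector_measure x)"
  by standard (simp add: space_vector_measure emeasure_vector_measure[OF circle_sets_top])

lemma vector_measure_measurable: "f \<in> borel_measurable borel \<Longrightarrow> f \<in> borel_measurable (vector_measure x)"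
  by (simp add: measurable_cong_sets[OF sets_vector_measure refl] measurable_restrict_space1)

lemma vector_measure_integrable:
  fixes f :: "complex \<Rightarrow> 'c::{banach, second_countable_topology}"
  assumes "f \<in> borel_measurable borel" "\<And>w. w \<in> unit_circle \<Longrightarrow> norm (f w) \<le> c"
  shows "integrable (vector_measure x) f"
  by (rule finite_measure.integrable_const_bound[OF finite_vector_measure, where B = c])
     (use assms in \<open>auto simp: space_vector_measure intro!: vector_measure_measurable AE_I2\<close>)

lemma integrable_squared_distance:
  assumes z: "cmod z = 1"
  shows "integrable (vector_measure x) (\<lambda>w. (cmod (w - z))\<^sup>2)"
proof (rule vector_measure_integrable[of _ 4])
  fix w assume "w \<in> unit_circle"
  then have "cmod (w - z) \<le> 2" using norm_triangle_ineq4[of w z] z by simp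
  then have "(cmod (w - z))\<^sup>2 \<le> 2\<^sup>2" by (intro power_mono) auto
  then show "norm ((cmod (w - z))\<^sup>2) \<le> 4" by simp
qed auto

text \<open>
  Expand the square on the left; the only spectral input is \<open>\<langle>U x, x\<rangle> = \<integral> w\<close>. Only this quadratic
  identity links \<open>U\<close> to \<open>P\<close>, and it suffices for the whole calculus used here: by the next two
  lemmas it says both that vectors supported near \<open>z\<close> are almost eigenvectors, and that almost
  eigenvectors are supported near \<open>z\<close>.
\<close>

lemma norm_U_minus_scalar:
  assumes z: "cmod z = 1"
  shows "(norm (U x - z *\<^sub>C x))\<^sup>2 = (LINT w|vector_measure x. (cmod (w - z))\<^sup>2)"
proof -
  interpret finite_measure "vector_measure x" by (rule finite_vector_measure)
  have id: "integrable (vector_measure x) (\<lambda>w. w)" by (rule vector_measure_integrable[of _ 1]) auto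
  have "(LINT w|vector_measure x. (cmod (w - z))\<^sup>2) = (LINT w|vector_measure x. 2 - 2 * Re (cnj z * w))"
  proof (rule Bochner_Integration.integral_cong[OF refl])
    fix w assume "w \<in> space (vector_measure x)"
    then have "cmod w = 1" by (simp add: space_vector_measure)
    then have "(Re w)\<^sup>2 + (Im w)\<^sup>2 = 1" "(Re z)\<^sup>2 + (Im z)\<^sup>2 = 1"
      using z by (metis cmod_power2 power_one)+
    then show "(cmod (w - z))\<^sup>2 = 2 - 2 * Re (cnj z * w)"
      by (simp add: cmod_power2 power2_diff)
  qed
  also have "\<dots> = 2 * measure (vector_measure x) (space (vector_measure x)) - 2 * Re (cnj z * (LINT w|vector_measure x. w))"
    using id by (simp add: integral_Re[symmetric] del: times_complex.sel)
  also have "\<dots> = 2 * (norm x)\<^sup>2 - 2 * Re (cnj z * cinner (U x) x)"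
    using spectral by (simp add: space_vector_measure measure_vector_measure[OF circle_sets_top] P_top spectral_measure_of_def)
  also have "\<dots> = (norm (U x - z *\<^sub>C x))\<^sup>2"
  proof -
    have "(norm (U x - z *\<^sub>C x))\<^sup>2 = (norm (U x))\<^sup>2 + (norm (z *\<^sub>C x))\<^sup>2 - 2 * inner (U x) (z *\<^sub>C x)"
      by (simp add: power2_norm_eq_inner inner_simps inner_commute)
    then show ?thesis
      by (simp add: unitary_opD(3)[OF unitary] norm_scaleC z inner_eq_Re_cinner cinner_scaleC_right
          del: times_complex.sel)
  qed
  finally show ?thesis by simp
qed

lemma near_eigenvector:
  assumes z: "cmod z = 1" and B: "B \<in> sets circle_borel" "P B x = x"
    and d: "\<And>w. w \<in> B \<Longrightarrow> cmod (w - z) \<le> d" "d \<ge> 0"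
  shows "norm (U x - z *\<^sub>C x) \<le> d * norm x"
proof -
  interpret finite_measure "vector_measure x" by (rule finite_vector_measure)
  have CB: "unit_circle - B \<in> sets circle_borel" using B(1) circle_sets_top by (rule sets.Diff[rotated])
  have "(norm (U x - z *\<^sub>C x))\<^sup>2 = (LINT w|vector_measure x. (cmod (w - z))\<^sup>2)" by (rule norm_U_minus_scalar[OF z])
  also have "\<dots> \<le> (LINT w|vector_measure x. d\<^sup>2)"
  proof (rule integral_mono_AE)
    show "integrable (vector_measure x) (\<lambda>w. (cmod (w - z))\<^sup>2)"
      by (rule integrable_squared_distance[OF z])
    show "AE w in vector_measure x. (cmod (w - z))\<^sup>2 \<le> d\<^sup>2"
    proof (rule AE_I[of _ _ "unit_circle - B"])
      show "{w \<in> space (vector_measure x). \<not> (cmod (w - z))\<^sup>2 \<le> d\<^sup>2} \<subseteq> unit_circle - B"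
        using d by (auto simp: space_vector_measure intro: power_mono)
      show "emeasure (vector_measure x) (unit_circle - B) = 0"
        using emeasure_vector_measure[OF CB, of x] P_Compl[OF B(1), of x] B(2) by simp
    qed (simp add: sets_vector_measure CB)
  qed simp
  also have "\<dots> = (d * norm x)\<^sup>2"
    by (simp add: space_vector_measure measure_vector_measure[OF circle_sets_top] P_top power_mult_distrib)
  finally show ?thesis using d(2) by (simp add: power2_le_iff_abs_le abs_mult) 
qed

lemma near_eigenvector_concentrated:
  assumes z: "cmod z = 1" and C: "C \<in> sets circle_borel"
    and d: "\<And>w. w \<in> C \<Longrightarrow> d \<le> cmod (w - z)" "d \<ge> 0"
  shows "d * norm (P C x) \<le> norm (U x - z *\<^sub>C x)"
proof (rule power2_le_imp_le)
  interpret finite_measure "vector_measure x" by (rule finite_vector_measure)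
  have "(d * norm (P C x))\<^sup>2 = (LINT w|vector_measure x. d\<^sup>2 * indicator C w)"
    using C circle_sets_space[OF C] by (simp add: sets_vector_measure measure_vector_measure power_mult_distrib space_vector_measure Int_absorb2)
  also have "\<dots> \<le> (LINT w|vector_measure x. (cmod (w - z))\<^sup>2)"
  proof (rule integral_mono)
    show "integrable (vector_measure x) (\<lambda>w. d\<^sup>2 * indicator C w)"
      using C by (intro integrable_mult_right integrable_real_indicator) (auto simp: sets_vector_measure emeasure_vector_measure)
    show "integrable (vector_measure x) (\<lambda>w. (cmod (w - z))\<^sup>2)"
      by (rule integrable_squared_distance[OF z])
    show "d\<^sup>2 * indicator C w \<le> (cmod (w - z))\<^sup>2" for w
      using d by (auto simp: indicator_def intro: power_mono)
  qed
  also have "\<dots> = (norm (U x - z *\<^sub>C x))\<^sup>2" by (rule norm_U_minus_scalar[OF z, symmetric])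
  finally show "(d * norm (P C x))\<^sup>2 \<le> (norm (U x - z *\<^sub>C x))\<^sup>2" .
qed simp

section \<open>Operators commuting with the unitary operator\<close>

lemma commute_if_invariant:
  assumes A: "bounded_linear A" and B: "B \<in> sets circle_borel"
    and "\<And>x. P B x = x \<Longrightarrow> P B (A x) = A x"
    and "\<And>x. P (unit_circle - B) x = x \<Longrightarrow> P (unit_circle - B) (A x) = A x"
  shows "P B (A x) = A (P B x)"
proof -
  let ?C = "unit_circle - B"
  have C: "?C \<in> sets circle_borel" using B circle_sets_top by (rule sets.Diff[rotated])
  have 1: "P B (A (P B x)) = A (P B x)" by (rule assms(3)) (rule P_idem[OF B])
  have "P ?C (A (P ?C x)) = A (P ?C x)" by (rule assms(4)) (rule P_idem[OF C])
  then have 2: "P B (A (P ?C x)) = 0" using P_Compl[OF B, of "A (P ?C x)"] by simp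
  have "P B (A x) = P B (A (P B x)) + P B (A (P ?C x))"
    by (simp add: P_Compl[OF B] linear_simps[OF A] linear_simps[OF P_linear[OF B]])
  then show ?thesis using 1 2 by simp
qed

text \<open>
  Cut a vector supported in \<open>B\<close> into \<open>n\<close> pieces supported on small arcs. Up to an error of order
  \<open>1/n\<close> per piece, \<open>U\<close> multiplies each piece by a scalar and hence keeps it in the range of \<open>P B\<close>;
  the errors add up to order \<open>1/sqrt n\<close>.
\<close>

lemma P_commutes_U:
  assumes B: "B \<in> sets circle_borel" shows "P B (U x) = U (P B x)"
proof -
  have inv: "P B (U x) = U x" if B: "B \<in> sets circle_borel" and x: "P B x = x" for B x
  proof -
    let ?C = "unit_circle - B"
    have C: "?C \<in> sets circle_borel" using B circle_sets_top by (rule sets.Diff[rotated])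
    have "norm (P ?C (U x)) \<le> (2 * pi * norm x) / sqrt n" if n: "n > 0" for n :: nat
    proof -
      obtain a z where a: "\<And>k. a k \<in> sets circle_borel" "disjoint_family_on a {..<n}"
          "(\<Union>k<n. a k) = unit_circle" "\<And>k. cmod (z k) = 1"
          "\<And>k w. w \<in> a k \<Longrightarrow> cmod (w - z k) \<le> 2 * pi / n"
        by (rule small_arc_partition[OF n]) blast
      have xs: "x = (\<Sum>k<n. P (a k) x)"
        using P_UN[of "{..<n}" a x] a(1,2,3) by (simp add: P_top)
      have Uxs: "U x = (\<Sum>k<n. U (P (a k) x))"
        using arg_cong[OF xs, of U]
        by (simp only: bounded_linear_sum_arg[OF bounded_clinearD(1)[OF unitary_opD(1)[OF unitary]]])
      have "P ?C (z k *\<^sub>C P (a k) x) = 0" for k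
      proof -
        have "P ?C (P (a k) (P B x)) = P (?C \<inter> (a k \<inter> B)) x"
          using B C a(1) by (simp add: P_Int sets.Int)
        also have "?C \<inter> (a k \<inter> B) = {}" by auto
        finally have "P ?C (P (a k) (P B x)) = 0" by (simp add: P_empty)
        then show ?thesis using x bounded_clinearD(2)[OF P_clinear[OF C]] 
          by (simp add: linear_simps(3)[OF bounded_linear_scaleC])
      qed
      then have "P ?C (\<Sum>k<n. z k *\<^sub>C P (a k) x) = 0"
        by (simp add: bounded_linear_sum_arg[OF P_linear[OF C]])
      then have "norm (P ?C (U x)) = norm (P ?C (U x - (\<Sum>k<n. z k *\<^sub>C P (a k) x)))"
        by (simp add: linear_simps[OF P_linear[OF C]])
      also have "\<dots> \<le> norm (U x - (\<Sum>k<n. z k *\<^sub>C P (a k) x))" by (rule norm_P_le[OF C])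
      also have "\<dots> = norm (\<Sum>k<n. U (P (a k) x) - z k *\<^sub>C P (a k) x)"
        by (simp only: Uxs sum_subtractf)
      also have "\<dots> \<le> (\<Sum>k<n. norm (U (P (a k) x) - z k *\<^sub>C P (a k) x))"
        by (rule norm_sum)
      also have "\<dots> \<le> (\<Sum>k<n. 2 * pi / n * norm (P (a k) x))"
        by (intro sum_mono near_eigenvector[OF a(4) a(1) P_idem[OF a(1)]] a(5)) auto
      also have "\<dots> = 2 * pi / n * (\<Sum>k<n. norm (P (a k) x))" by (simp add: sum_distrib_left)
      also have "\<dots> \<le> 2 * pi / n * (sqrt (card {..<n}) * norm x)"
        by (intro mult_left_mono sum_norm_le_sqrt_card[OF sum_norm_P_le]) (use a in auto)
      also have "\<dots> = (2 * pi * norm x) / sqrt n"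
        using n divide_mult_sqrt[of n "2 * pi" "norm x"] by simp
      finally show ?thesis .
    qed
    then have "norm (P ?C (U x)) = 0" by (intro zero_if_le_inverse_sqrt[of _ 0]) auto
    then show ?thesis using P_Compl[OF B, of "U x"] by simp
  qed
  show ?thesis
    by (rule commute_if_invariant[OF bounded_clinearD(1)[OF unitary_opD(1)[OF unitary]] B])
       (use inv B in \<open>auto intro!: inv sets.Diff circle_sets_top\<close>)
qed

text \<open>
  If \<open>y\<close> is supported on an arc around \<open>z\<close> of length \<open>1/n\<close>, it is an eigenvector of \<open>U\<close> up to
  \<open>O(1/n)\<close>, hence so is \<open>D y\<close>, and therefore \<open>D y\<close> has mass at most \<open>O(1/n)\<close> at distance \<open>d\<close> from
  the arc. Summing over the \<open>n\<close> pieces of \<open>x\<close> shows that \<open>D x\<close> has no mass at distance \<open>d\<close> from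
  \<open>B\<close>, for each \<open>d > 0\<close>. Closedness of \<open>B\<close> then lets \<open>d\<close> tend to zero.
\<close>

lemma range_P_invariant_closed:
  assumes D: "bounded_clinear D" and DU: "\<And>x. D (U x) = U (D x)"
    and B: "closed B" "B \<subseteq> unit_circle" and x: "P B x = x"
  shows "P B (D x) = D x"
proof -
  note Dl = linear_simps[OF bounded_clinearD(1)[OF D]]
  have Bs: "B \<in> sets circle_borel" using B by (intro circle_setsI) auto
  obtain K where K: "K > 0" "\<And>x. norm (D x) \<le> norm x * K"
    using bounded_linear.pos_bounded[OF bounded_clinearD(1)[OF D]] by blast
  define C where "C d = {w \<in> unit_circle. \<forall>b\<in>B. d \<le> cmod (w - b)}" for d
  have Cs: "C d \<in> sets circle_borel" for d
  proof (rule circle_setsI)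
    have "C d = unit_circle \<inter> (\<Inter>b\<in>B. {w. d \<le> cmod (w - b)})" by (auto simp: C_def)
    moreover have "closed \<dots>"
      by (intro closed_Int closed_INT ballI closed_Collect_le continuous_intros closed_sphere)
    ultimately show "C d \<in> sets borel" by simp
  qed (auto simp: C_def)
  have zero: "P (C d) (D x) = 0" if d: "d > 0" for d
  proof -
    define N where "N = nat \<lceil>4 * pi / d\<rceil>"
    \<comment> \<open>For such \<open>n\<close> each arc lies within \<open>d/2\<close> of its \<open>z k\<close>; if it meets \<open>B\<close>, then \<open>C d\<close> is \<open>d/2\<close>-far from \<open>z k\<close>.\<close>
    have bound: "norm (P (C d) (D x)) \<le> (4 * pi * K * norm x / d) / sqrt n" if n: "n > N" for n :: nat
    proof -
      have n0: "n > 0" using n by simp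
      have "4 * pi / d < n" using n by (simp add: N_def) linarith
      then have nd: "2 * pi / n \<le> d / 2" using d n0 by (simp add: field_simps)
      obtain a z where a: "\<And>k. a k \<in> sets circle_borel" "disjoint_family_on a {..<n}"
          "(\<Union>k<n. a k) = unit_circle" "\<And>k. cmod (z k) = 1"
          "\<And>k w. w \<in> a k \<Longrightarrow> cmod (w - z k) \<le> 2 * pi / n"
        by (rule small_arc_partition[OF n0]) blast
      have piece: "norm (P (C d) (D (P (a k) x))) \<le> (4 * pi * K / (d * n)) * norm (P (a k) x)" for k
      proof (cases "a k \<inter> B = {}")
        case True
        have "P (a k) x = P (a k) (P B x)" by (simp add: x)
        also have "\<dots> = 0" using True by (simp add: P_Int[OF a(1) Bs] P_empty)
        finally show ?thesis by (simp add: Dl linear_simps[OF P_linear[OF Cs]])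
      next
        case False
        then obtain b where b: "b \<in> a k" "b \<in> B" by blast
        let ?y = "P (a k) x"
        have far: "d / 2 \<le> cmod (w - z k)" if "w \<in> C d" for w
        proof -
          have "d \<le> cmod (w - b)" using that b by (auto simp: C_def)
          also have "\<dots> \<le> cmod (w - z k) + cmod (b - z k)"
            using norm_triangle_ineq4[of "w - z k" "b - z k"] by simp
          finally show ?thesis using a(5)[OF b(1)] nd by linarith
        qed
        have "d / 2 * norm (P (C d) (D ?y)) \<le> norm (U (D ?y) - z k *\<^sub>C D ?y)"
          by (rule near_eigenvector_concentrated[OF a(4) Cs far]) (use d in auto)
        also have "\<dots> = norm (D (U ?y - z k *\<^sub>C ?y))"
          by (simp add: Dl bounded_clinearD(2)[OF D] DU)
        also have "\<dots> \<le> norm (U ?y - z k *\<^sub>C ?y) * K" by (rule K)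
        also have "\<dots> \<le> (2 * pi / n * norm ?y) * K"
          by (intro mult_right_mono near_eigenvector[OF a(4) a(1) P_idem[OF a(1)]] a(5)) (use K in auto)
        finally show ?thesis using d n0 by (simp add: field_simps)
      qed
      have xs: "x = (\<Sum>k<n. P (a k) x)"
        using P_UN[of "{..<n}" a x] a(1,2,3) by (simp add: P_top)
      have "P (C d) (D (\<Sum>k<n. P (a k) x)) = (\<Sum>k<n. P (C d) (D (P (a k) x)))"
        by (simp add: bounded_linear_sum_arg[OF bounded_clinearD(1)[OF D]]
            bounded_linear_sum_arg[OF P_linear[OF Cs]])
      then have "norm (P (C d) (D x)) = norm (\<Sum>k<n. P (C d) (D (P (a k) x)))"
        by (simp only: arg_cong[OF xs, of D])
      also have "\<dots> \<le> (\<Sum>k<n. norm (P (C d) (D (P (a k) x))))" by (rule norm_sum)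
      also have "\<dots> \<le> (\<Sum>k<n. (4 * pi * K / (d * n)) * norm (P (a k) x))"
        by (intro sum_mono piece)
      also have "\<dots> = (4 * pi * K / (d * n)) * (\<Sum>k<n. norm (P (a k) x))"
        by (simp add: sum_distrib_left)
      also have "\<dots> \<le> (4 * pi * K / (d * n)) * (sqrt (card {..<n}) * norm x)"
        by (intro mult_left_mono sum_norm_le_sqrt_card[OF sum_norm_P_le]) (use a K d in auto)
      also have "\<dots> = (4 * pi * K * norm x / d) / sqrt n"
        using n0 divide_mult_sqrt[of n "4 * pi * K / d" "norm x"] by (simp add: mult_ac)
      finally show ?thesis .
    qed
    have "norm (P (C d) (D x)) = 0" by (rule zero_if_le_inverse_sqrt[OF norm_ge_zero bound])
    then show ?thesis by simp
  qed
  have "unit_circle - B = (\<Union>n. C (inverse (real (Suc n))))"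
  proof (intro equalityI subsetI)
    fix w assume w: "w \<in> unit_circle - B"
    then obtain e where e: "e > 0" "ball w e \<subseteq> - B"
      using openE[of "- B" w] B(1) by (auto simp: open_Compl)
    obtain n where n: "inverse (real (Suc n)) < e" using reals_Archimedean[OF e(1)] by blast
    have "inverse (real (Suc n)) \<le> cmod (w - b)" if "b \<in> B" for b
    proof (rule ccontr)
      assume "\<not> ?thesis"
      then have "b \<in> ball w e" using n by (simp add: dist_norm)
      then show False using e that by blast
    qed
    then show "w \<in> (\<Union>n. C (inverse (real (Suc n))))" using w by (auto simp: C_def)
  next
    fix w assume "w \<in> (\<Union>n. C (inverse (real (Suc n))))"
    then obtain n where n: "w \<in> C (inverse (real (Suc n)))" by blast
    have "w \<notin> B"
    proof
      assume "w \<in> B"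
      then have "inverse (real (Suc n)) \<le> cmod (w - w)" using n unfolding C_def by blast
      then show False by (simp add: field_simps)
    qed
    then show "w \<in> unit_circle - B" using n by (auto simp: C_def)
  qed
  moreover have "P (\<Union>n. C (inverse (real (Suc n)))) (D x) = 0"
  proof -
    define A where "A n = C (inverse (real (Suc n)))" for n
    have ds: "range (disjointed A) \<subseteq> sets circle_borel"
      by (rule sets.range_disjointed_sets) (auto simp: A_def Cs)
    have "P (disjointed A n) (D x) = 0" for n
    proof -
      have "P (disjointed A n) (P (A n) (D x)) = P (disjointed A n \<inter> A n) (D x)"
        by (rule P_Int) (use ds in \<open>auto simp: A_def Cs\<close>)
      moreover have "disjointed A n \<inter> A n = disjointed A n" using disjointed_subset[of A n] by blast
      moreover have "disjointed A n \<in> sets circle_borel" using ds by blast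
      ultimately show ?thesis by (simp add: A_def zero linear_simps[OF P_linear])
    qed
    then have "(\<lambda>n. 0) sums P (\<Union>n. disjointed A n) (D x)"
      using P_sums[OF ds disjoint_family_disjointed, of "D x"] by simp
    then show ?thesis using sums_unique2[OF _ sums_zero] by (simp add: UN_disjointed_eq A_def)
  qed
  ultimately show ?thesis using P_Compl[OF Bs, of "D x"] by simp
qed

text \<open>
  For closed sets the previous lemma and self-adjointness give commutation; the sets for which it
  holds form a sigma-algebra on the circle.
\<close>

lemma commutant_commutes_P:
  assumes D: "bounded_clinear D" and sa: "\<And>x y. inner (D x) y = inner x (D y)"
    and DU: "\<And>x. D (U x) = U (D x)" and B: "B \<in> sets circle_borel"
  shows "P B (D x) = D (P B x)"
proof -
  note Dl = linear_simps[OF bounded_clinearD(1)[OF D]]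
  define Q where "Q B \<longleftrightarrow> B \<in> sets circle_borel \<and> (\<forall>x. P B (D x) = D (P B x))" for B
  have Q_closed: "Q B" if B: "closed B" "B \<subseteq> unit_circle" for B
  proof -
    have Bs: "B \<in> sets circle_borel" using B by (intro circle_setsI) auto
    let ?C = "unit_circle - B"
    have Cs: "?C \<in> sets circle_borel" using Bs circle_sets_top by (rule sets.Diff[rotated])
    have "P B (D x) = D (P B x)" for x
    proof (rule commute_if_invariant[OF bounded_clinearD(1)[OF D] Bs])
      show "P B (D x) = D x" if "P B x = x" for x
        by (rule range_P_invariant_closed[OF D DU B that])
      fix x assume x: "P ?C x = x"
      have "inner (P B (D x)) y = 0" for y
      proof -
        have "inner (P B (D x)) y = inner x (D (P B y))"
          using sa P_selfadjoint[OF Bs] by simp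
        also have "\<dots> = inner (P ?C x) (P B (D (P B y)))"
          using x range_P_invariant_closed[OF D DU B P_idem[OF Bs]] by simp
        also have "\<dots> = inner x (P ?C (P B (D (P B y))))" by (rule P_selfadjoint[OF Cs])
        also have "P ?C (P B (D (P B y))) = 0" by (rule P_disjoint[OF Bs Cs]) auto
        finally show ?thesis by simp
      qed
      then have "P B (D x) = 0" by (metis inner_eq_zero_iff)
      then show "P ?C (D x) = D x" using P_Compl[OF Bs, of "D x"] by simp
    qed
    then show ?thesis using Bs by (simp add: Q_def)
  qed
  have Q_Compl: "Q (unit_circle - B)" if "Q B" for B
    using that circle_sets_top by (auto simp: Q_def P_Compl Dl)
  have Q_Int: "Q (B \<inter> C)" if "Q B" "Q C" for B C
    using that by (auto simp: Q_def P_Int[symmetric])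
  have Q_Diff: "Q (B - C)" if "Q B" "Q C" for B C
  proof -
    have "B - C = B \<inter> (unit_circle - C)" using that circle_sets_space by (auto simp: Q_def)
    then show ?thesis using Q_Int[OF that(1) Q_Compl[OF that(2)]] by simp
  qed
  have Q_empty: "Q {}" by (auto simp: Q_def P_empty Dl)
  have Q_Un: "Q (B \<union> C)" if "Q B" "Q C" for B C
  proof -
    have "B \<union> C = unit_circle - ((unit_circle - B) \<inter> (unit_circle - C))"
      using that circle_sets_space by (auto simp: Q_def)
    then show ?thesis using Q_Compl[OF Q_Int[OF Q_Compl[OF that(1)] Q_Compl[OF that(2)]]] by simp
  qed
  have Q_UN: "Q (\<Union>n. A n)" if A: "\<And>n::nat. Q (A n)" for A
  proof -
    have "Q (\<Union>i\<in>{0..<n}. A i)" for n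
      by (induction n) (auto simp: Q_empty atLeastLessThanSuc intro: Q_Un A)
    then have dQ: "Q (disjointed A n)" for n unfolding disjointed_def by (intro Q_Diff A)
    then have ds: "range (disjointed A) \<subseteq> sets circle_borel" by (auto simp: Q_def)
    have "P (\<Union>n. disjointed A n) (D x) = D (P (\<Union>n. disjointed A n) x)" for x
    proof (rule sums_unique2)
      show "(\<lambda>n. P (disjointed A n) (D x)) sums P (\<Union>n. disjointed A n) (D x)"
        by (rule P_sums[OF ds disjoint_family_disjointed])
      have "(\<lambda>n. D (P (disjointed A n) x)) sums D (P (\<Union>n. disjointed A n) x)"
        by (intro bounded_linear.sums[OF bounded_clinearD(1)[OF D]] P_sums[OF ds disjoint_family_disjointed])
      then show "(\<lambda>n. P (disjointed A n) (D x)) sums D (P (\<Union>n. disjointed A n) x)"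
        using dQ by (simp add: Q_def)
    qed
    moreover have "(\<Union>n. A n) \<in> sets circle_borel" using A by (auto simp: Q_def)
    ultimately show ?thesis by (simp add: Q_def UN_disjointed_eq)
  qed
  obtain B0 where B0: "B0 \<in> sets borel" "B = unit_circle \<inter> B0"
    using B by (auto simp: sets_restrict_space)
  have "B0 \<in> sigma_sets UNIV (Collect closed)" using B0(1) by (simp add: borel_eq_closed)
  then have "Q (unit_circle \<inter> B0)"
  proof induction
    case (Basic a) then show ?case by (intro Q_closed) auto
  next
    case Empty then show ?case using Q_empty by simp
  next
    case (Compl a)
    have "unit_circle \<inter> (UNIV - a) = unit_circle - (unit_circle \<inter> a)" by auto
    then show ?case using Q_Compl[OF Compl.IH] by simp
  next
    case (Union a)
    have "unit_circle \<inter> (\<Union>i. a i) = (\<Union>i. unit_circle \<inter> a i)" by auto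
    then show ?case using Q_UN[OF Union.IH] by simp
  qed
  then show ?thesis using B0(2) by (simp add: Q_def)
qed

end

section \<open>Packing numbers and crowded points\<close>

abbreviation separated :: "real \<Rightarrow> complex set \<Rightarrow> bool" where
  "separated r \<equiv> pairwise (\<lambda>x y. r < dist x y)"

text \<open>
  The maximum is over a finite set of cardinalities as soon as \<open>r > 0\<close> and \<open>E\<close> lies on the circle.
\<close>

definition packing_number :: "complex set \<Rightarrow> real \<Rightarrow> nat" where
  "packing_number E r = Max {card A | A. finite A \<and> A \<subseteq> E \<and> separated r A}"

lemma separated_card_le_covering:
  assumes E: "E \<subseteq> unit_circle" and r: "r > 0" and A: "A \<subseteq> E" "separated r A"
  shows "finite A \<and> card A \<le> arc_covering_number E r"
proof -
  let ?Q = "\<lambda>n. \<exists>a::nat \<Rightarrow> real. E \<subseteq> (\<Union>i<n. closed_arc (a i) r)"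
  define n where "n = Suc (nat \<lceil>2 * pi / r\<rceil>)"
  have n: "2 * pi \<le> n * r"
  proof -
    have "2 * pi / r \<le> n" unfolding n_def by linarith
    then show ?thesis using r by (simp add: field_simps)
  qed
  have "?Q n"
  proof (intro exI[of _ "\<lambda>i. real i * r"] subsetI)
    fix w assume "w \<in> E"
    then have w: "cmod w = 1" using E by auto
    define t where "t = Arg2pi w"
    have t: "0 \<le> t" "t < 2 * pi" "w = cis t"
      using w Arg2pi[of w] by (auto simp: t_def cis_conv_exp is_Arg_def)
    define i where "i = nat \<lfloor>t / r\<rfloor>"
    have "real i = of_int \<lfloor>t / r\<rfloor>" using t(1) r by (simp add: i_def)
    then have i: "real i \<le> t / r" "t / r < real i + 1" by linarith+
    then have i': "real i * r \<le> t" "t \<le> real i * r + r" using r by (simp_all add: field_simps)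
    have "real i * r < n * r" using i'(1) t(2) n by linarith
    then have "i < n" using r by simp
    moreover have "w \<in> closed_arc (real i * r) r"
      unfolding closed_arc_def t(3) using i' by (intro imageI) simp
    ultimately show "w \<in> (\<Union>i<n. closed_arc (real i * r) r)" by blast
  qed
  then have "?Q (arc_covering_number E r)" unfolding arc_covering_number_def by (rule LeastI)
  then obtain a :: "nat \<Rightarrow> real" where a: "E \<subseteq> (\<Union>i<arc_covering_number E r. closed_arc (a i) r)" ..
  have "\<forall>x\<in>A. \<exists>i<arc_covering_number E r. x \<in> closed_arc (a i) r" using a A(1) by blast
  then obtain i where i: "\<And>x. x \<in> A \<Longrightarrow> i x < arc_covering_number E r"
      "\<And>x. x \<in> A \<Longrightarrow> x \<in> closed_arc (a (i x)) r" by metis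
  have "inj_on i A"
  proof (rule inj_onI, rule ccontr)
    fix x y assume xy: "x \<in> A" "y \<in> A" "i x = i y" "x \<noteq> y"
    obtain s t where st: "x = cis s" "y = cis t" "s \<in> {a (i x)..a (i x) + r}" "t \<in> {a (i x)..a (i x) + r}"
      using i(2)[OF xy(1)] i(2)[OF xy(2)] xy(3) by (auto simp: closed_arc_def)
    have "dist x y \<le> \<bar>s - t\<bar>" unfolding st dist_norm by (rule norm_cis_diff_le)
    also have "\<dots> \<le> r" using st(3,4) by auto
    finally show False using pairwiseD[OF A(2) xy(1,2,4)] by simp
  qed
  moreover have "i ` A \<subseteq> {..<arc_covering_number E r}" using i(1) by auto
  ultimately show ?thesis
    using inj_on_finite card_inj_on_le by (metis card_lessThan finite_lessThan)
qed

lemma packing_number: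
  assumes E: "E \<subseteq> unit_circle" and r: "r > 0"
  shows separated_card_le: "A \<subseteq> E \<Longrightarrow> separated r A \<Longrightarrow> finite A \<and> card A \<le> packing_number E r"
    and packing_number_attained:
      "\<exists>A. finite A \<and> A \<subseteq> E \<and> separated r A \<and> card A = packing_number E r"
    and packing_number_le_covering: "packing_number E r \<le> arc_covering_number E r"
proof -
  let ?K = "{card A | A. finite A \<and> A \<subseteq> E \<and> separated r A}"
  have sub: "?K \<subseteq> {..arc_covering_number E r}" using separated_card_le_covering[OF E r] by auto
  then have fin: "finite ?K" using finite_subset by blast
  have "card {} \<in> ?K" by (rule CollectI) (auto intro!: exI[of _ "{}"])
  then have ne: "?K \<noteq> {}" by blast
  have "Max ?K \<in> ?K" by (rule Max_in[OF fin ne])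
  then show "\<exists>A. finite A \<and> A \<subseteq> E \<and> separated r A \<and> card A = packing_number E r"
    by (auto simp: packing_number_def)
  show "packing_number E r \<le> arc_covering_number E r"
    using \<open>Max ?K \<in> ?K\<close> sub unfolding packing_number_def by blast
  show "finite A \<and> card A \<le> packing_number E r" if A: "A \<subseteq> E" "separated r A"
  proof -
    have "finite A" using separated_card_le_covering[OF E r A] by simp
    then show ?thesis unfolding packing_number_def using A fin by (auto intro!: Max_ge)
  qed
qed

lemma packing_number_antimono:
  assumes E: "E \<subseteq> unit_circle" and r: "0 < r" "r \<le> r'"
  shows "packing_number E r' \<le> packing_number E r"
proof -
  obtain A where A: "A \<subseteq> E" "separated r' A" "card A = packing_number E r'"
    using packing_number_attained[OF E, of r'] r by auto
  have "separated r A" by (rule pairwise_mono[OF A(2)]) (use r in auto)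
  then show ?thesis using separated_card_le[OF E r(1) A(1)] A(3) by simp
qed

text \<open>
  At a point \<open>z\<close> of \<open>E\<close> that is not crowded, the part of \<open>E\<close> within distance \<open>W \<delta>\<close> of \<open>z\<close> already lies
  within \<open>2 \<delta>\<close>. So the set of such points splits into tiny clusters separated by gaps that are larger
  by a factor of about \<open>W\<close>. The factor 2 leaves the room needed in the next lemma.
\<close>

definition crowded_points :: "complex set \<Rightarrow> real \<Rightarrow> real \<Rightarrow> complex set" where
  "crowded_points E \<delta> W = {z \<in> E. \<exists>w\<in>E. 2 * \<delta> < dist z w \<and> dist z w < W * \<delta>}"

text \<open>
  Every crowded location allows one more point when the resolution is refined from \<open>4 W \<delta>\<close> to \<open>\<delta>\<close>:
  if a crowded point \<open>z\<close> is \<open>\<delta>\<close>-close to a point \<open>s\<close> of a coarse maximal packing \<open>S\<close>, then its companion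
  \<open>w\<close> is not, and it is also far from the rest of \<open>S\<close>; otherwise \<open>z\<close> itself can be added.
\<close>

lemma packing_number_increment:
  assumes E: "E \<subseteq> unit_circle" and \<delta>: "\<delta> > 0" and W: "W \<ge> 1"
    and Z: "finite Z" "Z \<subseteq> crowded_points E \<delta> W" "separated (10 * W * \<delta>) Z"
  shows "packing_number E (4 * W * \<delta>) + card Z \<le> packing_number E \<delta>"
proof -
  have W\<delta>: "\<delta> \<le> W * \<delta>" "W * \<delta> > 0" using \<delta> W by auto
  obtain S where S: "finite S" "S \<subseteq> E" "separated (4 * W * \<delta>) S" "card S = packing_number E (4 * W * \<delta>)"
    using packing_number_attained[OF E, of "4 * W * \<delta>"] W\<delta> by auto
  \<comment> \<open>\<open>c\<close> is the extra point contributed by \<open>z\<close>: either \<open>z\<close> itself or its companion.\<close>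
  have "\<exists>c\<in>E. dist c z < W * \<delta> \<and> (\<forall>s\<in>S. \<delta> < dist c s)" if z: "z \<in> Z" for z
  proof (cases "\<forall>s\<in>S. \<delta> < dist z s")
    case True
    then show ?thesis using z Z(2) W\<delta> by (intro bexI[of _ z]) (auto simp: crowded_points_def)
  next
    case False
    then obtain s where s: "s \<in> S" "dist z s \<le> \<delta>" by force
    obtain w where w: "w \<in> E" "2 * \<delta> < dist z w" "dist z w < W * \<delta>"
      using z Z(2) by (auto simp: crowded_points_def)
    have "\<delta> < dist w t" if t: "t \<in> S" for t
    proof (cases "t = s")
      case True
      then show ?thesis using dist_triangle[of z w s] s w by (simp add: dist_commute)
    next
      case False
      then have "4 * W * \<delta> < dist s t" using S(3) s t by (auto simp: pairwise_def)
      moreover have "dist s t \<le> dist z s + dist z w + dist w t"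
        using dist_triangle[of s t z] dist_triangle[of z t w] by (simp add: dist_commute)
      ultimately show ?thesis using s w W\<delta> by linarith
    qed
    then show ?thesis using w by (auto simp: dist_commute)
  qed
  then obtain c where c: "\<And>z. z \<in> Z \<Longrightarrow> c z \<in> E" "\<And>z. z \<in> Z \<Longrightarrow> dist (c z) z < W * \<delta>"
      "\<And>z s. z \<in> Z \<Longrightarrow> s \<in> S \<Longrightarrow> \<delta> < dist (c z) s" by metis
  have cc: "\<delta> < dist (c z) (c z')" if z: "z \<in> Z" "z' \<in> Z" "z \<noteq> z'" for z z'
  proof -
    have "10 * W * \<delta> < dist z z'" using Z(3) z by (auto simp: pairwise_def)
    moreover have "dist z z' \<le> dist (c z) z + dist (c z) (c z') + dist (c z') z'"
      using dist_triangle[of z z' "c z"] dist_triangle[of "c z" z' "c z'"] by (simp add: dist_commute)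
    ultimately show ?thesis using c(2)[OF z(1)] c(2)[OF z(2)] W\<delta> by linarith
  qed
  have inj: "inj_on c Z"
  proof (rule inj_onI, rule ccontr)
    fix z z' assume "z \<in> Z" "z' \<in> Z" "c z = c z'" "z \<noteq> z'"
    then show False using cc[of z z'] \<delta> by simp
  qed
  have disj: "S \<inter> c ` Z = {}" using c(3) \<delta> by force
  have "separated \<delta> (S \<union> c ` Z)"
  proof (rule pairwiseI)
    fix x y assume xy: "x \<in> S \<union> c ` Z" "y \<in> S \<union> c ` Z" "x \<noteq> y"
    have SS: "\<delta> < dist s t" if "s \<in> S" "t \<in> S" "s \<noteq> t" for s t
      using S(3) that W\<delta> unfolding pairwise_def by fastforce
    have cc': "\<delta> < dist (c z) (c z')" if "z \<in> Z" "z' \<in> Z" "c z \<noteq> c z'" for z z'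
      using cc[OF that(1,2)] that(3) by auto
    show "\<delta> < dist x y" using xy SS c(3) cc' by (auto simp: dist_commute)
  qed
  moreover have "S \<union> c ` Z \<subseteq> E" using S(2) c(1) by auto
  ultimately have "card (S \<union> c ` Z) \<le> packing_number E \<delta>" using separated_card_le[OF E \<delta>] by blast
  moreover have "card (S \<union> c ` Z) = card S + card Z"
    using S(1) Z(1) disj inj by (simp add: card_Un_disjoint card_image)
  ultimately show ?thesis using S(4) by simp
qed

text \<open>
  Between resolution 1 and resolution \<open>\<epsilon>\<close> there are about \<open>log (1/\<epsilon>) / log (4 W)\<close> scales, and each of
  them adds at least as many points to the packing as there are crowded locations. If at all small
  scales there were more than \<open>m\<close> of them, the covering numbers would eventually exceed
  \<open>C log (1/\<epsilon>)\<close>, for \<open>m\<close> of order \<open>C log (4 W)\<close>, contradicting the assumption on \<open>arc_alpha\<close>. A lower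
  limit in its definition suffices because one small \<open>\<epsilon>\<close> already gives the contradiction.
\<close>

lemma few_crowded_points:
  assumes E: "E \<subseteq> unit_circle" and alpha: "arc_alpha E < \<infinity>" and W: "W \<ge> 1"
  obtains m where "\<And>\<eta>. \<eta> > 0 \<Longrightarrow> \<exists>\<delta>. 0 < \<delta> \<and> \<delta> < \<eta> \<and>
      (\<forall>Z. finite Z \<and> Z \<subseteq> crowded_points E \<delta> W \<and> separated (10 * W * \<delta>) Z \<longrightarrow> card Z \<le> m)"
proof -
  obtain C :: nat where C: "arc_alpha E < ereal C" using alpha less_PInf_Ex_of_nat by auto
  define R where "R = 4 * W"
  have R: "R > 1" using W by (simp add: R_def)
  \<comment> \<open>At least \<open>m + 1\<close> new points per scale, with \<open>m + 1 > C ln R\<close>, outgrow \<open>C\<close> times the logarithm.\<close>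
  define m where "m = nat \<lceil>C * ln R\<rceil>"
  have m: "C * ln R + 1 \<le> real (Suc m)" unfolding m_def by linarith
  define q where "q s = packing_number E (1 / R ^ s)" for s :: nat
  show thesis
  proof (rule that[of m], rule ccontr)
    fix \<eta> :: real assume \<eta>: "\<eta> > 0"
    assume no: "\<not> (\<exists>\<delta>. 0 < \<delta> \<and> \<delta> < \<eta> \<and>
      (\<forall>Z. finite Z \<and> Z \<subseteq> crowded_points E \<delta> W \<and> separated (10 * W * \<delta>) Z \<longrightarrow> card Z \<le> m))"
    obtain s0 where s0: "1 / \<eta> < R ^ s0" using real_arch_pow[OF R] by blast
    have grow: "q s + Suc m \<le> q (Suc s)" if s: "s \<ge> s0" for s
    proof -
      define \<delta> where "\<delta> = 1 / R ^ Suc s"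
      have "R ^ s0 \<le> R ^ Suc s" using R s by (intro power_increasing) auto
      then have "1 / \<eta> < R ^ Suc s" using s0 by linarith
      then have "0 < \<delta>" "\<delta> < \<eta>" using \<eta> R by (auto simp: \<delta>_def field_simps)
      then obtain Z where Z: "finite Z" "Z \<subseteq> crowded_points E \<delta> W" "separated (10 * W * \<delta>) Z" "\<not> card Z \<le> m"
        using no by blast
      have "4 * W * \<delta> = 1 / R ^ s" using R by (simp add: \<delta>_def R_def[symmetric])
      then show ?thesis
        using packing_number_increment[OF E \<open>0 < \<delta>\<close> W Z(1-3)] Z(4) by (simp add: q_def \<delta>_def)
    qed
    have q_ge: "j * Suc m \<le> q (s0 + j)" for j
    proof (induction j)
      case (Suc j)
      then show ?case using grow[of "s0 + j"] by simp
    qed simp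
    \<comment> \<open>For \<open>s \<ge> K\<close> one has \<open>(m + 1) (s - s0) \<ge> C ln R (s + 1)\<close>.\<close>
    define K where "K = s0 + nat \<lceil>C * ln R * (s0 + 1)\<rceil>"
    have K: "s0 + C * ln R * (s0 + 1) \<le> K" "s0 \<le> K" by (simp_all add: K_def) linarith
    define f where "f \<epsilon> = ereal (real (arc_covering_number E \<epsilon>) / ln (1 / \<epsilon>))" for \<epsilon>
    have "\<not> eventually (\<lambda>\<epsilon>. ereal C \<le> f \<epsilon>) (at_right 0)"
    proof
      assume "eventually (\<lambda>\<epsilon>. ereal C \<le> f \<epsilon>) (at_right 0)"
      then have "ereal C \<le> Liminf (at_right 0) f" by (rule Liminf_bounded)
      also have "\<dots> = arc_alpha E" unfolding arc_alpha_def f_def[abs_def] ..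
      finally show False using C by simp
    qed
    moreover have "eventually (\<lambda>\<epsilon>. 0 < \<epsilon> \<and> \<epsilon> < 1 / R ^ Suc K) (at_right (0::real))"
      using R by (auto simp: eventually_at_right_field intro!: exI[of _ "1 / R ^ Suc K"])
    ultimately have "\<not> (\<forall>\<epsilon>. 0 < \<epsilon> \<and> \<epsilon> < 1 / R ^ Suc K \<longrightarrow> ereal C \<le> f \<epsilon>)"
      by (elim contrapos_nn) (erule eventually_mono, simp)
    then obtain \<epsilon> where \<epsilon>: "0 < \<epsilon>" "\<epsilon> < 1 / R ^ Suc K" "\<not> ereal C \<le> f \<epsilon>" by blast
    have lnR: "ln R > 0" using R by simp
    have "R ^ Suc K < 1 / \<epsilon>" using \<epsilon> R by (simp add: field_simps)
    define s where "s = nat \<lfloor>ln (1 / \<epsilon>) / ln R\<rfloor>"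
    have lK: "Suc K * ln R < ln (1 / \<epsilon>)"
    proof -
      have "ln (R ^ Suc K) < ln (1 / \<epsilon>)" using \<open>R ^ Suc K < 1 / \<epsilon>\<close> R \<epsilon> by (subst ln_less_cancel_iff) auto
      then show ?thesis using R by (simp only: ln_realpow)
    qed
    then have "Suc K < ln (1 / \<epsilon>) / ln R" using lnR by (simp add: pos_less_divide_eq)
    then have "Suc K \<le> s" "real s = of_int \<lfloor>ln (1 / \<epsilon>) / ln R\<rfloor>"
      unfolding s_def by (linarith, simp add: le_floor_iff)
    then have s: "Suc K \<le> s" "s \<le> ln (1 / \<epsilon>) / ln R" "ln (1 / \<epsilon>) / ln R < s + 1" by linarith+
    have "s * ln R \<le> ln (1 / \<epsilon>)" "ln (1 / \<epsilon>) < (s + 1) * ln R"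
      using s(2,3) lnR by (simp_all add: pos_le_divide_eq pos_divide_less_eq)
    then have "ln (R ^ s) \<le> ln (1 / \<epsilon>)" using R by (simp add: ln_realpow)
    then have "R ^ s \<le> 1 / \<epsilon>" using R \<epsilon> by (subst (asm) ln_le_cancel_iff) auto
    then have "\<epsilon> \<le> 1 / R ^ s" using R \<epsilon> by (simp add: field_simps)
    then have "q s \<le> packing_number E \<epsilon>" unfolding q_def by (rule packing_number_antimono[OF E \<epsilon>(1)])
    also have "\<dots> \<le> arc_covering_number E \<epsilon>" by (rule packing_number_le_covering[OF E \<epsilon>(1)])
    finally have "real (q s) \<le> real (arc_covering_number E \<epsilon>)" by simp
    also have "\<dots> < C * ln (1 / \<epsilon>)"
    proof -
      have "ln (1 / \<epsilon>) > 0" using lK lnR by (metis less_trans mult_pos_pos of_nat_0_less_iff zero_less_Suc)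
      then show ?thesis using \<epsilon>(3) by (simp add: f_def not_le pos_divide_less_eq)
    qed
    also have "\<dots> \<le> C * ((s + 1) * ln R)"
      using \<open>ln (1 / \<epsilon>) < (s + 1) * ln R\<close> by (intro mult_left_mono) auto
    finally have 1: "real (q s) < C * ln R * (s + 1)" by (simp add: mult_ac)
    have "real ((s - s0) * Suc m) \<le> real (q s)" using q_ge[of "s - s0"] s(1) K(2) by (subst of_nat_le_iff) auto
    moreover have "(real s - s0) * (C * ln R + 1) \<le> real ((s - s0) * Suc m)"
    proof -
      have "(real s - s0) * (C * ln R + 1) \<le> (real s - s0) * real (Suc m)"
        using m s(1) K(2) by (intro mult_left_mono) auto
      then show ?thesis using s(1) K(2) by (simp only: of_nat_mult of_nat_diff)
    qed
    ultimately have "(real s - s0) * (C * ln R + 1) < C * ln R * (s + 1)" using 1 by linarith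
    then have "real s < s0 + C * ln R * (s0 + 1)" by (simp add: algebra_simps)
    then show False using K s(1) by linarith
  qed
qed

section \<open>Mass of the crowded points, and clusters\<close>

lemma small_balls_of_atomless_measure:
  assumes fin: "finite_measure M" and M: "sets M = sets circle_borel"
    and atomless: "\<And>z. z \<in> unit_circle \<Longrightarrow> measure M {z} = 0" and \<eta>: "\<eta> > 0"
  obtains r where "r > 0" "\<And>z. z \<in> unit_circle \<Longrightarrow> measure M (unit_circle \<inter> cball z r) \<le> \<eta>"
proof -
  interpret finite_measure M by fact
  have sp: "space M = unit_circle" using sets_eq_imp_space_eq[OF M] by (simp add: space_restrict_space)
  have meas: "unit_circle \<inter> B \<in> sets M" if "closed B \<or> open B" for B
    unfolding M using that by (intro circle_setsI) auto
  have "\<exists>r>0. measure M (unit_circle \<inter> cball z r) < \<eta>" if z: "z \<in> unit_circle" for z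
  proof -
    let ?A = "\<lambda>n. unit_circle \<inter> cball z (inverse (real (Suc n)))"
    have "(\<lambda>n. measure M (?A n)) \<longlonglongrightarrow> measure M (\<Inter>n. ?A n)"
    proof (rule finite_Lim_measure_decseq)
      show "range ?A \<subseteq> sets M" using meas by auto
      show "decseq ?A" by (intro decseq_SucI Int_mono order_refl subset_cball le_imp_inverse_le) auto
    qed
    moreover have "(\<Inter>n. ?A n) = {z}"
    proof
      show "(\<Inter>n. ?A n) \<subseteq> {z}"
      proof
        fix w assume w: "w \<in> (\<Inter>n. ?A n)"
        have "dist z w = 0"
        proof (rule ccontr)
          assume "dist z w \<noteq> 0"
          then obtain n where "inverse (real (Suc n)) < dist z w" using reals_Archimedean[of "dist z w"] by auto
          moreover have "dist z w \<le> inverse (real (Suc n))" using w by (metis IntD2 INT_D UNIV_I mem_cball)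
          ultimately show False by simp
        qed
        then show "w \<in> {z}" by simp
      qed
    qed (use z in auto)
    ultimately have "(\<lambda>n. measure M (?A n)) \<longlonglongrightarrow> 0" using atomless[OF z] by simp
    then obtain n where "measure M (?A n) < \<eta>"
      using \<eta> by (metis (no_types, lifting) eventually_sequentially order_tendstoD(2) order_refl)
    then show ?thesis by (intro exI[of _ "inverse (real (Suc n))"]) auto
  qed
  then obtain r where r: "\<And>z. z \<in> unit_circle \<Longrightarrow> r z > 0"
    "\<And>z. z \<in> unit_circle \<Longrightarrow> measure M (unit_circle \<inter> cball z (r z)) < \<eta>" by metis
  define \<C> where "\<C> = (\<lambda>z. ball z (r z)) ` unit_circle"
  have cov: "compact unit_circle" "\<C> \<noteq> {}" "unit_circle \<subseteq> \<Union> \<C>" "\<And>B. B \<in> \<C> \<Longrightarrow> open B"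
    using r(1) by (auto simp: \<C>_def intro!: exI[of _ 1])
  have "\<exists>e>0. \<forall>T. T \<subseteq> unit_circle \<longrightarrow> diameter T < e \<longrightarrow> (\<exists>B\<in>\<C>. T \<subseteq> B)"
  proof (rule Lebesgue_number_lemma[OF cov(1-3)])
    show "open B" if "B \<in> \<C>" for B by (rule cov(4)[OF that])
    fix \<delta> :: real
    assume "0 < \<delta>" and "\<And>T. T \<subseteq> unit_circle \<Longrightarrow> diameter T < \<delta> \<Longrightarrow> \<exists>B\<in>\<C>. T \<subseteq> B"
    then show ?thesis by blast
  qed
  then obtain e where e: "e > 0"
    "\<And>T. T \<subseteq> unit_circle \<Longrightarrow> diameter T < e \<Longrightarrow> \<exists>B\<in>\<C>. T \<subseteq> B" by blast
  show thesis
  proof (rule that[of "e/4"])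
    fix z assume z: "z \<in> unit_circle"
    let ?T = "unit_circle \<inter> cball z (e/4)"
    have "diameter ?T \<le> 2 * (e/4)"
    proof (rule diameter_le)
      show "norm (x - y) \<le> 2 * (e/4)" if "x \<in> ?T" "y \<in> ?T" for x y
        using that dist_triangle[of x y z] by (simp add: dist_norm[symmetric] dist_commute)
    qed (use e(1) in simp)
    then have "diameter ?T < e" using e(1) by simp
    then obtain y where y: "y \<in> unit_circle" "?T \<subseteq> ball y (r y)"
      using e(2)[of ?T] by (auto simp: \<C>_def)
    have "measure M ?T \<le> measure M (unit_circle \<inter> cball y (r y))"
      by (rule finite_measure_mono) (use y in \<open>auto intro: meas\<close>)
    then show "measure M ?T \<le> \<eta>" using r(2)[OF y(1)] by simp
  qed (use e in simp)
qed

lemma crowded_points_measurable: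
  assumes "closed E" "E \<subseteq> unit_circle" shows "crowded_points E \<delta> W \<in> sets circle_borel"
proof (rule circle_setsI)
  have "crowded_points E \<delta> W = E \<inter> (\<Union>w\<in>E. {z. 2 * \<delta> < dist z w} \<inter> {z. dist z w < W * \<delta>})"
    by (auto simp: crowded_points_def)
  moreover have "open (\<Union>w\<in>E. {z. 2 * \<delta> < dist z w} \<inter> {z. dist z w < W * \<delta>})"
    by (intro open_UN ballI open_Int open_Collect_less continuous_intros)
  ultimately show "crowded_points E \<delta> W \<in> sets borel" using assms(1) by (simp add: sets.Int)
qed (use assms in \<open>auto simp: crowded_points_def\<close>)

text \<open>
  The crowded points are covered by a number of balls that stays bounded while their radius
  \<open>10 W \<delta>\<close> tends to zero, and small balls have small measure uniformly because there are no atoms.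
\<close>

lemma small_crowded_set:
  assumes E: "closed E" "E \<subseteq> unit_circle" and alpha: "arc_alpha E < \<infinity>" and W: "W \<ge> 1"
    and fin: "finite_measure M" and M: "sets M = sets circle_borel"
    and atomless: "\<And>z. z \<in> unit_circle \<Longrightarrow> measure M {z} = 0" and \<eta>: "\<eta> > 0"
  obtains \<delta> where "0 < \<delta>" "\<delta> < \<eta>" "measure M (crowded_points E \<delta> W) \<le> \<eta>"
proof -
  interpret finite_measure M by fact
  obtain m where m: "\<And>\<eta>. \<eta> > 0 \<Longrightarrow> \<exists>\<delta>. 0 < \<delta> \<and> \<delta> < \<eta> \<and>
      (\<forall>Z. finite Z \<and> Z \<subseteq> crowded_points E \<delta> W \<and> separated (10 * W * \<delta>) Z \<longrightarrow> card Z \<le> m)"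
    by (rule few_crowded_points[OF E(2) alpha W]) blast
  have pos: "\<eta> / real (Suc m) > 0" using \<eta> by simp
  obtain r where r: "r > 0"
      "\<And>z. z \<in> unit_circle \<Longrightarrow> measure M (unit_circle \<inter> cball z r) \<le> \<eta> / real (Suc m)"
    by (rule small_balls_of_atomless_measure[OF fin M _ pos]) (erule atomless, erule that, blast)
  have "min \<eta> (r / (10 * W)) > 0" using \<eta> r W by simp
  from m[OF this] obtain \<delta> where \<delta>: "0 < \<delta>" "\<delta> < min \<eta> (r / (10 * W))"
    "\<And>Z. finite Z \<Longrightarrow> Z \<subseteq> crowded_points E \<delta> W \<Longrightarrow> separated (10 * W * \<delta>) Z \<Longrightarrow> card Z \<le> m" by blast
  let ?B = "crowded_points E \<delta> W"
  have B: "?B \<subseteq> unit_circle" using E(2) by (auto simp: crowded_points_def)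
  have W\<delta>: "10 * W * \<delta> > 0" "10 * W * \<delta> \<le> r" using \<delta> W by (auto simp: field_simps)
  obtain Z where Z: "finite Z" "Z \<subseteq> ?B" "separated (10 * W * \<delta>) Z" "card Z = packing_number ?B (10 * W * \<delta>)"
    using packing_number_attained[OF B W\<delta>(1)] by blast
  have "?B \<subseteq> (\<Union>z\<in>Z. unit_circle \<inter> cball z r)"
  proof
    fix x assume x: "x \<in> ?B"
    show "x \<in> (\<Union>z\<in>Z. unit_circle \<inter> cball z r)"
    proof (rule ccontr)
      assume "\<not> ?thesis"
      then have far: "r < dist z x" if "z \<in> Z" for z using that x B by fastforce
      have "separated (10 * W * \<delta>) (insert x Z)"
        using Z(3) far W\<delta>(2) by (fastforce simp: pairwise_insert dist_commute)
      then have "card (insert x Z) \<le> card Z"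
        using separated_card_le[OF B W\<delta>(1), of "insert x Z"] Z x by simp
      moreover have "x \<notin> Z" using far[of x] r(1) by auto
      ultimately show False using Z(1) by simp
    qed
  qed
  moreover have meas: "unit_circle \<inter> cball z r \<in> sets M" for z
    unfolding M by (intro circle_setsI) auto
  ultimately have "measure M ?B \<le> measure M (\<Union>z\<in>Z. unit_circle \<inter> cball z r)"
    using Z(1) by (intro finite_measure_mono sets.finite_UN) auto
  also have "\<dots> \<le> (\<Sum>z\<in>Z. measure M (unit_circle \<inter> cball z r))"
    using Z(1) meas by (intro finite_measure_subadditive_finite) auto
  also have "\<dots> \<le> (\<Sum>z\<in>Z. \<eta> / real (Suc m))"
    using Z(2) B by (intro sum_mono r(2)) auto
  also have "\<dots> = card Z * (\<eta> / real (Suc m))" by simp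
  also have "\<dots> \<le> real (Suc m) * (\<eta> / real (Suc m))"
    using \<delta>(3)[OF Z(1-3)] \<eta> by (intro mult_right_mono) auto
  also have "\<dots> = \<eta>" by simp
  finally show thesis using that \<delta> by auto
qed

lemma cluster_decomposition:
  assumes E: "E \<subseteq> unit_circle" and \<delta>: "\<delta> > 0" and W: "W > 4"
  obtains S where "finite S" "S \<subseteq> E" "\<And>s t. s \<in> S \<Longrightarrow> t \<in> S \<Longrightarrow> s \<noteq> t \<Longrightarrow> W * \<delta> \<le> cmod (s - t)"
    "E - crowded_points E \<delta> W \<subseteq> (\<Union>s\<in>S. cball s (2 * \<delta>))"
    "disjoint_family_on (\<lambda>s. cball s (2 * \<delta>)) S"
proof -
  let ?G = "E - crowded_points E \<delta> W"
  have G: "?G \<subseteq> unit_circle" using E by auto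
  have gap: "dist x y \<le> 2 * \<delta> \<or> W * \<delta> \<le> dist x y" if "x \<in> ?G" "y \<in> ?G" for x y
    using that by (auto simp: crowded_points_def)
  have \<delta>2: "2 * \<delta> > 0" using \<delta> by simp
  obtain S where S: "finite S" "S \<subseteq> ?G" "separated (2 * \<delta>) S" "card S = packing_number ?G (2 * \<delta>)"
    using packing_number_attained[OF G \<delta>2] by blast
  have far: "W * \<delta> \<le> dist s t" if "s \<in> S" "t \<in> S" "s \<noteq> t" for s t
    using gap[of s t] that S(2,3) by (force simp: pairwise_def)
  show thesis
  proof (rule that[of S])
    show "W * \<delta> \<le> cmod (s - t)" if "s \<in> S" "t \<in> S" "s \<noteq> t" for s t
      using far[OF that] by (simp add: dist_norm)
    show "?G \<subseteq> (\<Union>s\<in>S. cball s (2 * \<delta>))"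
    proof (rule subsetI, rule ccontr)
      fix x assume x: "x \<in> ?G" and "x \<notin> (\<Union>s\<in>S. cball s (2 * \<delta>))"
      then have nb: "2 * \<delta> < dist s x" if "s \<in> S" for s using that by (simp add: not_le)
      then have "separated (2 * \<delta>) (insert x S)"
        using S(3) by (auto simp: pairwise_insert dist_commute)
      then have "card (insert x S) \<le> card S"
        using separated_card_le[OF G \<delta>2, of "insert x S"] S x by simp
      moreover have "x \<notin> S" using nb[of x] \<delta> by auto
      ultimately show False using S(1) by simp
    qed
    show "disjoint_family_on (\<lambda>s. cball s (2 * \<delta>)) S"
      unfolding disjoint_family_on_def
    proof (intro ballI impI equals0I)
      fix s t x assume st: "s \<in> S" "t \<in> S" "s \<noteq> t" and x: "x \<in> cball s (2 * \<delta>) \<inter> cball t (2 * \<delta>)"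
      have "dist s t \<le> dist s x + dist t x" by (rule dist_triangle2)
      also have "\<dots> \<le> 4 * \<delta>" using x by simp
      also have "\<dots> < W * \<delta>" using W \<delta> by simp
      finally show False using far[OF st] by simp
    qed
  qed (use S in auto)
qed

section \<open>Averages of separated exponential sums\<close>

lemma sum_inverse_squares_le:
  assumes K: "finite K" "0 \<notin> K"
  shows "(\<Sum>k\<in>K. 1 / (real k)\<^sup>2) \<le> 2"
proof -
  have *: "(\<Sum>k\<in>{1..Suc n}. 1 / (real k)\<^sup>2) \<le> 2 - 1 / real (Suc n)" for n
  proof (induction n)
    case (Suc n)
    have "1 / (real (Suc (Suc n)))\<^sup>2 \<le> 1 / real (Suc n) - 1 / real (Suc (Suc n))"
      by (simp add: divide_simps power2_eq_square)
    then show ?case using Suc by simp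
  qed simp
  have "(\<Sum>k\<in>K. 1 / (real k)\<^sup>2) \<le> (\<Sum>k\<in>{1..Suc (Max (insert 0 K))}. 1 / (real k)\<^sup>2)"
  proof (rule sum_mono2)
    show "K \<subseteq> {1..Suc (Max (insert 0 K))}"
    proof
      fix k assume k: "k \<in> K"
      then have "k \<le> Max (insert 0 K)" using K(1) by (intro Max_ge) auto
      moreover have "k \<noteq> 0" using k K(2) by metis
      ultimately show "k \<in> {1..Suc (Max (insert 0 K))}" by simp
    qed
  qed auto
  also have "\<dots> \<le> 2" by (rule order_trans[OF *]) simp
  finally show ?thesis .
qed

lemma norm_cis_minus_one_ge:
  assumes "\<bar>t\<bar> \<le> pi" shows "\<bar>t\<bar> / 3 \<le> cmod (cis t - 1)"
proof -
  have sin: "x / 3 \<le> sin x" if x: "0 \<le> x" "x \<le> pi / 2" for x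
  proof -
    have "\<bar>sin x - (\<Sum>m<3. sin_coeff m * x ^ m)\<bar> \<le> inverse (fact 3) * \<bar>x\<bar> ^ 3"
      by (rule Maclaurin_sin_bound)
    then have "\<bar>sin x - x\<bar> \<le> x ^ 3 / 6"
      using x by (simp add: eval_nat_numeral sin_coeff_def field_simps)
    then have "x - x ^ 3 / 6 \<le> sin x" by linarith
    moreover have "x * x\<^sup>2 \<le> x * 2\<^sup>2"
      using x pi_less_4 by (intro mult_left_mono power_mono) auto
    then have "x ^ 3 \<le> 4 * x" by (simp add: power3_eq_cube power2_eq_square)
    ultimately show ?thesis by linarith
  qed
  have "\<bar>t\<bar> / 2 / 3 \<le> sin (\<bar>t\<bar> / 2)" by (rule sin) (use assms in auto)
  also have "\<dots> \<le> \<bar>sin (t / 2)\<bar>" by (cases "t \<ge> 0") (auto simp: abs_real_def)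
  finally show ?thesis using norm_cis_diff[of t 0] by simp
qed

text \<open>
  Measured by their angle from \<open>z i\<close>, the other points on either side fall into distinct intervals
  \<open>[k \<gamma>, (k + 1) \<gamma>)\<close> with \<open>k \<ge> 1\<close>, so the sum is dominated by \<open>\<Sum> 1 / (k \<gamma>)\<^sup>2\<close>.
\<close>

lemma sum_inverse_squared_distances:
  fixes z :: "'i \<Rightarrow> complex"
  assumes I: "finite I" "i \<in> I" and z: "\<And>i. i \<in> I \<Longrightarrow> cmod (z i) = 1"
    and gap: "\<And>i j. i \<in> I \<Longrightarrow> j \<in> I \<Longrightarrow> i \<noteq> j \<Longrightarrow> \<gamma> \<le> cmod (z i - z j)" and \<gamma>: "\<gamma> > 0"
  shows "(\<Sum>j\<in>I - {i}. 1 / (cmod (z i - z j))\<^sup>2) \<le> 36 / \<gamma>\<^sup>2"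
proof -
  define \<phi> where "\<phi> j = Arg (z j / z i)" for j
  have cis: "z j = z i * cis (\<phi> j)" if "j \<in> I" for j
  proof -
    have "cmod (z j / z i) = 1" using z[OF that] z[OF I(2)] by (simp add: norm_divide)
    moreover from this have "z j / z i \<noteq> 0" by auto
    ultimately have "cis (\<phi> j) = z j / z i" by (simp add: \<phi>_def cis_Arg sgn_div_norm)
    then show ?thesis using z[OF I(2)] by auto
  qed
  have \<phi>: "\<bar>\<phi> j\<bar> \<le> pi" for j using Arg_bounded[of "z j / z i"] by (simp add: \<phi>_def abs_le_iff)
  have dij: "cmod (z i - z j) = cmod (cis (\<phi> j) - 1)" if "j \<in> I" for j
  proof -
    have "z i - z j = z i * (1 - cis (\<phi> j))" using cis[OF that] by (simp add: right_diff_distrib)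
    then show ?thesis using z[OF I(2)] by (simp add: norm_mult norm_minus_commute)
  qed
  have \<phi>_ge: "\<gamma> \<le> \<bar>\<phi> j\<bar>" if j: "j \<in> I - {i}" for j
    using gap[of i j] norm_cis_diff_le[of "\<phi> j" 0] dij[of j] j I(2) by auto
  define k where "k j = nat \<lfloor>\<bar>\<phi> j\<bar> / \<gamma>\<rfloor>" for j
  have k: "real (k j) \<le> \<bar>\<phi> j\<bar> / \<gamma>" "\<bar>\<phi> j\<bar> / \<gamma> < real (k j) + 1" for j
  proof -
    have "real (k j) = of_int \<lfloor>\<bar>\<phi> j\<bar> / \<gamma>\<rfloor>" using \<gamma> by (simp add: k_def)
    then show "real (k j) \<le> \<bar>\<phi> j\<bar> / \<gamma>" "\<bar>\<phi> j\<bar> / \<gamma> < real (k j) + 1" by linarith+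
  qed
  have k1: "k j \<noteq> 0" if j: "j \<in> I - {i}" for j
  proof
    assume "k j = 0"
    then have "\<bar>\<phi> j\<bar> / \<gamma> < 1" using k(2)[of j] by simp
    then show False using \<phi>_ge[OF j] \<gamma> by (simp add: field_simps)
  qed
  have summand: "1 / (cmod (z i - z j))\<^sup>2 \<le> 9 / \<gamma>\<^sup>2 * (1 / (real (k j))\<^sup>2)" if j: "j \<in> I - {i}" for j
  proof -
    have "real (k j) * \<gamma> \<le> \<bar>\<phi> j\<bar>" using k(1)[of j] \<gamma> by (simp add: field_simps)
    then have "real (k j) * \<gamma> / 3 \<le> cmod (z i - z j)"
      using norm_cis_minus_one_ge[OF \<phi>, of j] dij[of j] j by simp
    then have "(real (k j) * \<gamma> / 3)\<^sup>2 \<le> (cmod (z i - z j))\<^sup>2" using \<gamma> by (intro power_mono) auto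
    moreover have pos: "0 < (real (k j) * \<gamma> / 3)\<^sup>2" using k1[OF j] \<gamma> by simp
    ultimately have "1 / (cmod (z i - z j))\<^sup>2 \<le> 1 / (real (k j) * \<gamma> / 3)\<^sup>2"
      by (intro divide_left_mono mult_pos_pos) auto
    then show ?thesis by (simp add: power_mult_distrib power_divide mult.commute)
  qed
  have half: "(\<Sum>j\<in>J. 1 / (cmod (z i - z j))\<^sup>2) \<le> 18 / \<gamma>\<^sup>2"
    if J: "J \<subseteq> I - {i}" and sgn: "\<And>j l. j \<in> J \<Longrightarrow> l \<in> J \<Longrightarrow> \<bar>\<phi> j - \<phi> l\<bar> = \<bar>\<bar>\<phi> j\<bar> - \<bar>\<phi> l\<bar>\<bar>" for J
  proof -
    have fin: "finite J" using I(1) J finite_subset by blast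
    have "inj_on k J"
    proof (rule inj_onI, rule ccontr)
      fix j l assume jl: "j \<in> J" "l \<in> J" "k j = k l" "j \<noteq> l"
      have "\<bar>\<bar>\<phi> j\<bar> / \<gamma> - \<bar>\<phi> l\<bar> / \<gamma>\<bar> < 1" using k[of j] k[of l] jl(3) by linarith
      then have "\<bar>(\<bar>\<phi> j\<bar> - \<bar>\<phi> l\<bar>) / \<gamma>\<bar> < 1" by (simp add: diff_divide_distrib)
      then have lt: "\<bar>\<phi> j - \<phi> l\<bar> < \<gamma>" using sgn[OF jl(1,2)] \<gamma> by (simp add: abs_divide)
      have "z j - z l = z i * (cis (\<phi> j) - cis (\<phi> l))"
      proof -
        have "j \<in> I" "l \<in> I" using jl J by auto
        then show ?thesis using cis[of j] cis[of l] by (simp add: right_diff_distrib)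
      qed
      then have "cmod (z j - z l) \<le> \<bar>\<phi> j - \<phi> l\<bar>"
        using norm_cis_diff_le z[OF I(2)] by (simp add: norm_mult)
      moreover have "\<gamma> \<le> cmod (z j - z l)" using gap[of j l] jl J by blast
      ultimately show False using lt by simp
    qed
    then have "(\<Sum>j\<in>J. 1 / (real (k j))\<^sup>2) = (\<Sum>n\<in>k ` J. 1 / (real n)\<^sup>2)"
      by (simp add: sum.reindex)
    also have "\<dots> \<le> 2"
    proof (rule sum_inverse_squares_le)
      show "0 \<notin> k ` J"
      proof
        assume "0 \<in> k ` J"
        then obtain j where "j \<in> J" "k j = 0" by auto
        then show False using k1[of j] J by blast
      qed
    qed (use fin in simp)
    finally have two: "(\<Sum>j\<in>J. 1 / (real (k j))\<^sup>2) \<le> 2" .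
    have "(\<Sum>j\<in>J. 1 / (cmod (z i - z j))\<^sup>2) \<le> (\<Sum>j\<in>J. 9 / \<gamma>\<^sup>2 * (1 / (real (k j))\<^sup>2))"
      using J by (intro sum_mono summand) auto
    also have "\<dots> = 9 / \<gamma>\<^sup>2 * (\<Sum>j\<in>J. 1 / (real (k j))\<^sup>2)" by (simp only: sum_distrib_left)
    also have "\<dots> \<le> 9 / \<gamma>\<^sup>2 * 2" by (intro mult_left_mono two) simp
    finally show ?thesis by simp
  qed
  let ?A = "{j \<in> I - {i}. \<phi> j \<ge> 0}" and ?B = "{j \<in> I - {i}. \<phi> j < 0}"
  have un: "?A \<union> ?B = I - {i}" by auto
  have "(\<Sum>j\<in>?A \<union> ?B. 1 / (cmod (z i - z j))\<^sup>2)
      = (\<Sum>j\<in>?A. 1 / (cmod (z i - z j))\<^sup>2) + (\<Sum>j\<in>?B. 1 / (cmod (z i - z j))\<^sup>2)"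
    by (rule sum.union_disjoint) (use I(1) in auto)
  then have "(\<Sum>j\<in>I - {i}. 1 / (cmod (z i - z j))\<^sup>2)
      = (\<Sum>j\<in>?A. 1 / (cmod (z i - z j))\<^sup>2) + (\<Sum>j\<in>?B. 1 / (cmod (z i - z j))\<^sup>2)"
    unfolding un .
  also have "\<dots> \<le> 18 / \<gamma>\<^sup>2 + 18 / \<gamma>\<^sup>2" 
    by (rule add_mono; rule half) auto
  finally show ?thesis by simp
qed

lemma sum_swap_pairs:
  "(\<Sum>k\<in>A. \<Sum>l\<in>B. \<Sum>i\<in>I. \<Sum>j\<in>J. f k l i j) = (\<Sum>i\<in>I. \<Sum>j\<in>J. \<Sum>k\<in>A. \<Sum>l\<in>B. f k l i j)"
proof -
  have "(\<Sum>k\<in>A. \<Sum>l\<in>B. \<Sum>i\<in>I. \<Sum>j\<in>J. f k l i j) = (\<Sum>k\<in>A. \<Sum>i\<in>I. \<Sum>l\<in>B. \<Sum>j\<in>J. f k l i j)"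
    by (rule sum.cong[OF refl], rule sum.swap)
  also have "\<dots> = (\<Sum>i\<in>I. \<Sum>k\<in>A. \<Sum>l\<in>B. \<Sum>j\<in>J. f k l i j)" by (rule sum.swap)
  also have "\<dots> = (\<Sum>i\<in>I. \<Sum>k\<in>A. \<Sum>j\<in>J. \<Sum>l\<in>B. f k l i j)"
    by (rule sum.cong[OF refl], rule sum.cong[OF refl], rule sum.swap)
  also have "\<dots> = (\<Sum>i\<in>I. \<Sum>j\<in>J. \<Sum>k\<in>A. \<Sum>l\<in>B. f k l i j)"
    by (rule sum.cong[OF refl], rule sum.swap)
  finally show ?thesis .
qed

lemma Re_of_real_mult: "Re (complex_of_real r * w) = r * Re w"
  by simp

text \<open>
  Averaging over \<open>k + l\<close> instead of one index squares the Dirichlet kernel, which gives decay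
  \<open>1 / (N \<bar>z i - z j\<bar>)\<^sup>2\<close> for the cross terms. By the spacing bound above, the Schur test then controls their sum,
  however many exponentials there are and however far from orthogonal the \<open>v i\<close> may be.
\<close>

lemma fejer_average:
  fixes z :: "'i \<Rightarrow> complex" and v :: "'i \<Rightarrow> 'a::complex_inner" and N :: nat and \<gamma> :: real
  assumes I: "finite I" and z: "\<And>i. i \<in> I \<Longrightarrow> cmod (z i) = 1"
    and gap: "\<And>i j. i \<in> I \<Longrightarrow> j \<in> I \<Longrightarrow> i \<noteq> j \<Longrightarrow> \<gamma> \<le> cmod (z i - z j)" and \<gamma>: "\<gamma> > 0"
    and N: "N > 0"
  shows "\<bar>(\<Sum>k<N. \<Sum>l<N. (norm (\<Sum>i\<in>I. z i ^ (k + l) *\<^sub>C v i))\<^sup>2) / (real N)\<^sup>2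
      - (\<Sum>i\<in>I. (norm (v i))\<^sup>2)\<bar> \<le> 144 / (N * \<gamma>)\<^sup>2 * (\<Sum>i\<in>I. (norm (v i))\<^sup>2)"
proof -
  define \<zeta> where "\<zeta> i j = z i * cnj (z j)" for i j
  define \<kappa> where "\<kappa> i j = ((\<Sum>k<N. \<zeta> i j ^ k) / of_nat N)\<^sup>2" for i j
  define q where "q i j = (if i = j then 0 else 4 / ((real N)\<^sup>2 * (cmod (z i - z j))\<^sup>2))" for i j
  define a where "a i = (norm (v i))\<^sup>2" for i
  have sq: "(norm (\<Sum>i\<in>I. z i ^ n *\<^sub>C v i))\<^sup>2 = (\<Sum>i\<in>I. \<Sum>j\<in>I. Re (\<zeta> i j ^ n * cinner (v i) (v j)))" for n
    unfolding power2_norm_eq_inner inner_sum_left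
    unfolding inner_sum_right
    by (intro sum.cong refl)
       (simp add: inner_eq_Re_cinner cinner_scaleC_left cinner_scaleC_right \<zeta>_def power_mult_distrib
         mult_ac del: times_complex.sel)
  have avg: "(\<Sum>k<N. \<Sum>l<N. (norm (\<Sum>i\<in>I. z i ^ (k + l) *\<^sub>C v i))\<^sup>2) / (real N)\<^sup>2
      = (\<Sum>i\<in>I. \<Sum>j\<in>I. Re (\<kappa> i j * cinner (v i) (v j)))"
  proof -
    have "(\<Sum>k<N. \<Sum>l<N. (norm (\<Sum>i\<in>I. z i ^ (k + l) *\<^sub>C v i))\<^sup>2)
        = (\<Sum>i\<in>I. \<Sum>j\<in>I. \<Sum>k<N. \<Sum>l<N. Re (\<zeta> i j ^ (k + l) * cinner (v i) (v j)))"
      unfolding sq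
by (rule sum_swap_pairs)
    also have "\<dots> = (\<Sum>i\<in>I. \<Sum>j\<in>I. (real N)\<^sup>2 * Re (\<kappa> i j * cinner (v i) (v j)))"
    proof (intro sum.cong refl)
      fix i j
      have "(\<Sum>k<N. \<Sum>l<N. \<zeta> i j ^ (k + l)) = (\<Sum>k<N. \<zeta> i j ^ k)\<^sup>2"
        by (simp add: power_add power2_eq_square sum_product)
      also have "\<dots> = of_real ((real N)\<^sup>2) * \<kappa> i j" using N by (simp add: \<kappa>_def power_divide)
      finally have "(\<Sum>k<N. \<Sum>l<N. \<zeta> i j ^ (k + l)) * cinner (v i) (v j)
          = of_real ((real N)\<^sup>2) * (\<kappa> i j * cinner (v i) (v j))" by (simp add: mult.assoc)
      then have "Re (\<Sum>k<N. \<Sum>l<N. \<zeta> i j ^ (k + l) * cinner (v i) (v j))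
          = (real N)\<^sup>2 * Re (\<kappa> i j * cinner (v i) (v j))"
        by (simp only: sum_distrib_right Re_of_real_mult)
      then show "(\<Sum>k<N. \<Sum>l<N. Re (\<zeta> i j ^ (k + l) * cinner (v i) (v j)))
          = (real N)\<^sup>2 * Re (\<kappa> i j * cinner (v i) (v j))" by (simp only: Re_sum)
    qed
    finally show ?thesis using N by (simp add: sum_distrib_left[symmetric])
  qed
  have summand: "\<bar>Re (\<kappa> i j * cinner (v i) (v j)) - (if i = j then a i else 0)\<bar> \<le> q i j * ((a i + a j) / 2)"
    if ij: "i \<in> I" "j \<in> I" for i j
  proof (cases "i = j")
    case True
    have "\<zeta> i i = 1" using z[OF ij(1)] by (simp add: \<zeta>_def complex_norm_square[symmetric])
    then have "\<kappa> i i = 1" using N by (simp add: \<kappa>_def)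
    then show ?thesis using True by (simp add: a_def q_def power2_norm_eq_inner inner_eq_Re_cinner)
  next
    case False
    have d: "cmod (\<zeta> i j - 1) = cmod (z i - z j)"
    proof -
      have "z j * cnj (z j) = 1" using z[OF ij(2)] by (simp add: complex_norm_square[symmetric])
      then have "\<zeta> i j - 1 = (z i - z j) * cnj (z j)" by (simp add: \<zeta>_def left_diff_distrib)
      then show ?thesis using z[OF ij(2)] by (simp add: norm_mult)
    qed
    have pos: "cmod (z i - z j) > 0" using gap[OF ij False] \<gamma> by linarith
    then have ne: "\<zeta> i j \<noteq> 1" using d by auto
    have "cmod (\<zeta> i j ^ N - 1) \<le> cmod (\<zeta> i j ^ N) + 1" by (metis norm_one norm_triangle_ineq4)
    also have "\<dots> = 2" using z ij by (simp add: \<zeta>_def norm_power norm_mult)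
    finally have "cmod (\<Sum>k<N. \<zeta> i j ^ k) \<le> 2 / cmod (z i - z j)"
      using ne d pos by (simp add: geometric_sum norm_divide divide_right_mono)
    then have le: "(cmod (\<Sum>k<N. \<zeta> i j ^ k))\<^sup>2 \<le> (2 / cmod (z i - z j))\<^sup>2" by (intro power_mono) auto
    have "cmod (\<kappa> i j) = (cmod (\<Sum>k<N. \<zeta> i j ^ k))\<^sup>2 / (real N)\<^sup>2"
      by (simp add: \<kappa>_def norm_power norm_divide power_divide)
    also have "\<dots> \<le> (2 / cmod (z i - z j))\<^sup>2 / (real N)\<^sup>2"
      by (rule divide_right_mono[OF le]) simp
    also have "\<dots> = q i j" using False by (simp add: q_def power_divide mult.commute)
    finally have \<kappa>q: "cmod (\<kappa> i j) \<le> q i j" .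
    have "Re (\<kappa> i j * cinner (v i) (v j)) = inner (\<kappa> i j *\<^sub>C v i) (v j)"
      by (simp add: inner_eq_Re_cinner cinner_scaleC_left)
    then have "\<bar>Re (\<kappa> i j * cinner (v i) (v j))\<bar> \<le> norm (\<kappa> i j *\<^sub>C v i) * norm (v j)"
      using Cauchy_Schwarz_ineq2 by metis
    also have "\<dots> \<le> q i j * (norm (v i) * norm (v j))"
      using \<kappa>q by (simp add: norm_scaleC mult.assoc mult_right_mono)
    also have "\<dots> \<le> q i j * ((a i + a j) / 2)"
    proof (rule mult_left_mono)
      have "0 \<le> (norm (v i) - norm (v j))\<^sup>2" by simp
      then show "norm (v i) * norm (v j) \<le> (a i + a j) / 2" by (simp add: a_def power2_diff)
    qed (simp add: q_def)
    finally show ?thesis using False by simp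
  qed
  have q_sym: "q i j = q j i" for i j by (auto simp: q_def norm_minus_commute)
  have diag: "(\<Sum>i\<in>I. a i) = (\<Sum>i\<in>I. \<Sum>j\<in>I. if i = j then a i else 0)"
    using I by simp
  have "\<bar>(\<Sum>i\<in>I. \<Sum>j\<in>I. Re (\<kappa> i j * cinner (v i) (v j))) - (\<Sum>i\<in>I. a i)\<bar>
      = \<bar>\<Sum>i\<in>I. \<Sum>j\<in>I. (Re (\<kappa> i j * cinner (v i) (v j)) - (if i = j then a i else 0))\<bar>"
    unfolding diag by (simp only: sum_subtractf)
  also have "\<dots> \<le> (\<Sum>i\<in>I. \<Sum>j\<in>I. q i j * ((a i + a j) / 2))"
    by (rule order_trans[OF sum_abs sum_mono], rule order_trans[OF sum_abs sum_mono], rule summand)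
  also have "\<dots> = (\<Sum>i\<in>I. \<Sum>j\<in>I. q i j * a i / 2) + (\<Sum>i\<in>I. \<Sum>j\<in>I. q i j * a j / 2)"
    by (simp only: sum.distrib[symmetric], intro sum.cong refl, simp add: distrib_left add_divide_distrib)
  also have "(\<Sum>i\<in>I. \<Sum>j\<in>I. q i j * a j / 2) = (\<Sum>j\<in>I. \<Sum>i\<in>I. q i j * a j / 2)" by (rule sum.swap)
  also have "\<dots> = (\<Sum>i\<in>I. \<Sum>j\<in>I. q i j * a i / 2)"
    by (intro sum.cong refl, subst q_sym, rule refl)
  also have "(\<Sum>i\<in>I. \<Sum>j\<in>I. q i j * a i / 2) + (\<Sum>i\<in>I. \<Sum>j\<in>I. q i j * a i / 2)
      = (\<Sum>i\<in>I. (\<Sum>j\<in>I. q i j) * a i)"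
    by (simp add: sum.distrib[symmetric] sum_distrib_left mult.commute)
  also have "\<dots> \<le> (\<Sum>i\<in>I. 144 / (N * \<gamma>)\<^sup>2 * a i)"
  proof (intro sum_mono mult_right_mono)
    fix i assume i: "i \<in> I"
    have "(\<Sum>j\<in>I. q i j) = (\<Sum>j\<in>I - {i}. q i j)" using I i by (simp add: sum.remove q_def)
    also have "\<dots> = (\<Sum>j\<in>I - {i}. 4 / (real N)\<^sup>2 * (1 / (cmod (z i - z j))\<^sup>2))"
      by (intro sum.cong) (auto simp: q_def)
    also have "\<dots> = 4 / (real N)\<^sup>2 * (\<Sum>j\<in>I - {i}. 1 / (cmod (z i - z j))\<^sup>2)" by (rule sum_distrib_left[symmetric])
    also have "\<dots> \<le> 4 / (real N)\<^sup>2 * (36 / \<gamma>\<^sup>2)"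
      by (intro mult_left_mono sum_inverse_squared_distances[OF I i z gap \<gamma>]) auto
    finally show "(\<Sum>j\<in>I. q i j) \<le> 144 / (N * \<gamma>)\<^sup>2" by (simp add: power_mult_distrib)
  qed (simp add: a_def)
  finally show ?thesis unfolding avg a_def by (simp add: sum_distrib_left)
qed

section \<open>Vectors supported on a thin set\<close>

lemma unitary_power_near_scalar:
  assumes W: "unitary_op W" and z: "cmod z = 1"
  shows "norm ((W ^^ n) x - z ^ n *\<^sub>C x) \<le> n * norm (W x - z *\<^sub>C x)"
proof (induction n)
  case 0 then show ?case by (simp add: scaleC_one)
next
  case (Suc n)
  note Wl = linear_simps[OF bounded_clinearD(1)[OF unitary_opD(1)[OF W]]]
  have "(W ^^ Suc n) x - z ^ Suc n *\<^sub>C x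
      = W ((W ^^ n) x - z ^ n *\<^sub>C x) + z ^ n *\<^sub>C (W x - z *\<^sub>C x)"
    by (simp add: Wl bounded_clinearD(2)[OF unitary_opD(1)[OF W]] scaleC_diff_right scaleC_scaleC mult.commute)
  then have "norm ((W ^^ Suc n) x - z ^ Suc n *\<^sub>C x)
      \<le> norm ((W ^^ n) x - z ^ n *\<^sub>C x) + norm (W x - z *\<^sub>C x)"
    using norm_triangle_ineq[of "W ((W ^^ n) x - z ^ n *\<^sub>C x)" "z ^ n *\<^sub>C (W x - z *\<^sub>C x)"]
    by (simp add: unitary_opD(3)[OF W] norm_scaleC norm_power z)
  also have "\<dots> \<le> real (Suc n) * norm (W x - z *\<^sub>C x)" using Suc by (simp add: algebra_simps)
  finally show ?case .
qed

context unitary_with_spectral_measure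
begin

lemma P_commutes_inv:
  assumes B: "B \<in> sets circle_borel" shows "P B (inv U x) = inv U (P B x)"
proof -
  note u = unitary_opD[OF unitary]
  have "P B x = U (P B (inv U x))" using P_commutes_U[OF B, of "inv U x"] by (simp add: u(5))
  then show ?thesis by (simp add: u(6))
qed

lemma inv_near_eigenvector:
  assumes z: "cmod z = 1" shows "norm (inv U x - cnj z *\<^sub>C x) = norm (U x - z *\<^sub>C x)"
proof -
  note u = unitary_opD[OF unitary]
  note Ul = linear_simps[OF bounded_clinearD(1)[OF u(1)]]
  have "cnj z * z = 1" using z by (simp add: complex_norm_square[symmetric] mult.commute)
  then have "z *\<^sub>C U (inv U x - cnj z *\<^sub>C x) = z *\<^sub>C x - U x"
    by (simp add: Ul u(5) bounded_clinearD(2)[OF u(1)] scaleC_diff_right scaleC_scaleC scaleC_one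
        mult.commute)
  then have "norm (z *\<^sub>C U (inv U x - cnj z *\<^sub>C x)) = norm (U x - z *\<^sub>C x)"
    by (simp add: norm_minus_commute)
  then show ?thesis by (simp add: norm_scaleC z u(3))
qed

text \<open>
  The errors on the different clusters are orthogonal, since \<open>W\<close> commutes with the projections; so no
  factor counting the clusters is lost.
\<close>

lemma cluster_power_approximation:
  assumes W: "unitary_op W" and WP: "\<And>B x. B \<in> sets circle_borel \<Longrightarrow> P B (W x) = W (P B x)"
    and S: "finite S" and A: "\<And>s. s \<in> S \<Longrightarrow> A s \<in> sets circle_borel" "disjoint_family_on A S"
    and z: "\<And>s. s \<in> S \<Longrightarrow> cmod (z s) = 1"
    and near: "\<And>s. s \<in> S \<Longrightarrow> norm (W (P (A s) h) - z s *\<^sub>C P (A s) h) \<le> d * norm (P (A s) h)"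
    and d: "d \<ge> 0"
  shows "norm ((W ^^ n) (\<Sum>s\<in>S. P (A s) h) - (\<Sum>s\<in>S. z s ^ n *\<^sub>C P (A s) h)) \<le> n * d * norm h"
proof (rule power2_le_imp_le)
  have Wn: "bounded_clinear (W ^^ n)" by (rule bounded_clinear_funpow[OF unitary_opD(1)[OF W]])
  define y where "y s = (W ^^ n) (P (A s) h) - z s ^ n *\<^sub>C P (A s) h" for s
  have WPn: "P B ((W ^^ n) x) = (W ^^ n) (P B x)" if "B \<in> sets circle_borel" for B x
    by (induction n) (simp_all add: WP[OF that])
  have "(norm (\<Sum>s\<in>S. y s))\<^sup>2 = (\<Sum>s\<in>S. (norm (y s))\<^sup>2)"
  proof (rule norm_sum_P[OF S A])
    fix s assume "s \<in> S"
    then have As: "A s \<in> sets circle_borel" by (rule A(1))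
    show "P (A s) (y s) = y s"
      by (simp add: y_def linear_simps[OF P_linear[OF As]] bounded_clinearD(2)[OF P_clinear[OF As]]
          WPn[OF As] P_idem[OF As])
  qed
  also have "\<dots> \<le> (\<Sum>s\<in>S. (n * d)\<^sup>2 * (norm (P (A s) h))\<^sup>2)"
  proof (rule sum_mono)
    fix s assume s: "s \<in> S"
    have "norm (y s) \<le> n * norm (W (P (A s) h) - z s *\<^sub>C P (A s) h)"
      unfolding y_def by (rule unitary_power_near_scalar[OF W z[OF s]])
    also have "\<dots> \<le> n * (d * norm (P (A s) h))" by (intro mult_left_mono near[OF s]) simp
    finally have "(norm (y s))\<^sup>2 \<le> (n * d * norm (P (A s) h))\<^sup>2" by (intro power_mono) (simp_all add: mult.assoc)
    then show "(norm (y s))\<^sup>2 \<le> (n * d)\<^sup>2 * (norm (P (A s) h))\<^sup>2" by (simp add: power_mult_distrib)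
  qed
  also have "\<dots> = (n * d)\<^sup>2 * (\<Sum>s\<in>S. (norm (P (A s) h))\<^sup>2)" by (simp add: sum_distrib_left)
  also have "\<dots> \<le> (n * d)\<^sup>2 * (norm h)\<^sup>2" by (intro mult_left_mono sum_norm_P_le[OF S A]) auto
  finally have "(norm (\<Sum>s\<in>S. y s))\<^sup>2 \<le> (n * d * norm h)\<^sup>2" by (simp add: power_mult_distrib)
  then show "(norm ((W ^^ n) (\<Sum>s\<in>S. P (A s) h) - (\<Sum>s\<in>S. z s ^ n *\<^sub>C P (A s) h)))\<^sup>2 \<le> (n * d * norm h)\<^sup>2"
    by (simp add: y_def sum_subtractf bounded_linear_sum_arg[OF bounded_clinearD(1)[OF Wn]])
qed (use d in simp)

lemma funpow_inv_cancel: "(U ^^ n) ((inv U ^^ n) x) = x"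
proof (induction n arbitrary: x)
  case (Suc n)
  have "(U ^^ Suc n) ((inv U ^^ Suc n) x) = U ((U ^^ n) ((inv U ^^ n) (inv U x)))"
    by (simp add: funpow_swap1)
  then show ?case using Suc by (simp add: unitary_opD(5)[OF unitary])
qed simp

text \<open>
  Choose a scale \<open>\<delta>\<close> at which the crowded part of \<open>E\<close> has little mass for \<open>h\<close>, and cut the rest of \<open>h\<close> into its
  cluster components. With \<open>N\<close> large compared with \<open>1 / (W \<delta>)\<close> but small compared with \<open>1 / \<delta>\<close>,
  the powers \<open>U\<^sup>n\<close> with \<open>\<bar>n\<bar>\<close> of order \<open>N\<close> act as scalars on each cluster, while averages over
  \<open>N\<close> exponents make different clusters orthogonal. Consequently the averages of \<open>\<parallel>Y U\<^sup>n h\<parallel>\<^sup>2\<close> over forward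
  and over backward exponents are both close to the same number \<open>s\<close>, the sum of the squared
  norms of the images under \<open>Y\<close> of the cluster components. Comparing each term of the averages with a single one by the
  hypothesis \<open>mono\<close> gives the two inequalities.
\<close>

lemma thin_support_approximation:
  assumes Y: "bounded_clinear Y" and E: "closed E" "E \<subseteq> unit_circle" and alpha: "arc_alpha E < \<infinity>"
    and hE: "P E h = h" and atomless: "\<And>z. z \<in> unit_circle \<Longrightarrow> P {z} h = 0"
    and M: "M \<ge> 1" and mono: "\<And>n x. norm (Y ((U ^^ n) x)) \<le> M * norm (Y x)"
    and \<theta>: "\<theta> > 0"
  obtains s where "s \<ge> 0"
    "s * (1 - \<theta>) \<le> (M * norm (Y ((U ^^ j) h)) + \<theta>)\<^sup>2"
    "norm (Y ((inv U ^^ i) h)) / M - \<theta> \<le> sqrt (s * (1 + \<theta>))"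
proof -
  note u = unitary_opD[OF unitary]
  let ?V = "inv U"
  have V: "unitary_op ?V" by (rule unitary_op_inv[OF unitary])
  obtain L where L: "L > 0" "\<And>x. norm (Y x) \<le> norm x * L"
    using bounded_linear.pos_bounded[OF bounded_clinearD(1)[OF Y]] by blast
  note Yl = linear_simps[OF bounded_clinearD(1)[OF Y]]
  define H where "H = norm h + 1"
  have H: "H > 0" "norm h \<le> H" by (auto simp: H_def add_nonneg_pos)
  \<comment> \<open>With \<open>N W \<delta> \<ge> K\<close> the relative error \<open>144 / (N W \<delta>)\<^sup>2\<close> of the averages is at most \<open>\<theta>\<close>.\<close>
  define K where "K = 12 / sqrt \<theta>"
  have K: "K > 0" "K\<^sup>2 = 144 / \<theta>" using \<theta> by (auto simp: K_def power_divide)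
  \<comment> \<open>\<open>W > 4\<close> separates the clusters; \<open>W\<close> of order \<open>K / \<theta>\<close> makes \<open>N \<delta>\<close>, about \<open>K / W\<close>, small.\<close>
  define W where "W = max 5 (16 * L * H * K / \<theta>)"
  have W: "W \<ge> 5" "16 * L * H * K / \<theta> \<le> W" by (auto simp: W_def)
  then have WK: "4 * L * H * K / W \<le> \<theta> / 4" using \<theta> by (simp add: field_simps)
  define T where "T = real (2 + i + j)"
  have T: "T > 0" by (simp add: T_def)
  \<comment> \<open>The first bound controls the discarded mass, the second the shifts by \<open>i\<close>, \<open>j\<close> and the rounding of \<open>N\<close>.\<close>
  define \<eta> where "\<eta> = min ((\<theta> / (2 * L))\<^sup>2) (\<theta> / (8 * L * H * T))"
  have \<eta>: "\<eta> > 0" using \<theta> L H T by (simp add: \<eta>_def)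
  have Es: "E \<in> sets circle_borel" by (rule circle_setsI) (use E in auto)
  have single: "measure (vector_measure h) {z} = 0" if z: "z \<in> unit_circle" for z
  proof -
    have "{z} \<in> sets circle_borel" by (rule circle_setsI) (use z in auto)
    then show ?thesis by (simp add: measure_vector_measure atomless[OF z])
  qed
  have W1: "W \<ge> 1" using W by simp
  obtain \<delta> where \<delta>: "0 < \<delta>" "\<delta> < \<eta>" "measure (vector_measure h) (crowded_points E \<delta> W) \<le> \<eta>"
    by (rule small_crowded_set[OF E alpha W1 finite_vector_measure sets_vector_measure single \<eta>])
  let ?C = "crowded_points E \<delta> W"
  have Cs: "?C \<in> sets circle_borel" by (rule crowded_points_measurable[OF E])
  define G where "G = E - ?C"
  have Gs: "G \<in> sets circle_borel" unfolding G_def by (rule sets.Diff[OF Es Cs])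
  obtain S where S: "finite S" "S \<subseteq> E"
      "\<And>s t. s \<in> S \<Longrightarrow> t \<in> S \<Longrightarrow> s \<noteq> t \<Longrightarrow> W * \<delta> \<le> cmod (s - t)"
      "G \<subseteq> (\<Union>s\<in>S. cball s (2 * \<delta>))" "disjoint_family_on (\<lambda>s. cball s (2 * \<delta>)) S"
    unfolding G_def by (rule cluster_decomposition[OF E(2) \<delta>(1), of W]) (use W in auto)
  define A where "A s = G \<inter> cball s (2 * \<delta>)" for s
  have As: "A s \<in> sets circle_borel" for s
  proof -
    have "A s = G \<inter> (unit_circle \<inter> cball s (2 * \<delta>))" using circle_sets_space[OF Gs] by (auto simp: A_def)
    moreover have "unit_circle \<inter> cball s (2 * \<delta>) \<in> sets circle_borel" by (rule circle_setsI) auto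
    ultimately show ?thesis using Gs by (simp add: sets.Int)
  qed
  have dA: "disjoint_family_on A S" using S(5) by (auto simp: disjoint_family_on_def A_def)
  have UA: "(\<Union>s\<in>S. A s) = G" using S(4) by (auto simp: A_def)
  have Su: "cmod s = 1" if "s \<in> S" for s using that S(2) E(2) by auto
  define g where "g = (\<Sum>s\<in>S. P (A s) h)"
  have g: "g = P G h" using P_UN[OF S(1) As dA, of h] by (simp add: UA g_def)
  have hg: "norm (h - g) * L \<le> \<theta> / 2"
  proof -
    have "E = ?C \<union> G" "?C \<inter> G = {}" by (auto simp: G_def crowded_points_def)
    then have "P E h - P G h = P ?C h" using P_Un[OF Cs Gs, of h] by simp
    then have "h - g = P ?C h" by (simp only: hE g)
    then have "(norm (h - g))\<^sup>2 \<le> \<eta>" using \<delta>(3) by (simp add: measure_vector_measure[OF Cs])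
    also have "\<dots> \<le> (\<theta> / (2 * L))\<^sup>2" by (simp add: \<eta>_def)
    finally have "norm (h - g) \<le> \<theta> / (2 * L)" by (rule power2_le_imp_le) (use \<theta> L in simp)
    then show ?thesis using L by (simp add: field_simps)
  qed
  define N where "N = nat \<lceil>K / (W * \<delta>)\<rceil>"
  have W\<delta>: "W * \<delta> > 0" using W \<delta> by simp
  have N: "K / (W * \<delta>) \<le> N" "N \<le> K / (W * \<delta>) + 1" "N > 0"
    using K W\<delta> by (auto simp: N_def)
  \<comment> \<open>Over the whole time span, replacing \<open>U\<close> by scalars on the clusters costs at most \<open>\<theta> / 2\<close>.\<close>
  have time: "real n * (2 * \<delta>) * norm h * L \<le> \<theta> / 2" if n: "real n \<le> 2 * N + i + j" for n
  proof -
    have "real n \<le> 2 * (K / (W * \<delta>)) + T" using n N(2) by (simp add: T_def)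
    then have "real n * (2 * \<delta> * H * L) \<le> (2 * (K / (W * \<delta>)) + T) * (2 * \<delta> * H * L)"
      using \<delta> H L by (intro mult_right_mono) auto
    also have "\<dots> = 4 * L * H * K / W + 2 * L * H * T * \<delta>"
      using \<delta> W by (simp add: field_simps)
    also have "2 * L * H * T * \<delta> \<le> 2 * L * H * T * (\<theta> / (8 * L * H * T))"
      using \<delta>(2) L H T by (intro mult_left_mono) (auto simp: \<eta>_def)
    also have "\<dots> = \<theta> / 4" using L H T by simp
    finally have "real n * (2 * \<delta> * H * L) \<le> \<theta> / 2" using WK by simp
    moreover have "real n * (2 * \<delta>) * norm h * L \<le> real n * (2 * \<delta>) * H * L"
      using H \<delta> L by (intro mult_right_mono mult_left_mono) auto
    ultimately show ?thesis by (simp add: mult_ac)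
  qed
  have near: "norm (U (P (A s) h) - s *\<^sub>C P (A s) h) \<le> 2 * \<delta> * norm (P (A s) h)" if s: "s \<in> S" for s
    by (rule near_eigenvector[OF Su[OF s] As P_idem[OF As]])
       (use \<delta>(1) in \<open>auto simp: A_def dist_norm norm_minus_commute\<close>)
  define FU where "FU n = (\<Sum>s\<in>S. s ^ n *\<^sub>C Y (P (A s) h))" for n
  define FV where "FV n = (\<Sum>s\<in>S. cnj s ^ n *\<^sub>C Y (P (A s) h))" for n
  have Ysum: "Y (\<Sum>s\<in>S. z s *\<^sub>C P (A s) h) = (\<Sum>s\<in>S. z s *\<^sub>C Y (P (A s) h))" for z
    by (simp add: bounded_linear_sum_arg[OF bounded_clinearD(1)[OF Y]] bounded_clinearD(2)[OF Y])
  have approx: "norm (Y ((R ^^ n) h) - Y (\<Sum>s\<in>S. z s ^ n *\<^sub>C P (A s) h)) \<le> \<theta>"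
    if R: "unitary_op R" "\<And>B x. B \<in> sets circle_borel \<Longrightarrow> P B (R x) = R (P B x)"
      and z: "\<And>s. s \<in> S \<Longrightarrow> cmod (z s) = 1"
        "\<And>s. s \<in> S \<Longrightarrow> norm (R (P (A s) h) - z s *\<^sub>C P (A s) h) \<le> 2 * \<delta> * norm (P (A s) h)"
      and n: "real n \<le> 2 * N + i + j" for R z n
  proof -
    have Rn: "bounded_clinear (R ^^ n)" by (rule bounded_clinear_funpow[OF unitary_opD(1)[OF R(1)]])
    let ?s = "\<Sum>s\<in>S. z s ^ n *\<^sub>C P (A s) h"
    have e1: "norm (Y ((R ^^ n) (h - g))) \<le> \<theta> / 2"
      using L(2)[of "(R ^^ n) (h - g)"] hg unitary_funpow_norm[OF R(1)] by simp
    have e2: "norm (Y ((R ^^ n) g - ?s)) \<le> \<theta> / 2"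
    proof -
      have "norm ((R ^^ n) g - ?s) \<le> n * (2 * \<delta>) * norm h"
        unfolding g_def by (rule cluster_power_approximation[OF R S(1) As dA z]) (use \<delta>(1) in auto)
      then have "norm ((R ^^ n) g - ?s) * L \<le> n * (2 * \<delta>) * norm h * L"
        using L by (intro mult_right_mono) auto
      then show ?thesis using L(2)[of "(R ^^ n) g - ?s"] time[OF n] by linarith
    qed
    have "Y ((R ^^ n) h) - Y ?s = Y ((R ^^ n) (h - g)) + Y ((R ^^ n) g - ?s)"
      by (simp add: Yl linear_simps[OF bounded_clinearD(1)[OF Rn]])
    then show ?thesis
      using norm_triangle_ineq[of "Y ((R ^^ n) (h - g))" "Y ((R ^^ n) g - ?s)"] e1 e2
      by simp
  qed
  have approxU: "norm (Y ((U ^^ n) h) - FU n) \<le> \<theta>" if n: "real n \<le> 2 * N + i + j" for n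
    unfolding FU_def Ysum[symmetric]
    by (rule approx[OF unitary P_commutes_U Su near n])
  have approxV: "norm (Y ((?V ^^ n) h) - FV n) \<le> \<theta>" if n: "real n \<le> 2 * N + i + j" for n
    unfolding FV_def Ysum[symmetric]
    by (rule approx[OF V P_commutes_inv _ _ n]) (use Su near inv_near_eigenvector in auto)
  define s where "s = (\<Sum>t\<in>S. (norm (Y (P (A t) h)))\<^sup>2)"
  have ratio: "144 / (N * (W * \<delta>))\<^sup>2 \<le> \<theta>"
  proof -
    have "K \<le> N * (W * \<delta>)" using N(1) W\<delta> by (simp add: field_simps)
    then have "K\<^sup>2 \<le> (N * (W * \<delta>))\<^sup>2" using K by (intro power_mono) auto
    moreover have "0 < (N * (W * \<delta>))\<^sup>2 * K\<^sup>2" 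
      by (intro mult_pos_pos zero_less_power) (use K(1) N(3) W \<delta>(1) in auto)
    ultimately have "144 / (N * (W * \<delta>))\<^sup>2 \<le> 144 / K\<^sup>2"
      by (intro divide_left_mono) simp_all
    also have "\<dots> = \<theta>" using K \<theta> by simp
    finally show ?thesis .
  qed
  have avg: "\<bar>(\<Sum>k<N. \<Sum>l<N. (norm (\<Sum>t\<in>S. z t ^ (m + k + l) *\<^sub>C Y (P (A t) h)))\<^sup>2) / (real N)\<^sup>2 - s\<bar> \<le> \<theta> * s"
    if z: "\<And>t. t \<in> S \<Longrightarrow> cmod (z t) = 1" "\<And>s t. s \<in> S \<Longrightarrow> t \<in> S \<Longrightarrow> cmod (z s - z t) = cmod (s - t)"
    for z m
  proof -
    have v: "(norm (z t ^ m *\<^sub>C Y (P (A t) h)))\<^sup>2 = (norm (Y (P (A t) h)))\<^sup>2" if "t \<in> S" for t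
      using z(1)[OF that] by (simp add: norm_scaleC norm_power)
    have "\<bar>(\<Sum>k<N. \<Sum>l<N. (norm (\<Sum>t\<in>S. z t ^ (k + l) *\<^sub>C (z t ^ m *\<^sub>C Y (P (A t) h))))\<^sup>2) / (real N)\<^sup>2
        - (\<Sum>t\<in>S. (norm (z t ^ m *\<^sub>C Y (P (A t) h)))\<^sup>2)\<bar>
      \<le> 144 / (N * (W * \<delta>))\<^sup>2 * (\<Sum>t\<in>S. (norm (z t ^ m *\<^sub>C Y (P (A t) h)))\<^sup>2)"
      by (rule fejer_average[OF S(1) z(1) _ W\<delta> N(3)]) (use z(2) S(3) in auto)
    then have "\<bar>(\<Sum>k<N. \<Sum>l<N. (norm (\<Sum>t\<in>S. z t ^ (m + k + l) *\<^sub>C Y (P (A t) h)))\<^sup>2) / (real N)\<^sup>2 - s\<bar>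
        \<le> 144 / (N * (W * \<delta>))\<^sup>2 * s"
      by (simp add: v s_def scaleC_scaleC power_add mult_ac cong: sum.cong)
    also have "\<dots> \<le> \<theta> * s" by (intro mult_right_mono ratio) (simp add: s_def sum_nonneg)
    finally show ?thesis .
  qed
  have const: "(\<Sum>k<N. \<Sum>l<N. c) / (real N)\<^sup>2 = c" for c :: real
    using N(3) by (simp add: power2_eq_square)
  show thesis
  proof (rule that)
    show "s \<ge> 0" by (simp add: s_def sum_nonneg)
    have "s * (1 - \<theta>) \<le> (\<Sum>k<N. \<Sum>l<N. (norm (FU (j + k + l)))\<^sup>2) / (real N)\<^sup>2"
      using avg[of "\<lambda>t. t" j] Su unfolding FU_def by (simp add: algebra_simps abs_le_iff)
    also have "\<dots> \<le> (\<Sum>k<N. \<Sum>l<N. (M * norm (Y ((U ^^ j) h)) + \<theta>)\<^sup>2) / (real N)\<^sup>2"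
    proof (intro divide_right_mono sum_mono power_mono)
      fix k l assume kl: "k \<in> {..<N}" "l \<in> {..<N}"
      have "norm (Y ((U ^^ (j + k + l)) h)) \<le> M * norm (Y ((U ^^ j) h))"
        using mono[of "k + l" "(U ^^ j) h"] by (simp add: funpow_add[symmetric, THEN fun_cong, simplified] add_ac)
      moreover have "norm (Y ((U ^^ (j + k + l)) h) - FU (j + k + l)) \<le> \<theta>"
        by (rule approxU) (use kl in auto)
      ultimately show "norm (FU (j + k + l)) \<le> M * norm (Y ((U ^^ j) h)) + \<theta>"
        using norm_triangle_ineq2[of "FU (j + k + l)" "Y ((U ^^ (j + k + l)) h)"]
        by (simp add: norm_minus_commute)
    qed auto
    finally show "s * (1 - \<theta>) \<le> (M * norm (Y ((U ^^ j) h)) + \<theta>)\<^sup>2" by (simp only: const)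
    show "norm (Y ((?V ^^ i) h)) / M - \<theta> \<le> sqrt (s * (1 + \<theta>))"
    proof (cases "norm (Y ((?V ^^ i) h)) / M - \<theta> \<le> 0")
      case True
      moreover have "0 \<le> sqrt (s * (1 + \<theta>))" using \<open>s \<ge> 0\<close> \<theta> by simp
      ultimately show ?thesis by linarith
    next
      case False
      let ?c = "norm (Y ((?V ^^ i) h)) / M - \<theta>"
      have "?c\<^sup>2 = (\<Sum>k<N. \<Sum>l<N. ?c\<^sup>2) / (real N)\<^sup>2" by (rule const[symmetric])
      also have "\<dots> \<le> (\<Sum>k<N. \<Sum>l<N. (norm (FV (i + k + l)))\<^sup>2) / (real N)\<^sup>2"
      proof (intro divide_right_mono sum_mono power_mono)
        fix k l assume kl: "k \<in> {..<N}" "l \<in> {..<N}"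
        have "(U ^^ (k + l)) ((?V ^^ (i + k + l)) h) = (?V ^^ i) h"
        proof -
          have "(?V ^^ (i + k + l)) h = (?V ^^ (k + l)) ((?V ^^ i) h)"
            by (simp add: funpow_add[symmetric, THEN fun_cong, simplified] add_ac)
          then show ?thesis by (simp only: funpow_inv_cancel)
        qed
        then have "norm (Y ((?V ^^ i) h)) \<le> M * norm (Y ((?V ^^ (i + k + l)) h))"
          using mono[of "k + l" "(?V ^^ (i + k + l)) h"] by simp
        then have "norm (Y ((?V ^^ i) h)) / M \<le> norm (Y ((?V ^^ (i + k + l)) h))"
          using M by (simp add: field_simps)
        moreover have "norm (Y ((?V ^^ (i + k + l)) h) - FV (i + k + l)) \<le> \<theta>"
          by (rule approxV) (use kl in auto)
        ultimately show "?c \<le> norm (FV (i + k + l))"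
          using norm_triangle_ineq2[of "Y ((?V ^^ (i + k + l)) h)" "FV (i + k + l)"] by linarith
      qed (use False in auto)
      also have "\<dots> \<le> s * (1 + \<theta>)"
        using avg[of cnj i] Su unfolding FV_def
        by (simp add: algebra_simps abs_le_iff flip: complex_cnj_diff)
      finally show ?thesis by (rule real_le_rsqrt)
    qed
  qed
qed

lemma thin_support_two_sided_bound:
  assumes Y: "bounded_clinear Y" and E: "closed E" "E \<subseteq> unit_circle" and alpha: "arc_alpha E < \<infinity>"
    and hE: "P E h = h" and atomless: "\<And>z. z \<in> unit_circle \<Longrightarrow> P {z} h = 0"
    and M: "M \<ge> 1" and mono: "\<And>n x. norm (Y ((U ^^ n) x)) \<le> M * norm (Y x)"
  shows "norm (Y ((inv U ^^ i) h)) \<le> M\<^sup>2 * norm (Y ((U ^^ j) h))"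
proof -
  let ?a = "norm (Y ((inv U ^^ i) h))" and ?b = "norm (Y ((U ^^ j) h))"
  have "?a / M - \<theta> \<le> sqrt ((1 + \<theta>) / (1 - \<theta>)) * (M * ?b + \<theta>)" if \<theta>: "0 < \<theta>" "\<theta> < 1" for \<theta>
  proof -
    obtain s where s: "s \<ge> 0" "s * (1 - \<theta>) \<le> (M * ?b + \<theta>)\<^sup>2" "?a / M - \<theta> \<le> sqrt (s * (1 + \<theta>))"
      by (rule thin_support_approximation[OF Y E alpha hE atomless M mono \<theta>(1), of j i])
    have "s \<le> (M * ?b + \<theta>)\<^sup>2 / (1 - \<theta>)" using s(2) \<theta> by (simp add: field_simps)
    then have "s * (1 + \<theta>) \<le> (M * ?b + \<theta>)\<^sup>2 / (1 - \<theta>) * (1 + \<theta>)"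
      using \<theta> by (intro mult_right_mono) auto
    then have "sqrt (s * (1 + \<theta>)) \<le> sqrt ((1 + \<theta>) / (1 - \<theta>) * (M * ?b + \<theta>)\<^sup>2)"
      by (intro real_sqrt_le_mono) (simp add: mult.commute)
    also have "\<dots> = sqrt ((1 + \<theta>) / (1 - \<theta>)) * (M * ?b + \<theta>)"
    proof -
      have "0 \<le> M * ?b + \<theta>" using M \<theta> by (intro add_nonneg_nonneg mult_nonneg_nonneg) auto
      then show ?thesis by (simp only: real_sqrt_mult real_sqrt_abs abs_of_nonneg)
    qed
    finally show ?thesis using s(3) by linarith
  qed
  then have "eventually (\<lambda>\<theta>. ?a / M - \<theta> \<le> sqrt ((1 + \<theta>) / (1 - \<theta>)) * (M * ?b + \<theta>)) (at_right 0)"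
    by (auto simp: eventually_at_right_field intro!: exI[of _ 1])
  moreover have "((\<lambda>\<theta>. ?a / M - \<theta>) \<longlongrightarrow> ?a / M - 0) (at_right 0)"
    by (intro tendsto_intros)
  moreover have "((\<lambda>\<theta>. sqrt ((1 + \<theta>) / (1 - \<theta>)) * (M * ?b + \<theta>))
      \<longlongrightarrow> sqrt ((1 + 0) / (1 - 0)) * (M * ?b + 0)) (at_right (0::real))"
    by (intro tendsto_intros) auto
  ultimately have "?a / M - 0 \<le> sqrt ((1 + 0) / (1 - 0)) * (M * ?b + 0)"
    by (intro tendsto_le[OF trivial_limit_at_right_real])
  then show ?thesis using M by (simp add: field_simps power2_eq_square)
qed

end

section \<open>Comparison of the forward and backward limits\<close>

lemma eq_on_dense_range:
  fixes f g :: "'a::real_normed_vector \<Rightarrow> 'b::real_normed_vector"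
  assumes "bounded_linear f" "bounded_linear g" "closure (range A) = UNIV" "\<And>h. f (A h) = g (A h)"
  shows "f x = g x"
proof -
  have "closed {x. f x = g x}"
    by (intro closed_Collect_eq linear_continuous_on assms)
  moreover have "range A \<subseteq> {x. f x = g x}" using assms(4) by auto
  ultimately have "closure (range A) \<subseteq> {x. f x = g x}" by (rule closure_minimal[rotated])
  then show ?thesis using assms(3) by auto
qed

lemma norm_bound_on_dense_range:
  fixes f :: "'a::real_normed_vector \<Rightarrow> 'b::real_normed_vector"
  assumes "bounded_linear f" "closure (range A) = UNIV" "\<And>h. norm (f (A h)) \<le> c * norm (A h)"
  shows "norm (f x) \<le> c * norm x"
proof -
  have "closed {x. norm (f x) \<le> c * norm x}"
    by (intro closed_Collect_le continuous_intros linear_continuous_on assms)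
  moreover have "range A \<subseteq> {x. norm (f x) \<le> c * norm x}" using assms(3) by auto
  ultimately have "closure (range A) \<subseteq> {x. norm (f x) \<le> c * norm x}" by (rule closure_minimal[rotated])
  then show ?thesis using assms(2) by auto
qed

lemma bounded_clinear_compose:
  assumes "bounded_clinear A" "bounded_clinear B" shows "bounded_clinear (\<lambda>x. A (B x))"
  using assms bounded_linear_compose[of A B] by (auto simp: bounded_clinear_def)

context unitary_with_spectral_measure
begin

lemma eigenvector_two_sided_bound:
  assumes Y: "bounded_clinear Y" and z: "cmod z = 1" and h: "U h = z *\<^sub>C h"
  shows "norm (Y ((inv U ^^ i) h)) = norm (Y ((U ^^ j) h))"
proof -
  have "norm ((U ^^ j) h - z ^ j *\<^sub>C h) \<le> 0"
    using unitary_power_near_scalar[OF unitary z, of j h] h by simp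
  moreover have "norm ((inv U ^^ i) h - cnj z ^ i *\<^sub>C h) \<le> 0"
    using unitary_power_near_scalar[OF unitary_op_inv[OF unitary], of "cnj z" i h]
      inv_near_eigenvector[OF z, of h] z h by simp
  ultimately show ?thesis
    by (simp add: bounded_clinearD(2)[OF Y] norm_scaleC norm_power z)
qed

text \<open>
  An operator commuting with \<open>P\<close> has no cross terms between components supported on disjoint sets.
\<close>

lemma quadratic_form_splits:
  assumes D: "bounded_linear D" and DP: "\<And>B x. B \<in> sets circle_borel \<Longrightarrow> P B (D x) = D (P B x)"
    and I: "finite I" and B: "\<And>i. i \<in> I \<Longrightarrow> B i \<in> sets circle_borel" "disjoint_family_on B I"
  shows "inner (D (\<Sum>i\<in>I. P (B i) h)) (\<Sum>i\<in>I. P (B i) h)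
    = (\<Sum>i\<in>I. inner (D (P (B i) h)) (P (B i) h))"
proof -
  have off: "inner (D (P (B i) h)) (P (B j) h) = 0" if ij: "i \<in> I" "j \<in> I" "i \<noteq> j" for i j
  proof -
    have "inner (D (P (B i) h)) (P (B j) h) = inner (D h) (P (B i) (P (B j) h))"
      using B(1) ij by (simp add: DP[symmetric] P_selfadjoint)
    also have "P (B i) (P (B j) h) = 0"
      using P_disjoint[of "B j" "B i" h] B ij by (force simp: disjoint_family_on_def)
    finally show ?thesis by simp
  qed
  have "inner (D (\<Sum>i\<in>I. P (B i) h)) (\<Sum>i\<in>I. P (B i) h)
      = (\<Sum>i\<in>I. \<Sum>j\<in>I. inner (D (P (B i) h)) (P (B j) h))"
    unfolding bounded_linear_sum_arg[OF D] inner_sum_left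
    unfolding inner_sum_right ..
  also have "\<dots> = (\<Sum>i\<in>I. \<Sum>j\<in>I. if j = i then inner (D (P (B i) h)) (P (B i) h) else 0)"
    by (intro sum.cong refl) (auto simp: off)
  also have "\<dots> = (\<Sum>i\<in>I. inner (D (P (B i) h)) (P (B i) h))" using I by simp
  finally show ?thesis .
qed

text \<open>
  The atoms of \<open>h\<close> are at most countably many. Splitting them off as eigenvectors leaves atomless
  pieces, each supported on a single \<open>F k\<close>; different \<open>F k\<close> may be thin at completely different
  scales, so each piece has to stay within one of them.
\<close>

lemma thin_spectrum_decomposition:
  fixes F :: "'i \<Rightarrow> complex set"
  assumes I: "countable I" and F: "\<And>k. k \<in> I \<Longrightarrow> closed (F k)" "\<And>k. k \<in> I \<Longrightarrow> F k \<subseteq> unit_circle"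
    and null: "\<And>x. P (unit_circle - (\<Union>k\<in>I. F k)) x = 0"
  obtains B :: "nat \<Rightarrow> complex set" where
    "range B \<subseteq> sets circle_borel" "disjoint_family B" "P (\<Union>n. B n) h = h"
    "\<And>n. (\<exists>z. cmod z = 1 \<and> U (P (B n) h) = z *\<^sub>C P (B n) h) \<or>
      (\<exists>k\<in>I. P (F k) (P (B n) h) = P (B n) h \<and> (\<forall>z\<in>unit_circle. P {z} (P (B n) h) = 0))"
proof -
  have sing: "{z} \<in> sets circle_borel" if "z \<in> unit_circle" for z
    by (rule circle_setsI) (use that in auto)
  have Fs: "F k \<in> sets circle_borel" if "k \<in> I" for k
    by (rule circle_setsI) (use F that in auto)
  define A where "A = {z \<in> unit_circle. P {z} h \<noteq> 0}"
  have "A \<subseteq> {z. measure (vector_measure h) {z} \<noteq> 0}" by (auto simp: A_def measure_vector_measure sing)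
  then have A: "countable A"
    using finite_measure.countable_support[OF finite_vector_measure] countable_subset by blast
  have As: "A \<in> sets circle_borel"
  proof -
    have "(\<Union>z\<in>A. {z}) \<in> sets circle_borel"
      by (rule sets.countable_UN'[OF A]) (auto simp: A_def sing)
    then show ?thesis by simp
  qed
  \<comment> \<open>The empty set only ensures that the family can be enumerated.\<close>
  define \<C> where "\<C> = insert {} ((\<lambda>k. F k - A) ` I \<union> (\<lambda>z. {z}) ` A)"
  have \<C>: "countable \<C>" "\<C> \<noteq> {}" using I A by (auto simp: \<C>_def)
  have \<C>s: "C \<in> sets circle_borel" if "C \<in> \<C>" for C
    using that As by (auto simp: \<C>_def A_def intro: sing Fs sets.Diff)
  define C where "C = from_nat_into \<C>"
  have rC: "range C = \<C>" unfolding C_def by (rule range_from_nat_into[OF \<C>(2,1)])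
  then have C: "C n \<in> \<C>" for n by auto
  define B where "B = disjointed C"
  have BC: "B n \<subseteq> C n" for n unfolding B_def by (rule disjointed_subset)
  have Br: "range B \<subseteq> sets circle_borel"
    unfolding B_def by (rule sets.range_disjointed_sets) (use rC \<C>s in auto)
  then have Bs: "B n \<in> sets circle_borel" for n by auto
  have UB: "(\<Union>n. B n) = \<Union> \<C>" by (simp add: B_def UN_disjointed_eq rC)
  show thesis
  proof (rule that[OF Br])
    show "disjoint_family B" unfolding B_def by (rule disjoint_family_disjointed)
    show "P (\<Union>n. B n) h = h"
    proof -
      have UBs: "(\<Union>n. B n) \<in> sets circle_borel" using Br by auto
      have FUs: "(\<Union>k\<in>I. F k) \<in> sets circle_borel" by (rule sets.countable_UN'[OF I]) (use Fs in auto)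
      let ?c = "unit_circle - (\<Union>n. B n)" and ?d = "unit_circle - (\<Union>k\<in>I. F k)"
      have cd: "?c \<in> sets circle_borel" "?d \<in> sets circle_borel"
        using UBs FUs circle_sets_top by (auto intro: sets.Diff)
      have "(\<Union>k\<in>I. F k) \<subseteq> \<Union> \<C>" by (auto simp: \<C>_def)
      then have "?c \<inter> ?d = ?c" unfolding UB by auto
      then have "P ?c h = P ?c (P ?d h)" using P_Int[OF cd, of h] by simp
      also have "\<dots> = 0" by (simp add: null linear_simps[OF P_linear[OF cd(1)]])
      finally show ?thesis using P_Compl[OF UBs, of h] by simp
    qed
    fix n
    consider "C n = {}" | z where "z \<in> A" "C n = {z}" | k where "k \<in> I" "C n = F k - A"
      using C[of n] by (auto simp: \<C>_def)
    then show "(\<exists>z. cmod z = 1 \<and> U (P (B n) h) = z *\<^sub>C P (B n) h) \<or>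
      (\<exists>k\<in>I. P (F k) (P (B n) h) = P (B n) h \<and> (\<forall>z\<in>unit_circle. P {z} (P (B n) h) = 0))"
    proof cases
      case 1
      then have "P (B n) h = 0" using BC[of n] P_empty by simp
      then have "U (P (B n) h) = 1 *\<^sub>C P (B n) h"
        by (simp add: scaleC_one linear_simps(3)[OF bounded_clinearD(1)[OF unitary_opD(1)[OF unitary]]])
      then show ?thesis by (intro disjI1 exI[of _ 1]) simp
    next
      case 2
      then have z: "cmod z = 1" by (simp add: A_def)
      have "norm (U (P (B n) h) - z *\<^sub>C P (B n) h) \<le> 0 * norm (P (B n) h)"
        by (rule near_eigenvector[OF z Bs P_idem[OF Bs]]) (use BC[of n] 2 in auto)
      then have "U (P (B n) h) = z *\<^sub>C P (B n) h" by simp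
      then show ?thesis using z by blast
    next
      case 3
      have "F k \<inter> B n = B n" using BC[of n] 3 by auto
      then have 1: "P (F k) (P (B n) h) = P (B n) h" using P_Int[OF Fs[OF 3(1)] Bs[of n], of h] by simp
      have 2: "P {z} (P (B n) h) = 0" if z: "z \<in> unit_circle" for z
      proof (cases "z \<in> A")
        case True
        then have "{z} \<inter> B n = {}" using BC[of n] 3 by auto
        then show ?thesis using P_Int[OF sing[OF z] Bs[of n], of h] P_empty by simp
      next
        case False
        then have "P {z} h = 0" using z by (simp add: A_def)
        moreover have "P {z} (P (B n) h) = P (B n) (P {z} h)"
          using P_Int[OF sing[OF z] Bs[of n], of h] P_Int[OF Bs[of n] sing[OF z], of h]
          by (simp only: Int_commute)
        ultimately show ?thesis by (simp add: linear_simps[OF P_linear[OF Bs]])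
      qed
      then show ?thesis using 1 3(1) by blast
    qed
  qed
qed

text \<open>
  Let \<open>D\<close> and \<open>D'\<close> be the limit operators for forward and backward iteration. By \<open>mono\<close>, the first form is at
  most \<open>M\<^sup>2 \<parallel>Y h\<parallel>\<^sup>2\<close> and the second at least \<open>\<parallel>Y h\<parallel>\<^sup>2 / M\<^sup>2\<close>, so the claim follows from \<open>D' \<le> M\<^sup>4 D\<close>. On
  eigenvectors and on vectors supported on one thin set this holds by the two-sided bounds above,
  and it passes to general vectors because both forms are diagonal for spectral decompositions.
\<close>

lemma comparable_invariant_form:
  fixes F :: "'i \<Rightarrow> complex set" and Y :: "'b \<Rightarrow> 'a::complex_inner"
  assumes I: "countable I" and F: "\<And>k. k \<in> I \<Longrightarrow> closed (F k)" "\<And>k. k \<in> I \<Longrightarrow> F k \<subseteq> unit_circle"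
    and alpha: "\<And>k. k \<in> I \<Longrightarrow> arc_alpha (F k) < \<infinity>"
    and null: "\<And>x. P (unit_circle - (\<Union>k\<in>I. F k)) x = 0"
    and Y: "bounded_clinear Y" and M: "M \<ge> 1"
    and mono: "\<And>n x. norm (Y ((U ^^ n) x)) \<le> M * norm (Y x)"
  obtains D where "bounded_clinear D" "\<And>x y. inner (D x) y = inner x (D y)" "\<And>x. D (U x) = U (D x)"
    "\<And>h. inner (D h) h \<le> M\<^sup>2 * (norm (Y h))\<^sup>2" "\<And>h. (norm (Y h))\<^sup>2 \<le> M ^ 6 * inner (D h) h"
proof -
  note u = unitary_opD[OF unitary]
  let ?V = "inv U"
  have V: "unitary_op ?V" by (rule unitary_op_inv[OF unitary])
  obtain D where D: "bounded_clinear D" "\<And>x y. inner (D x) y = inner x (D y)" "\<And>x. D (U x) = U (D x)"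
      "\<And>x c. (\<And>n. c \<le> (norm (Y ((U ^^ n) x)))\<^sup>2) \<Longrightarrow> c \<le> inner (D x) x"
      "\<And>x c. (\<And>n. (norm (Y ((U ^^ n) x)))\<^sup>2 \<le> c) \<Longrightarrow> inner (D x) x \<le> c"
    by (rule invariant_limit_operator[OF unitary Y]) blast
  obtain D' where D': "bounded_clinear D'" "\<And>x y. inner (D' x) y = inner x (D' y)"
      "\<And>x. D' (?V x) = ?V (D' x)"
      "\<And>x c. (\<And>n. c \<le> (norm (Y ((?V ^^ n) x)))\<^sup>2) \<Longrightarrow> c \<le> inner (D' x) x"
      "\<And>x c. (\<And>n. (norm (Y ((?V ^^ n) x)))\<^sup>2 \<le> c) \<Longrightarrow> inner (D' x) x \<le> c"
    by (rule invariant_limit_operator[OF V Y]) blast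
  have D'U: "D' (U x) = U (D' x)" for x
    using D'(3)[of "U x"] by (metis u(5) u(6))
  have DP: "P B (D x) = D (P B x)" if "B \<in> sets circle_borel" for B x
    by (rule commutant_commutes_P[OF D(1-3) that])
  have D'P: "P B (D' x) = D' (P B x)" if "B \<in> sets circle_borel" for B x
    by (rule commutant_commutes_P[OF D'(1,2) D'U that])
  have piece: "inner (D' g) g \<le> M ^ 4 * inner (D g) g"
    if g: "\<And>i j. norm (Y ((?V ^^ i) g)) \<le> M\<^sup>2 * norm (Y ((U ^^ j) g))" for g
  proof (rule D'(5))
    fix i
    have "(norm (Y ((?V ^^ i) g)))\<^sup>2 / M ^ 4 \<le> inner (D g) g"
    proof (rule D(4))
      fix j
      have "(norm (Y ((?V ^^ i) g)))\<^sup>2 \<le> (M\<^sup>2 * norm (Y ((U ^^ j) g)))\<^sup>2" by (intro power_mono g) simp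
      then show "(norm (Y ((?V ^^ i) g)))\<^sup>2 / M ^ 4 \<le> (norm (Y ((U ^^ j) g)))\<^sup>2"
        using M by (simp add: power_mult_distrib pos_divide_le_eq mult.commute)
    qed
    then show "(norm (Y ((?V ^^ i) g)))\<^sup>2 \<le> M ^ 4 * inner (D g) g"
      using M by (simp add: pos_divide_le_eq mult.commute)
  qed
  have compare: "inner (D' h) h \<le> M ^ 4 * inner (D h) h" for h
  proof -
    obtain B :: "nat \<Rightarrow> complex set" where B: "range B \<subseteq> sets circle_borel" "disjoint_family B" "P (\<Union>n. B n) h = h"
      "\<And>n. (\<exists>z. cmod z = 1 \<and> U (P (B n) h) = z *\<^sub>C P (B n) h) \<or>
        (\<exists>k\<in>I. P (F k) (P (B n) h) = P (B n) h \<and> (\<forall>z\<in>unit_circle. P {z} (P (B n) h) = 0))"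
      by (rule thin_spectrum_decomposition[OF I F null, of h]) auto
    have Bs: "B n \<in> sets circle_borel" for n using B(1) by auto
    have dB: "disjoint_family_on B {..<N}" for N
      using B(2) by (auto simp: disjoint_family_on_def)
    define s where "s N = (\<Sum>n<N. P (B n) h)" for N
    have "(\<lambda>n. P (B n) h) sums h" using P_sums[OF B(1,2), of h] B(3) by simp
    then have s: "s \<longlonglongrightarrow> h" by (simp add: sums_def s_def[abs_def])
    have summand: "inner (D' (P (B n) h)) (P (B n) h) \<le> M ^ 4 * inner (D (P (B n) h)) (P (B n) h)" for n
    proof (rule piece)
      fix i j
      let ?g = "P (B n) h"
      from B(4)[of n] show "norm (Y ((?V ^^ i) ?g)) \<le> M\<^sup>2 * norm (Y ((U ^^ j) ?g))"
      proof (elim disjE exE bexE conjE)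
        fix z assume "cmod z = 1" "U ?g = z *\<^sub>C ?g"
        then have "norm (Y ((?V ^^ i) ?g)) = norm (Y ((U ^^ j) ?g))"
          by (rule eigenvector_two_sided_bound[OF Y])
        then show ?thesis using M mult_right_mono[of 1 "M\<^sup>2" "norm (Y ((U ^^ j) ?g))"]
          by (simp add: one_le_power)
      next
        fix k assume "k \<in> I" "P (F k) ?g = ?g" "\<forall>z\<in>unit_circle. P {z} ?g = 0"
        then show ?thesis
          by (intro thin_support_two_sided_bound[OF Y F alpha _ _ M mono]) auto
      qed
    qed
    have le: "inner (D' (s N)) (s N) \<le> M ^ 4 * inner (D (s N)) (s N)" for N
    proof -
      have "inner (D' (s N)) (s N) = (\<Sum>n<N. inner (D' (P (B n) h)) (P (B n) h))"
        unfolding s_def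
        by (rule quadratic_form_splits[OF bounded_clinearD(1)[OF D'(1)] D'P]) (use Bs dB in auto)
      also have "\<dots> \<le> (\<Sum>n<N. M ^ 4 * inner (D (P (B n) h)) (P (B n) h))"
        by (rule sum_mono) (rule summand)
      also have "\<dots> = M ^ 4 * (\<Sum>n<N. inner (D (P (B n) h)) (P (B n) h))"
        by (rule sum_distrib_left[symmetric])
      also have "(\<Sum>n<N. inner (D (P (B n) h)) (P (B n) h)) = inner (D (s N)) (s N)"
        unfolding s_def
        by (rule quadratic_form_splits[OF bounded_clinearD(1)[OF D(1)] DP, symmetric]) (use Bs dB in auto)
      finally show ?thesis .
    qed
    show ?thesis
    proof (rule LIMSEQ_le)
      show "(\<lambda>N. inner (D' (s N)) (s N)) \<longlonglongrightarrow> inner (D' h) h"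
        by (intro tendsto_inner bounded_linear.tendsto[OF bounded_clinearD(1)[OF D'(1)]] s)
      show "(\<lambda>N. M ^ 4 * inner (D (s N)) (s N)) \<longlonglongrightarrow> M ^ 4 * inner (D h) h"
        by (intro tendsto_mult tendsto_const tendsto_inner
            bounded_linear.tendsto[OF bounded_clinearD(1)[OF D(1)]] s)
    qed (use le in blast)
  qed
  show thesis
  proof (rule that[OF D(1-3)])
    fix h
    show "inner (D h) h \<le> M\<^sup>2 * (norm (Y h))\<^sup>2"
    proof (rule D(5))
      fix n
      have "(norm (Y ((U ^^ n) h)))\<^sup>2 \<le> (M * norm (Y h))\<^sup>2" by (intro power_mono mono) simp
      then show "(norm (Y ((U ^^ n) h)))\<^sup>2 \<le> M\<^sup>2 * (norm (Y h))\<^sup>2" by (simp add: power_mult_distrib)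
    qed
    have "(norm (Y h))\<^sup>2 / M\<^sup>2 \<le> inner (D' h) h"
    proof (rule D'(4))
      fix n
      have "norm (Y h) \<le> M * norm (Y ((?V ^^ n) h))"
        using mono[of n "(?V ^^ n) h"] by (simp add: funpow_inv_cancel)
      then have "(norm (Y h))\<^sup>2 \<le> (M * norm (Y ((?V ^^ n) h)))\<^sup>2" by (intro power_mono) auto
      then show "(norm (Y h))\<^sup>2 / M\<^sup>2 \<le> (norm (Y ((?V ^^ n) h)))\<^sup>2"
        using M by (simp add: power_mult_distrib pos_divide_le_eq mult.commute)
    qed
    also have "\<dots> \<le> M ^ 4 * inner (D h) h" by (rule compare)
    finally have "(norm (Y h))\<^sup>2 \<le> M ^ 4 * inner (D h) h * M\<^sup>2" using M by (simp add: pos_divide_le_eq)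
    also have "\<dots> = M ^ 6 * inner (D h) h" 
    proof -
      have "M ^ 4 * M\<^sup>2 = M ^ 6" by (simp flip: power_add)
      then show ?thesis by (metis mult.assoc mult.commute)
    qed
    finally show "(norm (Y h))\<^sup>2 \<le> M ^ 6 * inner (D h) h" .
  qed
qed

end

section \<open>Similarity to the unitary operator\<close>

lemma boundedly_invertibleI:
  assumes "bounded_clinear f" "bounded_clinear g" and gf: "\<And>x. g (f x) = x" and fg: "\<And>y. f (g y) = y"
  shows "boundedly_invertible f"
proof -
  have "bij f" by (rule o_bij[of g]) (auto simp: gf fg)
  moreover have "inv f = g" by (rule inv_equality) (rule gf, rule fg)
  ultimately show ?thesis using assms(1,2) by (simp add: boundedly_invertible_def)
qed

text \<open>
  If \<open>Z\<close> is the square root of \<open>D\<close>, then \<open>\<parallel>Z h\<parallel>\<close> is comparable with \<open>\<parallel>Y h\<parallel>\<close>, so \<open>Y h \<mapsto> Z h\<close> extends to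
  an invertible operator \<open>X\<close>. Since \<open>Z\<close> commutes with \<open>U\<close>, this \<open>X\<close> intertwines \<open>T\<close> with \<open>U\<close> itself,
  and not merely with some unitary operator.
\<close>

lemma similar_to_unitary:
  fixes U :: "'b::{complex_inner, complete_space} \<Rightarrow> 'b" and T :: "'a::{complex_inner, complete_space} \<Rightarrow> 'a"
  assumes U: "unitary_op U" and T: "bounded_clinear T" and Y: "bounded_clinear Y"
    and inj: "\<And>h. Y h = 0 \<Longrightarrow> h = 0" and dense: "closure (range Y) = UNIV"
    and YU: "\<And>h. Y (U h) = T (Y h)"
    and D: "bounded_clinear D" "\<And>x y. inner (D x) y = inner x (D y)" "\<And>x. D (U x) = U (D x)"
    and le: "\<And>h. inner (D h) h \<le> a\<^sup>2 * (norm (Y h))\<^sup>2" "\<And>h. (norm (Y h))\<^sup>2 \<le> b\<^sup>2 * inner (D h) h"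
    and ab: "a \<ge> 0" "b > 0"
  shows "T \<approx>\<^sub>o U" and "boundedly_invertible T"
proof -
  note u = unitary_opD[OF U]
  have pos: "inner (D h) h \<ge> 0" for h
  proof -
    have "0 \<le> b\<^sup>2 * inner (D h) h" by (rule order_trans[OF _ le(2)]) simp
    then show ?thesis using ab(2) by (simp add: zero_le_mult_iff)
  qed
  obtain Z where Z: "bounded_linear Z" "\<And>x y. inner (Z x) y = inner x (Z y)" "\<And>x. Z (Z x) = D x"
      "\<And>C x. bounded_linear C \<Longrightarrow> (\<And>x. C (D x) = D (C x)) \<Longrightarrow> C (Z x) = Z (C x)"
    by (rule positive_operator_sqrt[OF bounded_clinearD(1)[OF D(1)] D(2) pos]) blast
  have "c *\<^sub>C Z x = Z (c *\<^sub>C x)" for c x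
    by (rule Z(4)[OF bounded_linear_scaleC]) (simp add: bounded_clinearD(2)[OF D(1)])
  then have Zc: "bounded_clinear Z" using Z(1) by (simp add: bounded_clinear_def)
  have ZU: "U (Z x) = Z (U x)" for x
    by (rule Z(4)[OF bounded_clinearD(1)[OF u(1)]]) (simp add: D(3))
  have nZ: "(norm (Z h))\<^sup>2 = inner (D h) h" for h
    using Z(2)[of "Z h" h] by (simp add: power2_norm_eq_inner Z(3))
  have ZY: "norm (Z h) \<le> a * norm (Y h)" for h
    by (rule power2_le_imp_le) (use le(1)[of h] ab in \<open>simp_all add: nZ power_mult_distrib\<close>)
  have YZ: "norm (Y h) \<le> b * norm (Z h)" for h
    by (rule power2_le_imp_le) (use le(2)[of h] ab in \<open>simp_all add: nZ power_mult_distrib\<close>)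
  have Zinj: "h = 0" if "Z h = 0" for h
    using YZ[of h] that inj by simp
  have Zdense: "closure (range Z) = UNIV" by (rule injective_selfadjoint_dense_range[OF Z(1,2) Zinj])
  obtain X where X: "bounded_clinear X" "\<And>h. X (Y h) = Z h"
    by (rule bounded_extension_from_dense_range[OF Y Zc dense ZY]) (erule that, blast)
  obtain X' where X': "bounded_clinear X'" "\<And>h. X' (Z h) = Y h"
    by (rule bounded_extension_from_dense_range[OF Zc Y Zdense YZ]) (erule that, blast)
  note lin = bounded_clinearD(1)[OF bounded_clinear_compose]
  have X'X: "X' (X x) = x" for x
    by (rule eq_on_dense_range[OF lin[OF X'(1) X(1)] bounded_linear_ident dense]) (simp add: X X')
  have XX': "X (X' x) = x" for x
    by (rule eq_on_dense_range[OF lin[OF X(1) X'(1)] bounded_linear_ident Zdense]) (simp add: X X')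
  have XT: "X (T x) = U (X x)" for x
    by (rule eq_on_dense_range[OF lin[OF X(1) T] lin[OF u(1) X(1)] dense])
       (simp add: X ZU YU[symmetric])
  have "boundedly_invertible X"
    by (rule boundedly_invertibleI[OF X(1) X'(1) X'X XX'])
  moreover have "X \<circ> T = U \<circ> X" by (auto simp: XT)
  ultimately show "T \<approx>\<^sub>o U" by (auto simp: similar_op_def)
  define R where "R x = X' (inv U (X x))" for x
  have Rc: "bounded_clinear R"
    unfolding R_def[abs_def]
    by (intro bounded_clinear_compose[OF X'(1)] bounded_clinear_compose[OF unitary_opD(1)[OF unitary_op_inv[OF U]]] X(1))
  have TR: "T (R x) = x" for x
  proof -
    have "X (T (R x)) = X x" by (simp add: XT R_def XX' u(5))
    then have "X' (X (T (R x))) = X' (X x)" by simp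
    then show ?thesis by (simp only: X'X)
  qed
  have RT: "R (T x) = x" for x by (simp add: R_def XT u(6) X'X)
  show "boundedly_invertible T"
    by (rule boundedly_invertibleI[OF T Rc RT TR])
qed

section \<open>Power bounded operators quasisimilar to a unitary operator with thin spectrum\<close>

theorem theorem3p5:
  fixes F :: "'i \<Rightarrow> complex set" and I :: "'i set"
    and U :: "'b::separable_complex_hilbert \<Rightarrow> 'b"
    and \<mu> :: "complex measure"
    and T :: "'a::separable_complex_hilbert \<Rightarrow> 'a"
  assumes "countable I"
    and "\<And>k. k \<in> I \<Longrightarrow> closed (F k)"
    and "\<And>k. k \<in> I \<Longrightarrow> F k \<subseteq> unit_circle"
    and "\<And>k. k \<in> I \<Longrightarrow> arc_alpha (F k) < \<infinity>"
    and "unitary_op U"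
    and "scalar_spectral_measure U \<mu>"
    and "emeasure \<mu> unit_circle = emeasure \<mu> (\<Union>k\<in>I. F k)"
    and "bounded_clinear T"
    and "power_bounded T"
    and "T \<sim>\<^sub>o U"
  shows "T \<approx>\<^sub>o U \<and> boundedly_invertible T \<and>
    bdd_above ((\<lambda>n. onorm (op_powi T n)) ` {..0}) \<and>
    (SUP n\<in>{..0}. onorm (op_powi T n)) \<le> (SUP n\<in>{0..}. onorm (op_powi T n)) ^ 8"
proof -
  obtain P where P: "spectral_measure_of U P"
      "\<And>B. B \<in> sets circle_borel \<Longrightarrow> emeasure \<mu> B = 0 \<longleftrightarrow> P B = (\<lambda>x. 0)"
    and \<mu>: "sets \<mu> = sets circle_borel" "finite_measure \<mu>"
    using assms(6) by (auto simp: scalar_spectral_measure_def)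
  interpret unitary_with_spectral_measure U P by unfold_locales (rule assms(5), rule P(1))
  note u = unitary_opD[OF unitary]
  let ?V = "inv U"
  have null: "P (unit_circle - (\<Union>k\<in>I. F k)) x = 0" for x
  proof -
    have FU: "(\<Union>k\<in>I. F k) \<in> sets circle_borel"
      by (rule sets.countable_UN'[OF assms(1)]) (use assms(2,3) in \<open>auto intro!: circle_setsI\<close>)
    have "emeasure \<mu> (unit_circle - (\<Union>k\<in>I. F k)) = emeasure \<mu> unit_circle - emeasure \<mu> (\<Union>k\<in>I. F k)"
      by (rule emeasure_Diff)
         (use FU circle_sets_space[OF FU] finite_measure.emeasure_finite[OF \<mu>(2)] circle_sets_top
           in \<open>auto simp: \<mu>(1)\<close>)
    also have "\<dots> = 0" using assms(7) finite_measure.emeasure_finite[OF \<mu>(2)] by simp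
    finally have "emeasure \<mu> (unit_circle - (\<Union>k\<in>I. F k)) = 0" .
    then show ?thesis using P(2)[OF sets.Diff[OF circle_sets_top FU]] by metis
  qed
  obtain Y where Y: "bounded_clinear Y" "{h. Y h = 0} = {0}" "closure (range Y) = UNIV" "Y \<circ> U = T \<circ> Y"
    using assms(10) by (auto simp: quasisimilar_op_def quasiaffine_op_def)
  have inj: "h = 0" if "Y h = 0" for h using Y(2) that by blast
  have YU: "Y (U h) = T (Y h)" for h using fun_cong[OF Y(4)] by simp
  have YUn: "Y ((U ^^ n) h) = (T ^^ n) (Y h)" for n h by (induction n) (simp_all add: YU)
  have Tn: "bounded_linear (T ^^ n)" for n
    by (rule bounded_clinearD(1)[OF bounded_clinear_funpow[OF assms(8)]])
  define M0 where "M0 = (SUP n\<in>{0..}. onorm (op_powi T n))"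
  have bdd: "bdd_above ((\<lambda>n. onorm (op_powi T n)) ` {0..})"
  proof -
    have "(\<lambda>n. onorm (op_powi T n)) ` {0..} \<subseteq> range (\<lambda>n. onorm (T ^^ n))" by (auto simp: op_powi_def)
    then show ?thesis using assms(9) bdd_above_mono by (auto simp: power_bounded_def)
  qed
  have TM0: "onorm (T ^^ n) \<le> M0" for n
    using cSUP_upper[OF _ bdd, of "int n"] by (simp add: M0_def op_powi_def)
  \<comment> \<open>If the space is trivial then \<open>M0 = 0\<close>; otherwise \<open>M0 \<ge> 1\<close> because of \<open>T\<^sup>0\<close>.\<close>
  define M where "M = max 1 M0"
  have M: "M \<ge> 1" by (simp add: M_def)
  have mono: "norm (Y ((U ^^ n) x)) \<le> M * norm (Y x)" for n x
  proof -
    have "norm (Y ((U ^^ n) x)) \<le> onorm (T ^^ n) * norm (Y x)" unfolding YUn by (rule onorm[OF Tn])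
    also have "\<dots> \<le> M * norm (Y x)" using TM0[of n] by (intro mult_right_mono) (auto simp: M_def)
    finally show ?thesis .
  qed
  obtain D where D: "bounded_clinear D" "\<And>x y. inner (D x) y = inner x (D y)" "\<And>x. D (U x) = U (D x)"
    "\<And>h. inner (D h) h \<le> M\<^sup>2 * (norm (Y h))\<^sup>2" "\<And>h. (norm (Y h))\<^sup>2 \<le> M ^ 6 * inner (D h) h"
    by (rule comparable_invariant_form[OF assms(1-4) null Y(1) M mono]) blast+
  have D6: "(norm (Y h))\<^sup>2 \<le> (M ^ 3)\<^sup>2 * inner (D h) h" for h using D(5)[of h] by (simp flip: power_mult)
  have sim: "T \<approx>\<^sub>o U" "boundedly_invertible T"
    using similar_to_unitary[OF unitary assms(8) Y(1) inj Y(3) YU D(1-4) D6] M by auto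
  have bijT: "bij T" and Tinv: "bounded_clinear (inv T)"
    using sim(2) by (auto simp: boundedly_invertible_def)
  have invTY: "inv T (Y h) = Y (?V h)" for h
  proof -
    have "T (Y (?V h)) = Y h" by (simp add: YU[symmetric] u(5))
    then show ?thesis using bijT by (metis bij_is_inj inv_f_f)
  qed
  have invTYn: "(inv T ^^ n) (Y h) = Y ((?V ^^ n) h)" for n h by (induction n) (simp_all add: invTY)
  have DV: "inner (D ((?V ^^ n) h)) ((?V ^^ n) h) = inner (D h) h" for n h
  proof -
    have "inner (D (?V g)) (?V g) = inner (D g) g" for g
      using D(3)[of "?V g"] u(2)[of "D (?V g)" "?V g"] by (simp add: u(5))
    then show ?thesis by (induction n) simp_all
  qed
  have neg: "norm ((inv T ^^ n) x) \<le> M ^ 4 * norm x" for n x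
  proof (rule norm_bound_on_dense_range[OF _ Y(3)])
    show "bounded_linear (inv T ^^ n)" by (rule bounded_clinearD(1)[OF bounded_clinear_funpow[OF Tinv]])
    fix h
    have "(norm (Y ((?V ^^ n) h)))\<^sup>2 \<le> M ^ 6 * inner (D ((?V ^^ n) h)) ((?V ^^ n) h)" by (rule D(5))
    also have "\<dots> \<le> M ^ 6 * (M\<^sup>2 * (norm (Y h))\<^sup>2)" unfolding DV using M D(4) by (intro mult_left_mono) auto
    also have "\<dots> = (M ^ 4 * norm (Y h))\<^sup>2" 
    proof -
      have "M ^ 6 * M\<^sup>2 = (M ^ 4)\<^sup>2" by (simp flip: power_add power_mult)
      then show ?thesis by (simp only: power_mult_distrib mult.assoc[symmetric])
    qed
    finally show "norm ((inv T ^^ n) (Y h)) \<le> M ^ 4 * norm (Y h)"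
      unfolding invTYn by (rule power2_le_imp_le) (use M in simp)
  qed
  have op_neg: "onorm (op_powi T n) \<le> M ^ 4" if n: "n \<le> 0" for n
  proof (rule onorm_bound)
    have "op_powi T n = inv T ^^ nat (- n)" using n by (cases "n = 0") (simp_all add: op_powi_def)
    then show "norm (op_powi T n x) \<le> M ^ 4 * norm x" for x by (simp add: neg)
  qed (use M in simp)
  have bdd_neg: "bdd_above ((\<lambda>n. onorm (op_powi T n)) ` {..0})"
    using op_neg by (intro bdd_aboveI2[of _ _ "M ^ 4"]) simp
  have "(SUP n\<in>{..0}. onorm (op_powi T n)) \<le> M0 ^ 8"
  proof (cases "\<exists>x::'a. x \<noteq> 0")
    case True
    then obtain x :: 'a where x: "x \<noteq> 0" by blast
    have "norm ((T ^^ 0) x) \<le> onorm (T ^^ 0) * norm x" by (rule onorm[OF Tn])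
    then have "1 \<le> onorm (T ^^ 0)" using x by simp
    then have "M = M0" using TM0[of 0] by (simp add: M_def)
    then have "onorm (op_powi T n) \<le> M0 ^ 8" if "n \<le> 0" for n
      using op_neg[OF that] M power_increasing[of 4 8 M] by simp
    then show ?thesis by (intro cSUP_least) auto
  next
    case False
    then have zero: "onorm (op_powi T n) = 0" for n
    proof -
      have "op_powi T n = (\<lambda>x. 0)" using False by blast
      then show ?thesis by (simp add: onorm_zero)
    qed
    then show ?thesis by (simp add: M0_def)
  qed
  then show ?thesis using sim bdd_neg by (simp add: M0_def)
qed

end
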